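(* Let $\Omega=\mathbb{R}^2\times(0,1)$ and let $\boldsymbol{u}$ be a smooth solution of the steady Navier-Stokes system $$-\Delta\boldsymbol{u}+(\boldsymbol{u}\cdot\nabla)\boldsymbol{u}+\nabla P=0,\qquad \nabla\cdot\boldsymbol{u}=0\qquad\text{in }\Omega,$$ with no-slip boundary conditions $\boldsymbol{u}=0$ at $x_3=0$ and $x_3=1$. If $$\|\boldsymbol{u}\|_{L^\infty(\Omega)}<\pi,$$ then $\boldsymbol{u}$ must be a Poiseuille flow, i.e. there are constants $c_1,c_2\in\mathbb{R}$ such that $\boldsymbol{u}=(c_1x_3(1-x_3),\,c_2x_3(1-x_3),\,0)$.
   Context: $\boldsymbol{u}=(u^1,u^2,u^3)$ is a real vector field (velocity) and $P$ is a scalar function (pressure). A smooth solution means that there is a smooth scalar $P$ such that the smooth field $\boldsymbol{u}$ and $P$ satisfy the system; smoothness is understood up to the boundary, i.e. on $\mathbb{R}^2\times[0,1]$. $\|\boldsymbol{u}\|_{L^\infty(\Omega)}$ is the supremum over $\Omega$ of the Euclidean length $|\boldsymbol{u}|$. *)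

theory Defs
  imports "HOL-Analysis.Analysis"
begin

definition slab :: "(real^3) set" where
  "slab = {x. 0 < x $ 3 \<and> x $ 3 < 1}"

definition closed_slab :: "(real^3) set" where
  "closed_slab = {x. 0 \<le> x $ 3 \<and> x $ 3 \<le> 1}"

(* C^k on a set S: derivatives are taken relative to S, hence are one-sided at boundary points
   of S.  Meant for S on which such derivatives are unique, e.g. open sets or convex sets with
   nonempty interior.  On the closed slab this is smoothness up to the boundary: all partial
   derivatives exist in the interior and extend continuously to the boundary. *)
primrec Ck_on :: "nat \<Rightarrow> 'a::real_normed_vector set \<Rightarrow> ('a \<Rightarrow> 'b::real_normed_vector) \<Rightarrow> bool"
  where
    "Ck_on 0 S f \<longleftrightarrow> continuous_on S f"
  | "Ck_on (Suc k) S f \<longleftrightarrow>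
       f differentiable_on S \<and> (\<forall>v. Ck_on k S (\<lambda>x. frechet_derivative f (at x within S) v))"

definition smooth_on :: "'a::real_normed_vector set \<Rightarrow> ('a \<Rightarrow> 'b::real_normed_vector) \<Rightarrow> bool"
  where "smooth_on S f \<longleftrightarrow> (\<forall>k. Ck_on k S f)"

definition partial_deriv :: "'n \<Rightarrow> (real^'n \<Rightarrow> 'b::real_normed_vector) \<Rightarrow> real^'n \<Rightarrow> 'b" where
  "partial_deriv i f x = frechet_derivative f (at x) (axis i 1)"

definition gradient :: "(real^'n \<Rightarrow> real) \<Rightarrow> real^'n \<Rightarrow> real^'n" where
  "gradient p x = (\<chi> i. partial_deriv i p x)"

definition divergence :: "(real^'n \<Rightarrow> real^'n) \<Rightarrow> real^'n \<Rightarrow> real" where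
  "divergence u x = (\<Sum>i\<in>UNIV. partial_deriv i (\<lambda>y. u y $ i) x)"

definition laplacian :: "(real^'n \<Rightarrow> 'b::real_normed_vector) \<Rightarrow> real^'n \<Rightarrow> 'b" where
  "laplacian f x = (\<Sum>i\<in>UNIV. partial_deriv i (partial_deriv i f) x)"

(* (u . nabla) v *)
definition advection ::
    "(real^'n \<Rightarrow> real^'n) \<Rightarrow> (real^'n \<Rightarrow> 'b::real_normed_vector) \<Rightarrow> real^'n \<Rightarrow> 'b" where
  "advection u v x = (\<Sum>i\<in>UNIV. (u x $ i) *\<^sub>R partial_deriv i v x)"

definition steady_navier_stokes_on ::
    "(real^3) set \<Rightarrow> (real^3 \<Rightarrow> real^3) \<Rightarrow> (real^3 \<Rightarrow> real) \<Rightarrow> bool" where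
  "steady_navier_stokes_on \<Omega> u P \<longleftrightarrow>
     (\<forall>x\<in>\<Omega>. - laplacian u x + advection u u x + gradient P x = 0 \<and> divergence u x = 0)"

definition smooth_slab_solution :: "(real^3 \<Rightarrow> real^3) \<Rightarrow> bool" where
  "smooth_slab_solution u \<longleftrightarrow>
     smooth_on closed_slab u \<and>
     (\<exists>P. smooth_on closed_slab P \<and> steady_navier_stokes_on slab u P)"

definition no_slip :: "(real^3 \<Rightarrow> real^3) \<Rightarrow> bool" where
  "no_slip u \<longleftrightarrow> (\<forall>x. x $ 3 = 0 \<or> x $ 3 = 1 \<longrightarrow> u x = 0)"

(* Extended-real valued, so that unbounded fields have norm infinity. *)
definition Linf_norm :: "'a set \<Rightarrow> ('a \<Rightarrow> 'b::real_normed_vector) \<Rightarrow> ereal" where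
  "Linf_norm \<Omega> u = (SUP x\<in>\<Omega>. ereal (norm (u x)))"

(* Fields are total functions on real^3; only their values on the closed slab matter. *)
definition poiseuille_flow :: "(real^3 \<Rightarrow> real^3) \<Rightarrow> bool" where
  "poiseuille_flow u \<longleftrightarrow>
     (\<exists>c1 c2. \<forall>x\<in>closed_slab.
        u x = vector [c1 * x $ 3 * (1 - x $ 3), c2 * x $ 3 * (1 - x $ 3), 0])"

end

theory Submission
  imports Defs
begin

text \<open>The heart of the matter is a linear energy estimate.  Fix a horizontal vector \<open>h\<close> and put
  \<open>w(p) = u(p + h) - u(p)\<close>.  This field is solenoidal, vanishes on both walls, and satisfies the difference
  of two momentum equations.  Testing that equation with \<open>w\<close> would give
  \<open>\<integral>|Dw|\<^sup>2 \<le> sup|u| \<integral>|w||Dw| \<le> (sup|u| / \<pi>) \<integral>|Dw|\<^sup>2\<close>, since transport by \<open>u(\<cdot> + h)\<close>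
  does not change the energy and \<open>\<pi>\<close> is the constant of Wirtinger's inequality for functions that vanish
  at the ends of a vertical segment of length one.  So \<open>sup|u| < \<pi>\<close> forces \<open>w = 0\<close>, that is, \<open>u\<close> depends on
  the height only.  Then the divergence condition removes the third component, the pressure does not
  depend on the height, and the second derivative of each horizontal component is constant: this is a
  Poiseuille flow.

  Two obstacles separate this idea from a proof: the energy over the unbounded layer may be infinite, and a
  cutoff brings in the pressure, on which nothing is known.  The pressure disappears if the localised test
  field is still solenoidal.  Therefore \<open>w\<close> is written as the curl of an explicit potential \<open>A\<close> that
  vanishes on the walls (lemma \<open>potential\<close>), and the test field is \<open>curl(\<chi>A) = \<chi>w + grad \<chi> \<times> A\<close>.  The potential
  is made of vertical primitives of \<open>w\<close> and of a stream function for the vertically integrated flux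
  of \<open>w\<close>.  Here taking a difference pays off: the stream function of \<open>u\<close> may grow linearly, but that of \<open>w\<close>
  is a mean of the flux of \<open>u\<close> along the segment from \<open>p\<close> to \<open>p + h\<close>, hence bounded.

  Let \<open>J R\<close> be the energy of \<open>w\<close> over the square of half-width \<open>R\<close>.  The test yields
  \<open>J (R/2) \<le> (C/R) (J R + \<integral>(|Dw| + \<theta>))\<close>, with \<open>\<theta>\<close> the root mean square of \<open>|Dw|\<close> on vertical
  segments (lemma \<open>decay_estimate\<close>).  By Young's inequality the right-hand side is at most
  \<open>J R / 8 + C'\<close>, so \<open>J\<close> is bounded as soon as it grows at most quadratically
  (lemma \<open>doubling_growth\<close>).  Once \<open>J\<close> is bounded, the right-hand side tends to \<open>0\<close>
  (lemma \<open>sqrt_mean_sublinear\<close>), so \<open>J = 0\<close> (lemma \<open>J_vanishes\<close>).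

  Quadratic growth of \<open>J\<close> is not evident either, because no bound on the derivatives of \<open>u\<close> is given.
  It is first shown for the average of \<open>u\<close> over a horizontal square of side \<open>\<epsilon>\<close>.  The averaged field
  satisfies a momentum balance with a bounded stress in place of \<open>u\<otimes>u\<close>, and its horizontal derivatives
  are bounded by \<open>2 sup|u| / \<epsilon>\<close>, which gives quadratic growth with a constant that depends on \<open>\<epsilon>\<close>
  (lemma \<open>crude_bound\<close>).  The doubling argument replaces it by a constant independent of \<open>\<epsilon>\<close>
  (lemma \<open>quadratic_growth\<close>), and \<open>\<epsilon>\<close> can be sent to \<open>0\<close> (lemma \<open>energy_growth\<close>).\<close>

section \<open>Fields of class C1 and integration over bricks\<close>

text \<open>Throughout, these names refer to the gauge integral.\<close>

lemmas integral_cong = Henstock_Kurzweil_Integration.integral_cong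
  and integral_add = Henstock_Kurzweil_Integration.integral_add
  and integral_diff = Henstock_Kurzweil_Integration.integral_diff
  and integral_nonneg = Henstock_Kurzweil_Integration.integral_nonneg

type_synonym pt = "real \<times> real \<times> real"

definition dir :: "3 \<Rightarrow> pt" where
  "dir j = (if j = 1 then (1,0,0) else if j = 2 then (0,1,0) else (0,0,1))"

text \<open>The partial derivatives \<open>f'\<close> are part of the data.  They are taken along lines and within \<open>X\<close>, so that on the
  closed layer the vertical derivative is one-sided at the walls, which is all that the fundamental theorem
  of calculus needs.\<close>

definition C1 :: "pt set \<Rightarrow> (pt \<Rightarrow> real) \<Rightarrow> (3 \<Rightarrow> pt \<Rightarrow> real) \<Rightarrow> bool" where
  "C1 X f f' \<longleftrightarrow> continuous_on X f \<and> (\<forall>j. continuous_on X (f' j)) \<and>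
     (\<forall>j p t. p + t *\<^sub>R dir j \<in> X \<longrightarrow>
        ((\<lambda>s. f (p + s *\<^sub>R dir j)) has_real_derivative f' j (p + t *\<^sub>R dir j))
          (at t within {s. p + s *\<^sub>R dir j \<in> X}))"

definition brick :: "real \<Rightarrow> real \<Rightarrow> real \<Rightarrow> real \<Rightarrow> pt set" where
  "brick a b c d = cbox (a, c, 0) (b, d, 1)"

definition layer :: "pt set" where
  "layer = UNIV \<times> UNIV \<times> {0..1}"

lemma dir_simps [simp]: "dir 1 = (1,0,0)" "dir 2 = (0,1,0)" "dir 3 = (0,0,1)"
  by (auto simp: dir_def)

lemma brick_eq: "brick a b c d = {a..b} \<times> {c..d} \<times> {0..1}"
  by (simp add: brick_def cbox_Pair_eq)

lemma brick_sub_layer: "brick a b c d \<subseteq> layer"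
  by (auto simp: brick_eq layer_def)

lemma C1_cont: "C1 X f f' \<Longrightarrow> continuous_on X f"
  and C1_cont': "C1 X f f' \<Longrightarrow> continuous_on X (f' j)"
  and C1_deriv: "C1 X f f' \<Longrightarrow> p + t *\<^sub>R dir j \<in> X \<Longrightarrow>
     ((\<lambda>s. f (p + s *\<^sub>R dir j)) has_real_derivative f' j (p + t *\<^sub>R dir j))
          (at t within {s. p + s *\<^sub>R dir j \<in> X})"
  by (simp_all only: C1_def)

lemma C1I:
  assumes "continuous_on X f" "\<And>j. continuous_on X (f' j)"
    "\<And>j p t. p + t *\<^sub>R dir j \<in> X \<Longrightarrow>
     ((\<lambda>s. f (p + s *\<^sub>R dir j)) has_real_derivative f' j (p + t *\<^sub>R dir j))
          (at t within {s. p + s *\<^sub>R dir j \<in> X})"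
  shows "C1 X f f'"
  unfolding C1_def using assms by blast

lemma C1_subset: "C1 X f f' \<Longrightarrow> Y \<subseteq> X \<Longrightarrow> C1 Y f f'"
  by (rule C1I)
    (blast intro: continuous_on_subset C1_cont C1_cont' DERIV_subset[OF C1_deriv])+

lemma C1_const: "C1 X (\<lambda>p. c) (\<lambda>j p. 0)"
  by (rule C1I) auto

lemma C1_add: "C1 X f f' \<Longrightarrow> C1 X g g' \<Longrightarrow> C1 X (\<lambda>p. f p + g p) (\<lambda>j p. f' j p + g' j p)"
  by (rule C1I) (intro continuous_intros derivative_intros C1_cont C1_cont' C1_deriv; assumption)+

lemma C1_diff: "C1 X f f' \<Longrightarrow> C1 X g g' \<Longrightarrow> C1 X (\<lambda>p. f p - g p) (\<lambda>j p. f' j p - g' j p)"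
  by (rule C1I) (intro continuous_intros derivative_intros C1_cont C1_cont' C1_deriv; assumption)+

lemma C1_mult:
  assumes f: "C1 X f f'" and g: "C1 X g g'"
  shows "C1 X (\<lambda>p. f p * g p) (\<lambda>j p. f' j p * g p + f p * g' j p)"
proof (rule C1I)
  fix j p t assume "p + t *\<^sub>R dir j \<in> X"
  from DERIV_mult'[OF C1_deriv[OF f this] C1_deriv[OF g this]]
  show "((\<lambda>s. f (p + s *\<^sub>R dir j) * g (p + s *\<^sub>R dir j)) has_real_derivative
      f' j (p + t *\<^sub>R dir j) * g (p + t *\<^sub>R dir j) + f (p + t *\<^sub>R dir j) * g' j (p + t *\<^sub>R dir j))
     (at t within {s. p + s *\<^sub>R dir j \<in> X})"
    by (simp only: add.commute)
qed (intro continuous_intros C1_cont[OF f] C1_cont[OF g] C1_cont'[OF f] C1_cont'[OF g])+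

lemma C1_cmult: "C1 X f f' \<Longrightarrow> C1 X (\<lambda>p. c * f p) (\<lambda>j p. c * f' j p)"
  using C1_mult[OF C1_const[of X c], of f f'] by simp

lemma C1_cong:
  assumes "C1 X f f'" "\<And>p. p \<in> X \<Longrightarrow> f p = g p" "\<And>j p. p \<in> X \<Longrightarrow> f' j p = g' j p"
  shows "C1 X g g'"
proof (rule C1I)
  fix j p t assume t: "p + t *\<^sub>R dir j \<in> X"
  have "((\<lambda>s. g (p + s *\<^sub>R dir j)) has_real_derivative f' j (p + t *\<^sub>R dir j))
          (at t within {s. p + s *\<^sub>R dir j \<in> X})"
    by (rule has_field_derivative_transform_within[OF C1_deriv[OF assms(1) t] zero_less_one])
      (use t assms(2) in simp_all)
  then show "((\<lambda>s. g (p + s *\<^sub>R dir j)) has_real_derivative g' j (p + t *\<^sub>R dir j))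
          (at t within {s. p + s *\<^sub>R dir j \<in> X})"
    using assms(3)[OF t, of j] by simp
next
  show "continuous_on X g" "\<And>j. continuous_on X (g' j)"
    using C1_cont[OF assms(1)] C1_cont'[OF assms(1)] assms(2,3) by (simp_all cong: continuous_on_cong)
qed

lemma C1_compose_linear:
  fixes L :: "pt \<Rightarrow> real"
  assumes g: "\<And>t. (g has_real_derivative g' t) (at t)" "continuous_on UNIV g'"
    and L: "bounded_linear L"
  shows "C1 X (\<lambda>p. g (L p)) (\<lambda>j p. g' (L p) * L (dir j))"
proof (rule C1I)
  have c: "continuous_on UNIV g"
    using g(1) by (meson DERIV_continuous_on has_field_derivative_at_within)
  have cL: "continuous_on X L"
    using L by (rule linear_continuous_on)
  show "continuous_on X (\<lambda>p. g (L p))" "\<And>j. continuous_on X (\<lambda>p. g' (L p) * L (dir j))"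
    by (intro continuous_intros continuous_on_compose2[OF c cL] continuous_on_compose2[OF g(2) cL]; simp)+
  interpret L: bounded_linear L by (rule L)
  fix j p t Y
  have "((\<lambda>s. g (L p + s * L (dir j))) has_real_derivative g' (L p + t * L (dir j)) * L (dir j)) (at t within Y)"
    by (rule DERIV_chain2[OF g(1)]) (auto intro!: derivative_eq_intros)
  then show "((\<lambda>s. g (L (p + s *\<^sub>R dir j))) has_real_derivative g' (L (p + t *\<^sub>R dir j)) * L (dir j)) (at t within Y)"
    by (simp add: L.add L.scaleR)
qed

lemmas C1_compose_x = C1_compose_linear[OF _ _ bounded_linear_fst]
  and C1_compose_y = C1_compose_linear[OF _ _ bounded_linear_compose[OF bounded_linear_fst bounded_linear_snd]]
  and C1_compose_z = C1_compose_linear[OF _ _ bounded_linear_compose[OF bounded_linear_snd bounded_linear_snd]]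

lemma C1_slice:
  assumes "C1 X f f'"
  shows "(x,y,z) \<in> X \<Longrightarrow> ((\<lambda>t. f (t,y,z)) has_real_derivative f' 1 (x,y,z)) (at x within {t. (t,y,z) \<in> X})"
    "(x,y,z) \<in> X \<Longrightarrow> ((\<lambda>t. f (x,t,z)) has_real_derivative f' 2 (x,y,z)) (at y within {t. (x,t,z) \<in> X})"
    "(x,y,z) \<in> X \<Longrightarrow> ((\<lambda>t. f (x,y,t)) has_real_derivative f' 3 (x,y,z)) (at z within {t. (x,y,t) \<in> X})"
  using C1_deriv[OF assms, of "(0,y,z)" x 1] C1_deriv[OF assms, of "(x,0,z)" y 2]
    C1_deriv[OF assms, of "(x,y,0)" z 3] by simp_all

lemma integral_brick:
  fixes f :: "pt \<Rightarrow> real"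
  assumes "continuous_on (brick a b c d) f"
  shows "integral (brick a b c d) f =
    integral {a..b} (\<lambda>x. integral {c..d} (\<lambda>y. integral {0..1} (\<lambda>z. f (x,y,z))))"
proof -
  have "integral (brick a b c d) f = integral (cbox a b) (\<lambda>x. integral (cbox (c,0) (d,1)) (\<lambda>q. f (x,q)))"
    using assms unfolding brick_def by (rule integral_prod_continuous)
  also have "\<dots> = integral {a..b} (\<lambda>x. integral {c..d} (\<lambda>y. integral {0..1} (\<lambda>z. f (x,y,z))))"
    unfolding cbox_interval
  proof (rule integral_cong, goal_cases)
    case (1 x)
    have "continuous_on (cbox (c,0) (d,1)) (\<lambda>q. f (x,q))"
      by (rule continuous_on_compose2[OF assms])
        (use 1 in \<open>auto intro!: continuous_intros simp: brick_def cbox_Pair_eq\<close>)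
    from integral_prod_continuous[OF this] show ?case by (simp add: cbox_interval)
  qed
  finally show ?thesis .
qed

lemma brick_integrable: "continuous_on (brick a b c d) f \<Longrightarrow> f integrable_on brick a b c d"
  for f :: "pt \<Rightarrow> real"
  unfolding brick_def by (rule integrable_continuous)

lemma continuous_column:
  fixes f :: "pt \<Rightarrow> real"
  assumes "continuous_on ({a..b} \<times> {c..d} \<times> {0..1}) f"
  shows "continuous_on ({a..b} \<times> {c..d}) (\<lambda>(x,y). integral {0..1} (\<lambda>z. f (x,y,z)))"
proof -
  have "continuous_on (({a..b} \<times> {c..d}) \<times> cbox 0 1) (\<lambda>(q,z). f (fst q, snd q, z))"
    unfolding case_prod_unfold
    by (rule continuous_on_compose2[OF assms]) (auto intro!: continuous_intros simp: cbox_interval)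
  from integral_continuous_on_param[OF this] show ?thesis
    by (simp add: case_prod_unfold cbox_interval)
qed

text \<open>Allows an inequality between functions of the height alone to be used under a weight that depends on the
  horizontal coordinates.\<close>

lemma integral_brick_mono_columns:
  assumes f: "continuous_on (brick a b c d) f" and g: "continuous_on (brick a b c d) g"
    and le: "\<And>x y. x \<in> {a..b} \<Longrightarrow> y \<in> {c..d} \<Longrightarrow>
      integral {0..1} (\<lambda>z. f (x,y,z)) \<le> integral {0..1} (\<lambda>z. g (x,y,z) :: real)"
  shows "integral (brick a b c d) f \<le> integral (brick a b c d) g"
proof -
  have cy: "continuous_on {c..d} (\<lambda>y. integral {0..1} (\<lambda>z. h (x,y,z) :: real))"
    if "continuous_on (brick a b c d) h" "x \<in> {a..b}" for h x
    using continuous_on_compose2[OF continuous_column[of a b c d h], of "{c..d}" "\<lambda>y. (x,y)"] that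
    by (force simp: brick_eq intro!: continuous_intros)
  have cx: "continuous_on {a..b} (\<lambda>x. integral {c..d} (\<lambda>y. integral {0..1} (\<lambda>z. h (x,y,z) :: real)))"
    if "continuous_on (brick a b c d) h" for h
    using integral_continuous_on_param[of "{a..b}" c d "\<lambda>x y. integral {0..1} (\<lambda>z. h (x,y,z))"]
      continuous_column[of a b c d h] that
    by (simp add: brick_eq cbox_interval)
  show ?thesis
    unfolding integral_brick[OF f] integral_brick[OF g]
    by (intro integral_le integrable_continuous_interval cx cy f g le)
qed

text \<open>Integration by parts without boundary terms: by Fubini's theorem the integration in the direction of the
  derivative may be done first, and there the fundamental theorem of calculus applies.\<close>

lemma integral_deriv_zero:
  assumes C: "C1 (brick a b c d) k k'" and ab: "a \<le> b" "c \<le> d"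
    and bd: "\<And>x y z. (x,y,z) \<in> brick a b c d \<Longrightarrow> x = a \<or> x = b \<or> y = c \<or> y = d \<or> z = 0 \<or> z = 1 \<Longrightarrow> k (x,y,z) = 0"
  shows "integral (brick a b c d) (k' j) = 0"
proof -
  have cont: "continuous_on (brick a b c d) (k' j)" for j by (rule C1_cont'[OF C])
  have ftc: "integral {s..t} f' = 0"
    if "s \<le> t" "f s = 0" "f t = 0" and f: "\<And>r. r \<in> {s..t} \<Longrightarrow> (f has_real_derivative f' r) (at r within {s..t})"
    for s t and f f' :: "real \<Rightarrow> real"
    using fundamental_theorem_of_calculus[OF that(1), of f f'] that(2,3) f
    by (auto simp: has_real_derivative_iff_has_vector_derivative dest: integral_unique)
  have z: "integral {0..1} (\<lambda>z. k' 3 (x,y,z)) = 0" if xy: "x \<in> {a..b}" "y \<in> {c..d}" for x y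
  proof (rule ftc)
    have eq: "{t. (x,y,t) \<in> brick a b c d} = {0..1}" using xy by (auto simp: brick_eq)
    show "((\<lambda>z. k (x,y,z)) has_real_derivative k' 3 (x,y,z)) (at z within {0..1})" if "z \<in> {0..1}" for z
      using C1_slice(3)[OF C, of x y z] that xy unfolding eq by (auto simp: brick_eq)
  qed (use xy in \<open>auto intro!: bd simp: brick_eq\<close>)
  have y: "integral {c..d} (\<lambda>y. k' 2 (x,y,z)) = 0" if xz: "x \<in> {a..b}" "z \<in> {0..1}" for x z
  proof (rule ftc)
    have eq: "{t. (x,t,z) \<in> brick a b c d} = {c..d}" using xz by (auto simp: brick_eq)
    show "((\<lambda>y. k (x,y,z)) has_real_derivative k' 2 (x,y,z)) (at y within {c..d})" if "y \<in> {c..d}" for y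
      using C1_slice(2)[OF C, of x y z] that xz unfolding eq by (auto simp: brick_eq)
  qed (use xz ab in \<open>auto intro!: bd simp: brick_eq\<close>)
  have x: "integral {a..b} (\<lambda>x. k' 1 (x,y,z)) = 0" if yz: "y \<in> {c..d}" "z \<in> {0..1}" for y z
  proof (rule ftc)
    have eq: "{t. (t,y,z) \<in> brick a b c d} = {a..b}" using yz by (auto simp: brick_eq)
    show "((\<lambda>x. k (x,y,z)) has_real_derivative k' 1 (x,y,z)) (at x within {a..b})" if "x \<in> {a..b}" for x
      using C1_slice(1)[OF C, of x y z] that yz unfolding eq by (auto simp: brick_eq)
  qed (use yz ab in \<open>auto intro!: bd simp: brick_eq\<close>)
  consider "j = 1" | "j = 2" | "j = 3" using exhaust_3 by blast
  then show ?thesis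
  proof cases
    case 3
    have "integral {a..b} (\<lambda>x. integral {c..d} (\<lambda>y. integral {0..1} (\<lambda>z. k' 3 (x,y,z)))) =
        integral {a..b} (\<lambda>x. integral {c..d} (\<lambda>y. 0))"
      by (intro integral_cong) (rule z)
    then show ?thesis using 3 integral_brick[OF cont] by simp
  next
    case 2
    have "integral {a..b} (\<lambda>x. integral {c..d} (\<lambda>y. integral {0..1} (\<lambda>z. k' 2 (x,y,z)))) =
        integral {a..b} (\<lambda>x. integral {0..1} (\<lambda>z. integral {c..d} (\<lambda>y. k' 2 (x,y,z))))"
    proof (intro integral_cong)
      fix x assume "x \<in> {a..b}"
      then have "continuous_on (cbox (c,0) (d,1)) (\<lambda>(y,z). k' 2 (x,y,z))"
        unfolding case_prod_unfold
        by (intro continuous_on_compose2[OF cont])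
          (auto intro!: continuous_intros simp: brick_eq cbox_Pair_eq)
      from integral_swap_continuous[OF this]
      show "integral {c..d} (\<lambda>y. integral {0..1} (\<lambda>z. k' 2 (x,y,z))) =
        integral {0..1} (\<lambda>z. integral {c..d} (\<lambda>y. k' 2 (x,y,z)))" by (simp add: cbox_interval)
    qed
    also have "\<dots> = integral {a..b} (\<lambda>x. integral {0..1} (\<lambda>z::real. 0::real))"
    proof (rule integral_cong)
      fix x assume x: "x \<in> {a..b}"
      show "integral {0..1} (\<lambda>z. integral {c..d} (\<lambda>y. k' 2 (x, y, z))) = integral {0..1} (\<lambda>z::real. 0::real)"
        by (rule integral_cong) (rule y[OF x])
    qed
    finally show ?thesis using 2 integral_brick[OF cont] by simp
  next
    case 1
    have "integral (brick a b c d) (k' 1) = integral (cbox a b) (\<lambda>x. integral (cbox (c,0) (d,1)) (\<lambda>q. k' 1 (x,q)))"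
      using cont unfolding brick_def by (rule integral_prod_continuous)
    also have "\<dots> = integral (cbox (c,0) (d,1)) (\<lambda>q. integral (cbox a b) (\<lambda>x. k' 1 (x,q)))"
      by (rule integral_swap_continuous) (use cont[of 1] in \<open>simp add: brick_def case_prod_unfold\<close>)
    also have "\<dots> = integral (cbox (c,0) (d,1)) (\<lambda>q::real \<times> real. 0::real)"
      by (intro integral_cong) (use x in \<open>auto simp: cbox_Pair_eq cbox_interval\<close>)
    finally show ?thesis using 1 by simp
  qed
qed

section \<open>Horizontal translation, averages and vertical primitives\<close>

definition hor :: "real \<times> real \<Rightarrow> pt" where
  "hor h = (fst h, snd h, 0)"

lemma hor_layer [simp]: "p + hor h \<in> layer \<longleftrightarrow> p \<in> layer"
  by (cases p) (auto simp: layer_def hor_def)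

lemma hor_layer' [simp]: "p + s *\<^sub>R hor h \<in> layer \<longleftrightarrow> p \<in> layer"
  by (cases p) (auto simp: layer_def hor_def)

lemma convex_layer: "convex layer"
  unfolding layer_def by (intro convex_Times) auto

lemma convex_line: "convex X \<Longrightarrow> convex {s. p + s *\<^sub>R d \<in> X}" for d :: pt
proof (rule convexI)
  fix x y u v :: real
  assume X: "convex X" and xy: "x \<in> {s. p + s *\<^sub>R d \<in> X}" "y \<in> {s. p + s *\<^sub>R d \<in> X}"
    and uv: "0 \<le> u" "0 \<le> v" "u + v = 1"
  have "u *\<^sub>R (p + x *\<^sub>R d) + v *\<^sub>R (p + y *\<^sub>R d) \<in> X"
    using xy uv by (auto intro: convexD[OF X])
  also have "u *\<^sub>R (p + x *\<^sub>R d) + v *\<^sub>R (p + y *\<^sub>R d) = (u + v) *\<^sub>R p + (u * x + v * y) *\<^sub>R d"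
    by (simp add: algebra_simps)
  finally show "u *\<^sub>R x + v *\<^sub>R y \<in> {s. p + s *\<^sub>R d \<in> X}" using uv by simp
qed

lemma C1_shift:
  assumes f: "C1 layer f f'"
  shows "C1 layer (\<lambda>p. f (p + hor h)) (\<lambda>j p. f' j (p + hor h))"
proof (rule C1I)
  show "continuous_on layer (\<lambda>p. f (p + hor h))" "\<And>j. continuous_on layer (\<lambda>p. f' j (p + hor h))"
    by (rule continuous_on_compose2[OF C1_cont[OF f]] continuous_on_compose2[OF C1_cont'[OF f]];
        auto intro!: continuous_intros)+
next
  fix j p t assume t: "p + t *\<^sub>R dir j \<in> layer"
  have eq: "p + s *\<^sub>R dir j + hor h = (p + hor h) + s *\<^sub>R dir j" for s by simp
  have "(p + hor h) + t *\<^sub>R dir j \<in> layer" using t by (metis eq hor_layer)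
  from C1_deriv[OF f this]
  have "((\<lambda>s. f (p + s *\<^sub>R dir j + hor h)) has_real_derivative f' j (p + t *\<^sub>R dir j + hor h))
     (at t within {s. p + s *\<^sub>R dir j + hor h \<in> layer})"
    by (simp only: eq)
  then show "((\<lambda>s. f (p + s *\<^sub>R dir j + hor h)) has_real_derivative f' j (p + t *\<^sub>R dir j + hor h))
     (at t within {s. p + s *\<^sub>R dir j \<in> layer})" by (simp only: hor_layer)
qed

text \<open>Differentiation under the integral sign, in the form used for averages and primitives.\<close>

lemma C1_integral_param:
  assumes X: "convex X"
    and c: "continuous_on (X \<times> {0..1}) (\<lambda>(p,s). F p s)"
    and c': "\<And>j. j \<in> J \<Longrightarrow> continuous_on (X \<times> {0..1}) (\<lambda>(p,s). F' j p s)"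
    and d: "\<And>j p t \<sigma>. j \<in> J \<Longrightarrow> p + t *\<^sub>R dir j \<in> X \<Longrightarrow> \<sigma> \<in> {0..1::real} \<Longrightarrow>
      ((\<lambda>s. F (p + s *\<^sub>R dir j) \<sigma>) has_real_derivative F' j (p + t *\<^sub>R dir j) \<sigma>)
         (at t within {s. p + s *\<^sub>R dir j \<in> X})"
  shows "continuous_on X (\<lambda>p. integral {0..1} (F p))"
    and "\<And>j. j \<in> J \<Longrightarrow> continuous_on X (\<lambda>p. integral {0..1} (F' j p))"
    and "\<And>j p t. j \<in> J \<Longrightarrow> p + t *\<^sub>R dir j \<in> X \<Longrightarrow>
      ((\<lambda>s. integral {0..1} (F (p + s *\<^sub>R dir j))) has_real_derivative
         integral {0..1} (F' j (p + t *\<^sub>R dir j))) (at t within {s. p + s *\<^sub>R dir j \<in> X})"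
proof -
  show "continuous_on X (\<lambda>p. integral {0..1} (F p))"
    using integral_continuous_on_param[of X 0 1 F] c by (simp add: cbox_interval)
  show "\<And>j. j \<in> J \<Longrightarrow> continuous_on X (\<lambda>p. integral {0..1} (F' j p))"
    using integral_continuous_on_param[of X 0 1 "F' _"] c' by (simp add: cbox_interval)
  fix j p t assume j: "j \<in> J" and t: "p + t *\<^sub>R dir j \<in> X"
  let ?U = "{s. p + s *\<^sub>R dir j \<in> X}"
  have "((\<lambda>s. integral (cbox 0 1) (F (p + s *\<^sub>R dir j))) has_real_derivative
         integral (cbox 0 1) (F' j (p + t *\<^sub>R dir j))) (at t within ?U)"
  proof (rule leibniz_rule_field_derivative[where U = ?U and f = "\<lambda>s. F (p + s *\<^sub>R dir j)" and fx = "\<lambda>s. F' j (p + s *\<^sub>R dir j)"])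
    show "continuous_on (?U \<times> cbox 0 1) (\<lambda>(x, y). F' j (p + x *\<^sub>R dir j) y)"
      using continuous_on_compose2[OF c'[OF j], of "?U \<times> cbox 0 1" "\<lambda>(x,y). (p + x *\<^sub>R dir j, y)"]
      by (force simp: case_prod_unfold cbox_interval intro!: continuous_intros)
    show "F (p + s *\<^sub>R dir j) integrable_on cbox 0 1" if "s \<in> ?U" for s
      using continuous_on_compose2[OF c, of "cbox 0 1" "\<lambda>y. (p + s *\<^sub>R dir j, y)"] that
      by (intro integrable_continuous) (force simp: cbox_interval intro!: continuous_intros)
  qed (use d[OF j] t convex_line[OF X] in \<open>auto simp: cbox_interval\<close>)
  then show "((\<lambda>s. integral {0..1} (F (p + s *\<^sub>R dir j))) has_real_derivative
         integral {0..1} (F' j (p + t *\<^sub>R dir j))) (at t within ?U)"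
    by (simp add: cbox_interval)
qed

definition avg :: "real \<times> real \<Rightarrow> (pt \<Rightarrow> real) \<Rightarrow> pt \<Rightarrow> real" where
  "avg h f p = integral {0..1} (\<lambda>s. f (p + s *\<^sub>R hor h))"

lemma continuous_shift_param:
  assumes "continuous_on layer f"
  shows "continuous_on (layer \<times> {0..1}) (\<lambda>(p,s). f (p + s *\<^sub>R hor h))"
  unfolding case_prod_unfold
  by (rule continuous_on_compose2[OF assms]) (auto intro!: continuous_intros)

lemma C1_avg:
  assumes f: "C1 layer f f'"
  shows "C1 layer (avg h f) (\<lambda>j. avg h (f' j))"
proof -
  have D: "((\<lambda>s. f (p + s *\<^sub>R dir j + \<sigma> *\<^sub>R hor h)) has_real_derivative f' j (p + t *\<^sub>R dir j + \<sigma> *\<^sub>R hor h))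
     (at t within {s. p + s *\<^sub>R dir j \<in> layer})" if "p + t *\<^sub>R dir j \<in> layer" for j p t \<sigma>
    using C1_deriv[OF C1_shift[OF f, of "\<sigma> *\<^sub>R h"] that] by (simp add: hor_def)
  note I = C1_integral_param[of layer "\<lambda>p s. f (p + s *\<^sub>R hor h)" UNIV "\<lambda>j p s. f' j (p + s *\<^sub>R hor h)",
      OF convex_layer continuous_shift_param[OF C1_cont[OF f]] continuous_shift_param[OF C1_cont'[OF f]] D]
  show ?thesis
    unfolding avg_def by (rule C1I) (rule I; simp)+
qed

text \<open>The derivative of the average along \<open>h\<close> in the direction \<open>h\<close> is a difference.  This identity gives both the
  bound on horizontal derivatives of mollified fields and the bounded stream function of a difference.  Only
  directions parallel to an axis are considered, so that no chain rule for partial derivatives is involved;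
  they suffice because they generate all horizontal translations.\<close>

lemma avg_fundamental:
  assumes f: "C1 layer f f'" and p: "p \<in> layer" and h: "fst h = 0 \<or> snd h = 0"
  shows "fst h * avg h (f' 1) p + snd h * avg h (f' 2) p = f (p + hor h) - f p"
proof -
  have main: "c * avg h (f' j) p = f (p + hor h) - f p" if h: "hor h = c *\<^sub>R dir j" and j: "j \<noteq> 3" for c j
  proof -
    have U: "{s. p + s *\<^sub>R dir j \<in> layer} = UNIV"
      using p exhaust_3[of j] j by (cases p) (auto simp: layer_def)
    have d: "((\<lambda>s. f (p + s *\<^sub>R dir j)) has_real_derivative f' j (p + t *\<^sub>R dir j)) (at t)" for t
      using C1_deriv[OF f, of p t j] U by auto
    have "((\<lambda>s. f (p + (c * s) *\<^sub>R dir j)) has_real_derivative f' j (p + (c * t) *\<^sub>R dir j) * c) (at t within {0..1})" for t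
      by (rule DERIV_chain2[of "\<lambda>s. f (p + s *\<^sub>R dir j)" _ "\<lambda>s. c * s", OF d]) (auto intro!: derivative_eq_intros)
    then have "((\<lambda>s. f' j (p + (c * s) *\<^sub>R dir j) * c) has_integral
        f (p + (c * 1) *\<^sub>R dir j) - f (p + (c * 0) *\<^sub>R dir j)) {0..1}"
      by (intro fundamental_theorem_of_calculus) (auto simp: has_real_derivative_iff_has_vector_derivative)
    then show ?thesis
      by (simp add: avg_def h integral_unique mult.commute flip: integral_mult_right)
  qed
  from h show ?thesis
  proof
    assume "fst h = 0"
    then show ?thesis using main[of "snd h" 2] by (simp add: hor_def)
  next
    assume "snd h = 0"
    then show ?thesis using main[of "fst h" 1] by (simp add: hor_def)
  qed
qed

definition prim :: "(pt \<Rightarrow> real) \<Rightarrow> pt \<Rightarrow> real" where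
  "prim f p = integral {0..snd (snd p)} (\<lambda>s. f (fst p, fst (snd p), s))"

definition column :: "(pt \<Rightarrow> real) \<Rightarrow> pt \<Rightarrow> real" where
  "column f p = integral {0..1} (\<lambda>s. f (fst p, fst (snd p), s))"

lemma continuous_segment:
  assumes "continuous_on layer f"
  shows "continuous_on {0..1} (\<lambda>s. f (x, y, s))"
  by (rule continuous_on_compose2[OF assms]) (auto intro!: continuous_intros simp: layer_def)

text \<open>Rescaling to a fixed interval turns a primitive into a parameter integral, to which differentiation under
  the integral sign applies.\<close>

lemma prim_scaled:
  assumes "continuous_on layer f" "p \<in> layer"
  shows "prim f p = snd (snd p) * integral {0..1} (\<lambda>t. f (fst p, fst (snd p), snd (snd p) * t))"
proof -
  obtain x y z where p: "p = (x,y,z)" by (cases p) auto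
  have z: "0 \<le> z" "z \<le> 1" using assms(2) p by (auto simp: layer_def)
  have "((\<lambda>t. z * f (x,y,z * t)) has_integral prim f p) {0..1}"
  proof (cases "z = 0")
    case False
    have "((\<lambda>s. f (x,y,s)) has_integral prim f p) {0..z}"
      unfolding prim_def p fst_conv snd_conv
      by (intro integrable_integral integrable_continuous_interval
          continuous_on_subset[OF continuous_segment[OF assms(1)]]) (use z in auto)
    then have "((\<lambda>t. f (x,y,z * t)) has_integral (1 / \<bar>z\<bar>) *\<^sub>R prim f p) ((\<lambda>x. x / z) ` {0..z})"
      using has_integral_stretch_real[of "\<lambda>s. f (x,y,s)"] False by blast
    moreover have "(\<lambda>x. x / z) ` {0..z} = {0..1}"
      using z False by (auto simp: image_iff field_simps intro!: bexI[of _ "_ * z"])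
    ultimately show ?thesis
      using has_integral_mult_right[of "\<lambda>t. f (x,y,z * t)" _ "{0..1}" z] z False by fastforce
  qed (simp add: prim_def p)
  then show ?thesis by (simp add: p integral_unique flip: integral_mult_right)
qed

lemma snd_snd_dir: "j \<noteq> 3 \<Longrightarrow> snd (snd (dir j)) = 0"
  using exhaust_3[of j] by auto

text \<open>Common differentiation rule for primitives (\<open>c\<close> is the height of the point) and for integrals over whole
  vertical segments (\<open>c = 1\<close>).\<close>

lemma column_param:
  assumes f: "C1 layer f f'"
    and c: "continuous_on layer c" "\<forall>p\<in>layer. c p \<in> {0..1}"
      "\<forall>j p t. j \<noteq> 3 \<longrightarrow> c (p + t *\<^sub>R dir j) = c p"
  defines "G \<equiv> \<lambda>g p t. g (fst p, fst (snd p), c p * t) :: real"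
  shows "continuous_on layer (\<lambda>p. integral {0..1} (G f p))"
    and "\<And>j. j \<noteq> 3 \<Longrightarrow> continuous_on layer (\<lambda>p. integral {0..1} (G (f' j) p))"
    and "\<And>j p t. j \<noteq> 3 \<Longrightarrow> p + t *\<^sub>R dir j \<in> layer \<Longrightarrow>
      ((\<lambda>s. integral {0..1} (G f (p + s *\<^sub>R dir j))) has_real_derivative
         integral {0..1} (G (f' j) (p + t *\<^sub>R dir j))) (at t within {s. p + s *\<^sub>R dir j \<in> layer})"
proof -
  have C: "continuous_on (layer \<times> {0..1}) (\<lambda>(p,s). G g p s)" if "continuous_on layer g" for g
  proof -
    have "continuous_on (layer \<times> {0..1}) (\<lambda>q. c (fst q))"
      by (rule continuous_on_compose2[OF c(1)]) (auto intro!: continuous_intros)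
    moreover have "c p * s \<in> {0..1}" if "p \<in> layer" "s \<in> {0..1}" for p s
      using c(2) that by (auto intro: mult_le_one)
    ultimately show ?thesis
      unfolding G_def case_prod_unfold
      by (intro continuous_on_compose2[OF that]) (auto intro!: continuous_intros simp: layer_def)
  qed
  have D: "((\<lambda>s. G f (p + s *\<^sub>R dir j) \<sigma>) has_real_derivative G (f' j) (p + t *\<^sub>R dir j) \<sigma>)
         (at t within {s. p + s *\<^sub>R dir j \<in> layer})"
    if j: "j \<noteq> 3" and t: "p + t *\<^sub>R dir j \<in> layer" and \<sigma>: "\<sigma> \<in> {0..1}" for j p t \<sigma>
  proof -
    obtain x y z where p: "p = (x,y,z)" by (cases p) auto
    have pl: "p \<in> layer" and U: "{s. p + s *\<^sub>R dir j \<in> layer} = UNIV"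
      using t j exhaust_3[of j] by (auto simp: p layer_def)
    have m: "c p * \<sigma> \<in> {0..1}"
      using c(2) pl \<sigma> by (auto intro: mult_le_one)
    let ?q = "(x, y, c p * \<sigma>)"
    have q: "?q + s *\<^sub>R dir j = (fst (p + s *\<^sub>R dir j), fst (snd (p + s *\<^sub>R dir j)), c (p + s *\<^sub>R dir j) * \<sigma>)" for s
    proof -
      have "c (p + s *\<^sub>R dir j) = c p" using c(3) j by blast
      then show ?thesis using snd_snd_dir[OF j] by (cases "dir j") (simp add: p)
    qed
    have ql: "?q + s *\<^sub>R dir j \<in> layer" for s
      using m unfolding q layer_def using c(3) j by (auto simp: p)
    have "{s. ?q + s *\<^sub>R dir j \<in> layer} = UNIV" using ql by auto
    with C1_deriv[OF f ql[of t]] show ?thesis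
      unfolding G_def U by (simp only: q)
  qed
  note I = C1_integral_param[of layer "G f" "{j. j \<noteq> 3}" "\<lambda>j. G (f' j)", OF convex_layer C[OF C1_cont[OF f]] C[OF C1_cont'[OF f]] D]
  show "continuous_on layer (\<lambda>p. integral {0..1} (G f p))"
    and "\<And>j. j \<noteq> 3 \<Longrightarrow> continuous_on layer (\<lambda>p. integral {0..1} (G (f' j) p))"
    and "\<And>j p t. j \<noteq> 3 \<Longrightarrow> p + t *\<^sub>R dir j \<in> layer \<Longrightarrow>
      ((\<lambda>s. integral {0..1} (G f (p + s *\<^sub>R dir j))) has_real_derivative
         integral {0..1} (G (f' j) (p + t *\<^sub>R dir j))) (at t within {s. p + s *\<^sub>R dir j \<in> layer})"
    by (rule I; simp)+
qed

lemma C1_prim: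
  assumes f: "C1 layer f f'"
  shows "C1 layer (prim f) (\<lambda>j. if j = 3 then f else prim (f' j))"
proof (rule C1I)
  let ?c = "\<lambda>p::pt. snd (snd p)"
  let ?G = "\<lambda>g p t. g (fst p, fst (snd p), ?c p * t)"
  have c: "continuous_on layer ?c" "\<forall>p\<in>layer. ?c p \<in> {0..1}"
      "\<forall>j p t. j \<noteq> 3 \<longrightarrow> ?c (p + t *\<^sub>R dir j) = ?c p"
    by (auto intro!: continuous_intros simp: layer_def snd_snd_dir)
  note P = column_param[OF f c]
  have cf: "continuous_on layer f" "\<And>j. continuous_on layer (f' j)" by (rule C1_cont[OF f] C1_cont'[OF f])+
  have "continuous_on layer (\<lambda>p. ?c p * integral {0..1} (?G f p))"
    by (intro continuous_intros P(1))
  then show "continuous_on layer (prim f)"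
    by (simp add: prim_scaled[OF cf(1)] cong: continuous_on_cong)
  fix j
  have "j \<noteq> 3 \<Longrightarrow> continuous_on layer (\<lambda>p. ?c p * integral {0..1} (?G (f' j) p))"
    by (intro continuous_intros P(2))
  then show "continuous_on layer (if j = 3 then f else prim (f' j))"
    using cf by (simp add: prim_scaled[OF cf(2)] cong: continuous_on_cong)
  fix p t assume t: "p + t *\<^sub>R dir j \<in> layer"
  let ?U = "{s. p + s *\<^sub>R dir j \<in> layer}"
  show "((\<lambda>s. prim f (p + s *\<^sub>R dir j)) has_real_derivative
      (if j = 3 then f else prim (f' j)) (p + t *\<^sub>R dir j)) (at t within ?U)"
  proof (cases "j = 3")
    case False
    have cz: "?c (p + s *\<^sub>R dir j) = ?c p" for s using c(3) False by blast
    have "((\<lambda>s. ?c p * integral {0..1} (?G f (p + s *\<^sub>R dir j))) has_real_derivative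
        ?c p * integral {0..1} (?G (f' j) (p + t *\<^sub>R dir j))) (at t within ?U)"
      by (rule DERIV_cmult, rule P(3)[OF False t])
    then have "((\<lambda>s. prim f (p + s *\<^sub>R dir j)) has_real_derivative
        ?c p * integral {0..1} (?G (f' j) (p + t *\<^sub>R dir j))) (at t within ?U)"
      by (rule has_field_derivative_transform_within[OF _ zero_less_one])
        (use t in \<open>simp_all add: prim_scaled[OF cf(1)] cz del: snd_add\<close>)
    then show ?thesis using False t by (simp add: prim_scaled[OF cf(2)] cz del: snd_add)
  next
    case True
    obtain x y z where p: "p = (x,y,z)" by (cases p) auto
    have U: "?U = (\<lambda>s. s - z) ` {0..1}" unfolding True
      by (force simp: p layer_def image_iff)
    have "((\<lambda>w. integral {0..w} (\<lambda>s. f (x,y,s))) has_real_derivative f (x,y,z + t)) (at (z + t) within {0..1})"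
      by (rule integral_has_real_derivative[OF continuous_segment[OF cf(1)]])
        (use t in \<open>auto simp: True p layer_def\<close>)
    then have "((\<lambda>s. integral {0..z + s} (\<lambda>s. f (x,y,s))) has_real_derivative f (x,y,z + t) * 1) (at t within ?U)"
      by (intro DERIV_image_chain[of "\<lambda>w. integral {0..w} (\<lambda>s. f (x,y,s))" _ "\<lambda>s. z + s", unfolded o_def])
        (auto simp: U image_image intro!: derivative_eq_intros)
    then show ?thesis by (simp add: True p prim_def)
  qed
qed

lemma C1_column:
  assumes f: "C1 layer f f'"
  shows "C1 layer (column f) (\<lambda>j p. if j = 3 then 0 else column (f' j) p)"
proof (rule C1I)
  have c: "continuous_on layer (\<lambda>p. 1::real)" "\<forall>p\<in>layer. (1::real) \<in> {0..1}"
      "\<forall>j p t. j \<noteq> (3::3) \<longrightarrow> (1::real) = 1" by auto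
  note P = column_param[OF f c, unfolded mult_1]
  show "continuous_on layer (column f)"
    using P(1) by (simp add: column_def [abs_def])
  show "continuous_on layer (\<lambda>p. if j = 3 then 0 else column (f' j) p)" for j
    using P(2)[of j] by (cases "j = 3") (simp_all add: column_def [abs_def])
  fix j p t assume t: "p + t *\<^sub>R dir j \<in> layer"
  show "((\<lambda>s. column f (p + s *\<^sub>R dir j)) has_real_derivative
      (if j = 3 then 0 else column (f' j) (p + t *\<^sub>R dir j))) (at t within {s. p + s *\<^sub>R dir j \<in> layer})"
    using P(3)[OF _ t] by (cases "j = 3") (simp_all add: column_def)
qed

section \<open>The weak momentum balance\<close>

definition test_field :: "real \<Rightarrow> real \<Rightarrow> real \<Rightarrow> real \<Rightarrow> (3 \<Rightarrow> pt \<Rightarrow> real) \<Rightarrow> (3 \<Rightarrow> 3 \<Rightarrow> pt \<Rightarrow> real) \<Rightarrow> bool" where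
  "test_field a b c d \<Psi> \<Psi>' \<longleftrightarrow> a \<le> b \<and> c \<le> d \<and>
     (\<forall>i. C1 (brick a b c d) (\<Psi> i) (\<Psi>' i)) \<and>
     (\<forall>i x y z. (x,y,z) \<in> brick a b c d \<longrightarrow>
        x = a \<or> x = b \<or> y = c \<or> y = d \<or> z = 0 \<or> z = 1 \<longrightarrow> \<Psi> i (x,y,z) = 0) \<and>
     (\<forall>p\<in>brick a b c d. (\<Sum>i\<in>UNIV. \<Psi>' i i p) = 0)"

text \<open>A stress \<open>T\<close> has this property if all its horizontal translates are orthogonal to the gradients of solenoidal
  test fields, i.e. if \<open>div T\<close> is a pressure gradient in the weak sense.  Quantifying over all translates makes
  the notion stable under differences and averages, and the pressure is gone for good.\<close>

definition weak_balance :: "(3 \<Rightarrow> 3 \<Rightarrow> pt \<Rightarrow> real) \<Rightarrow> bool" where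
  "weak_balance T \<longleftrightarrow> (\<forall>h a b c d \<Psi> \<Psi>'. test_field a b c d \<Psi> \<Psi>' \<longrightarrow>
     integral (brick a b c d) (\<lambda>p. \<Sum>i\<in>UNIV. \<Sum>j\<in>UNIV. T i j (p + hor h) * \<Psi>' i j p) = 0)"

lemma weak_balanceD:
  "weak_balance T \<Longrightarrow> test_field a b c d \<Psi> \<Psi>' \<Longrightarrow>
     integral (brick a b c d) (\<lambda>p. \<Sum>i\<in>UNIV. \<Sum>j\<in>UNIV. T i j (p + hor h) * \<Psi>' i j p) = 0"
  unfolding weak_balance_def by blast

lemma brick_layer: "p \<in> brick a b c d \<Longrightarrow> p \<in> layer"
  using brick_sub_layer by blast

lemma continuous_shift: "continuous_on layer f \<Longrightarrow> continuous_on layer (\<lambda>p. f (p + hor h))"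
  by (rule continuous_on_compose2[of layer f]) (auto intro!: continuous_intros)

lemma divergence_free_weak:
  assumes T: "\<And>i j. C1 layer (T i j) (T' i j)"
    and div: "\<And>i p. p \<in> layer \<Longrightarrow> (\<Sum>j\<in>UNIV. T' i j j p) = 0"
  shows "weak_balance T"
  unfolding weak_balance_def
proof (intro allI impI)
  fix h a b c d \<Psi> \<Psi>' assume t: "test_field a b c d \<Psi> \<Psi>'"
  let ?B = "brick a b c d"
  have C: "C1 ?B (\<Psi> i) (\<Psi>' i)" for i using t by (simp add: test_field_def)
  have TC: "C1 ?B (\<lambda>p. T i j (p + hor h)) (\<lambda>k p. T' i j k (p + hor h))" for i j
    by (rule C1_subset[OF C1_shift[OF T] brick_sub_layer])
  have M: "C1 ?B (\<lambda>p. T i j (p + hor h) * \<Psi> i p)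
     (\<lambda>k p. T' i j k (p + hor h) * \<Psi> i p + T i j (p + hor h) * \<Psi>' i k p)" for i j
    by (rule C1_mult[OF TC C])
  have int: "(\<lambda>p. T' i j k (p + hor h) * \<Psi> i p + T i j (p + hor h) * \<Psi>' i k p) integrable_on ?B" for i j k
    by (rule brick_integrable[OF C1_cont'[OF M]])
  have z: "integral ?B (\<lambda>p. T' i j j (p + hor h) * \<Psi> i p + T i j (p + hor h) * \<Psi>' i j p) = 0" for i j
    by (rule integral_deriv_zero[OF M]) (use t in \<open>auto simp: test_field_def\<close>)
  have "integral ?B (\<lambda>p. \<Sum>i\<in>UNIV. \<Sum>j\<in>UNIV. T i j (p + hor h) * \<Psi>' i j p) =
      integral ?B (\<lambda>p. \<Sum>i\<in>UNIV. \<Sum>j\<in>UNIV. T' i j j (p + hor h) * \<Psi> i p + T i j (p + hor h) * \<Psi>' i j p)"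
  proof (rule integral_cong)
    fix p assume "p \<in> ?B"
    then have "p + hor h \<in> layer" by (simp add: brick_layer)
    then show "(\<Sum>i\<in>UNIV. \<Sum>j\<in>UNIV. T i j (p + hor h) * \<Psi>' i j p) =
      (\<Sum>i\<in>UNIV. \<Sum>j\<in>UNIV. T' i j j (p + hor h) * \<Psi> i p + T i j (p + hor h) * \<Psi>' i j p)"
      using div by (simp add: sum.distrib flip: sum_distrib_right)
  qed
  also have "\<dots> = 0"
    using int z by (simp add: integral_sum integrable_sum)
  finally show "integral ?B (\<lambda>p. \<Sum>i\<in>UNIV. \<Sum>j\<in>UNIV. T i j (p + hor h) * \<Psi>' i j p) = 0" .
qed

lemma weak_avg:
  assumes T: "\<And>i j. continuous_on layer (T i j)" and W: "weak_balance T"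
  shows "weak_balance (\<lambda>i j. avg h (T i j))"
  unfolding weak_balance_def
proof (intro allI impI)
  fix k a b c d \<Psi> \<Psi>' assume t: "test_field a b c d \<Psi> \<Psi>'"
  let ?B = "brick a b c d"
  have C: "C1 ?B (\<Psi> i) (\<Psi>' i)" for i using t by (simp add: test_field_def)
  define f where "f p s = (\<Sum>i\<in>UNIV. \<Sum>j\<in>UNIV. T i j (p + hor (k + s *\<^sub>R h)) * \<Psi>' i j p)" for p s
  have sh: "p + hor k + s *\<^sub>R hor h = p + hor (k + s *\<^sub>R h)" for p s
    by (cases p) (simp add: hor_def)
  have Tc: "continuous_on (?B \<times> {0..1}) (\<lambda>q. T i j (fst q + hor (k + snd q *\<^sub>R h)))" for i j
    by (rule continuous_on_compose2[OF T])
      (use brick_sub_layer in \<open>auto intro!: continuous_intros simp: hor_def\<close>, force simp: layer_def brick_eq)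
  have Pc: "continuous_on (?B \<times> {0..1}) (\<lambda>q. \<Psi>' i j (fst q))" for i j
    by (rule continuous_on_compose2[OF C1_cont'[OF C]]) (auto intro!: continuous_intros)
  have fc: "continuous_on (?B \<times> {0..1::real}) (\<lambda>(p,s). f p s)"
    unfolding f_def case_prod_unfold by (intro continuous_intros Tc Pc)
  have "integral ?B (\<lambda>p. \<Sum>i\<in>UNIV. \<Sum>j\<in>UNIV. avg h (T i j) (p + hor k) * \<Psi>' i j p) =
     integral ?B (\<lambda>p. integral {0..1} (f p))"
  proof (rule integral_cong)
    fix p assume p: "p \<in> ?B"
    have "(\<lambda>s. T i j (p + hor (k + s *\<^sub>R h)) * \<Psi>' i j p) integrable_on {0..1}" for i j
      by (intro integrable_continuous_interval continuous_intros continuous_on_compose2[OF Tc, of "{0..1}" "\<lambda>s. (p, s)", simplified])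
        (use p in auto)
    then have "integral {0..1} (f p) = (\<Sum>i\<in>UNIV. \<Sum>j\<in>UNIV. integral {0..1} (\<lambda>s. T i j (p + hor (k + s *\<^sub>R h)) * \<Psi>' i j p))"
      unfolding f_def by (simp add: integral_sum integrable_sum)
    then show "(\<Sum>i\<in>UNIV. \<Sum>j\<in>UNIV. avg h (T i j) (p + hor k) * \<Psi>' i j p) = integral {0..1} (f p)"
      by (simp add: avg_def sh)
  qed
  also have "\<dots> = integral {0..1} (\<lambda>s. integral ?B (\<lambda>p. f p s))"
    using integral_swap_continuous[of "(a,c,0)" 0 "(b,d,1)" 1 f] fc
    by (simp add: brick_def box_real cbox_Pair_eq[of "(a,c,0)"])
  also have "\<dots> = 0"
    unfolding f_def weak_balanceD[OF W t] by simp
  finally show "integral ?B (\<lambda>p. \<Sum>i\<in>UNIV. \<Sum>j\<in>UNIV. avg h (T i j) (p + hor k) * \<Psi>' i j p) = 0" .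
qed

text \<open>The full stress \<open>Du - u\<otimes>u - P I\<close> is divergence-free by the momentum equation, and its pressure part is
  pointwise orthogonal to the gradient of a solenoidal field.\<close>

lemma navier_stokes_weak:
  assumes u: "\<And>i. C1 layer (u i) (u' i)" and u': "\<And>i j. C1 layer (u' i j) (u'' i j)"
    and P: "C1 layer P P'"
    and ns: "\<And>i p. p \<in> layer \<Longrightarrow> - (\<Sum>j\<in>UNIV. u'' i j j p) + (\<Sum>j\<in>UNIV. u j p * u' i j p) + P' i p = 0"
    and div: "\<And>p. p \<in> layer \<Longrightarrow> (\<Sum>i\<in>UNIV. u' i i p) = 0"
  shows "weak_balance (\<lambda>i j p. u' i j p - u i p * u j p)"
proof -
  define T where "T i j p = u' i j p - u i p * u j p - (if i = j then 1 else 0) * P p" for i j :: 3 and p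
  define T' where "T' i j k p = u'' i j k p - (u' i k p * u j p + u i p * u' j k p)
     - (if i = j then 1 else 0) * P' k p" for i j k :: 3 and p
  have "weak_balance T"
  proof (rule divergence_free_weak)
    show "C1 layer (T i j) (T' i j)" for i j
      unfolding T_def[abs_def] T'_def[abs_def]
      by (rule C1_diff[OF C1_diff[OF u' C1_mult[OF u u]] C1_cmult[OF P]])
    fix i p assume p: "p \<in> layer"
    have "(\<Sum>j\<in>UNIV. u i p * u' j j p) = 0"
      using div[OF p] by (simp flip: sum_distrib_left)
    moreover have "(\<Sum>j\<in>UNIV. (if i = j then 1 else 0) * P' j p) = P' i p"
      by (simp add: if_distrib[of "\<lambda>x. x * _"] cong: if_cong)
    ultimately show "(\<Sum>j\<in>UNIV. T' i j j p) = 0"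
      using ns[OF p, of i] unfolding T'_def
      by (simp add: sum_subtractf sum.distrib mult.commute)
  qed
  show ?thesis
    unfolding weak_balance_def
  proof (intro allI impI)
    fix h a b c d \<Psi> \<Psi>' assume t: "test_field a b c d \<Psi> \<Psi>'"
    have "integral (brick a b c d) (\<lambda>p. \<Sum>i\<in>UNIV. \<Sum>j\<in>UNIV. (u' i j (p + hor h) - u i (p + hor h) * u j (p + hor h)) * \<Psi>' i j p) =
      integral (brick a b c d) (\<lambda>p. \<Sum>i\<in>UNIV. \<Sum>j\<in>UNIV. T i j (p + hor h) * \<Psi>' i j p)"
    proof (rule integral_cong)
      fix p assume "p \<in> brick a b c d"
      then have "(\<Sum>i\<in>UNIV. P (p + hor h) * \<Psi>' i i p) = 0"
        using t by (simp add: test_field_def flip: sum_distrib_left)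
      then show "(\<Sum>i\<in>UNIV. \<Sum>j\<in>UNIV. (u' i j (p + hor h) - u i (p + hor h) * u j (p + hor h)) * \<Psi>' i j p) =
        (\<Sum>i\<in>UNIV. \<Sum>j\<in>UNIV. T i j (p + hor h) * \<Psi>' i j p)"
        by (simp add: T_def left_diff_distrib sum_subtractf if_distrib[of "\<lambda>x. x * _"] cong: if_cong)
    qed
    also have "\<dots> = 0" by (rule weak_balanceD[OF \<open>weak_balance T\<close> t])
    finally show "integral (brick a b c d) (\<lambda>p. \<Sum>i\<in>UNIV. \<Sum>j\<in>UNIV. (u' i j (p + hor h) - u i (p + hor h) * u j (p + hor h)) * \<Psi>' i j p) = 0" .
  qed
qed

section \<open>Cutoffs and solenoidal test fields\<close>

text \<open>The components of \<open>curl(\<phi>A)\<close> for a cutoff \<open>\<phi>\<close> that does not depend on the height, with \<open>curl A\<close> replaced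
  by \<open>w\<close>.  The derivative of this field is \<open>\<phi> Dw\<close> plus an error that contains derivatives of \<open>\<phi>\<close>, which is
  the content of \<open>cut_err\<close>.\<close>

definition curl_test :: "(pt \<Rightarrow> real) \<Rightarrow> (3 \<Rightarrow> pt \<Rightarrow> real) \<Rightarrow> (3 \<Rightarrow> pt \<Rightarrow> real) \<Rightarrow> (3 \<Rightarrow> pt \<Rightarrow> real) \<Rightarrow> 3 \<Rightarrow> pt \<Rightarrow> real" where
  "curl_test \<phi> \<phi>' w A i p = (if i = 1 then \<phi> p * w 1 p + \<phi>' 2 p * A 3 p
     else if i = 2 then \<phi> p * w 2 p - \<phi>' 1 p * A 3 p
     else \<phi> p * w 3 p + (\<phi>' 1 p * A 2 p - \<phi>' 2 p * A 1 p))"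

definition cut_err :: "(3 \<Rightarrow> pt \<Rightarrow> real) \<Rightarrow> (3 \<Rightarrow> 3 \<Rightarrow> pt \<Rightarrow> real) \<Rightarrow> (3 \<Rightarrow> pt \<Rightarrow> real) \<Rightarrow> (3 \<Rightarrow> pt \<Rightarrow> real) \<Rightarrow>
    (3 \<Rightarrow> 3 \<Rightarrow> pt \<Rightarrow> real) \<Rightarrow> 3 \<Rightarrow> 3 \<Rightarrow> pt \<Rightarrow> real" where
  "cut_err \<phi>' \<phi>'' w A A' i j p = \<phi>' j p * w i p +
     (if i = 1 then \<phi>'' 2 j p * A 3 p + \<phi>' 2 p * A' 3 j p
      else if i = 2 then - (\<phi>'' 1 j p * A 3 p + \<phi>' 1 p * A' 3 j p)
      else (\<phi>'' 1 j p * A 2 p + \<phi>' 1 p * A' 2 j p) - (\<phi>'' 2 j p * A 1 p + \<phi>' 2 p * A' 1 j p))"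

lemma C1_curl_test:
  assumes \<phi>: "C1 X \<phi> \<phi>'" and \<phi>': "\<And>j. C1 X (\<phi>' j) (\<phi>'' j)"
    and w: "\<And>i. C1 X (w i) (w' i)" and A: "\<And>i. C1 X (A i) (A' i)"
  shows "C1 X (curl_test \<phi> \<phi>' w A i) (\<lambda>j p. \<phi> p * w' i j p + cut_err \<phi>' \<phi>'' w A A' i j p)"
proof -
  note 1 = C1_add[OF C1_mult[OF \<phi> w[of 1]] C1_mult[OF \<phi>'[of 2] A[of 3]]]
  note 2 = C1_diff[OF C1_mult[OF \<phi> w[of 2]] C1_mult[OF \<phi>'[of 1] A[of 3]]]
  note 3 = C1_add[OF C1_mult[OF \<phi> w[of 3]] C1_diff[OF C1_mult[OF \<phi>'[of 1] A[of 2]] C1_mult[OF \<phi>'[of 2] A[of 1]]]]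
  consider (x) "i = 1" | (y) "i = 2" | (z) "i = 3" using exhaust_3 by blast
  then show ?thesis
  proof cases
    case x
    show ?thesis by (rule C1_cong[OF 1]) (simp_all add: x curl_test_def cut_err_def algebra_simps)
  next
    case y
    show ?thesis by (rule C1_cong[OF 2]) (simp_all add: y curl_test_def cut_err_def algebra_simps)
  next
    case z
    show ?thesis by (rule C1_cong[OF 3]) (simp_all add: z curl_test_def cut_err_def algebra_simps)
  qed
qed

definition has_potential :: "(3 \<Rightarrow> pt \<Rightarrow> real) \<Rightarrow> (3 \<Rightarrow> pt \<Rightarrow> real) \<Rightarrow> (3 \<Rightarrow> 3 \<Rightarrow> pt \<Rightarrow> real) \<Rightarrow> bool" where
  "has_potential w A A' \<longleftrightarrow> (\<forall>i. C1 layer (A i) (A' i)) \<and>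
     (\<forall>p\<in>layer. w 1 p = A' 3 2 p - A' 2 3 p \<and> w 2 p = A' 1 3 p - A' 3 1 p \<and> w 3 p = A' 2 1 p - A' 1 2 p) \<and>
     (\<forall>i x y. A i (x,y,0) = 0 \<and> A i (x,y,1) = 0)"

text \<open>A high power makes the product of two such functions a square \<open>\<eta>\<^sup>2\<close> whose first and second derivatives are
  still bounded by a multiple of \<open>\<eta> / R\<close>.  The remaining factor \<open>\<eta>\<close> is what allows the gradient of \<open>w\<close> to be
  absorbed.  Only the square of half-width \<open>R\<close> is ever used, so the polynomial is not cut off outside.\<close>

definition cutoff :: "real \<Rightarrow> real \<Rightarrow> real" where "cutoff R t = (1 - t\<^sup>2 / R\<^sup>2) ^ 4"
definition cutoff' :: "real \<Rightarrow> real \<Rightarrow> real" where "cutoff' R t = - 8 * t / R\<^sup>2 * (1 - t\<^sup>2 / R\<^sup>2) ^ 3"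
definition cutoff'' :: "real \<Rightarrow> real \<Rightarrow> real" where
  "cutoff'' R t = - 8 / R\<^sup>2 * (1 - t\<^sup>2 / R\<^sup>2) ^ 3 + 48 * t\<^sup>2 / R ^ 4 * (1 - t\<^sup>2 / R\<^sup>2)\<^sup>2"

lemma cutoff_deriv: "(cutoff R has_real_derivative cutoff' R t) (at t)"
proof -
  define c where "c = inverse (R\<^sup>2)"
  have "((\<lambda>t. (1 - t\<^sup>2 * c) ^ 4) has_real_derivative - 8 * t * c * (1 - t\<^sup>2 * c) ^ 3) (at t)"
    by (auto intro!: derivative_eq_intros)
  then show ?thesis by (simp add: cutoff_def[abs_def] cutoff'_def divide_inverse c_def)
qed

lemma cutoff'_deriv: "(cutoff' R has_real_derivative cutoff'' R t) (at t)"
proof -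
  define c where "c = inverse (R\<^sup>2)"
  have "((\<lambda>t. - 8 * t * c * (1 - t\<^sup>2 * c) ^ 3) has_real_derivative
      - 8 * c * (1 - t\<^sup>2 * c) ^ 3 + 48 * t\<^sup>2 * c\<^sup>2 * (1 - t\<^sup>2 * c)\<^sup>2) (at t)"
    by (auto intro!: derivative_eq_intros simp: power2_eq_square)
  moreover have "inverse (R ^ 4) = c\<^sup>2"
    by (simp add: c_def power_inverse flip: power_mult)
  ultimately show ?thesis by (simp add: cutoff'_def[abs_def] cutoff''_def divide_inverse c_def)
qed

lemma cutoff_continuous:
  "continuous_on X (cutoff R)" "continuous_on X (cutoff' R)" "continuous_on X (cutoff'' R)"
  unfolding cutoff_def[abs_def] cutoff'_def[abs_def] cutoff''_def[abs_def] divide_inverse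
  by (intro continuous_intros)+

definition chi :: "real \<Rightarrow> pt \<Rightarrow> real" where
  "chi R p = cutoff R (fst p) * cutoff R (fst (snd p))"
definition chi' :: "real \<Rightarrow> 3 \<Rightarrow> pt \<Rightarrow> real" where
  "chi' R j p = (if j = 1 then cutoff' R (fst p) * cutoff R (fst (snd p))
     else if j = 2 then cutoff R (fst p) * cutoff' R (fst (snd p)) else 0)"
definition chi'' :: "real \<Rightarrow> 3 \<Rightarrow> 3 \<Rightarrow> pt \<Rightarrow> real" where
  "chi'' R i j p = (if i = 1 \<and> j = 1 then cutoff'' R (fst p) * cutoff R (fst (snd p))
     else if i = 2 \<and> j = 2 then cutoff R (fst p) * cutoff'' R (fst (snd p))
     else if i = 3 \<or> j = 3 then 0 else cutoff' R (fst p) * cutoff' R (fst (snd p)))"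
definition eta :: "real \<Rightarrow> pt \<Rightarrow> real" where
  "eta R p = (1 - (fst p)\<^sup>2 / R\<^sup>2)\<^sup>2 * (1 - (fst (snd p))\<^sup>2 / R\<^sup>2)\<^sup>2"

lemma C1_chi: "C1 X (chi R) (chi' R)"
proof -
  note x = C1_compose_x[OF cutoff_deriv[of R] cutoff_continuous(2)]
    and y = C1_compose_y[OF cutoff_deriv[of R] cutoff_continuous(2)]
  have "(j::3) = 1 \<or> j = 2 \<or> j = 3" for j by (rule exhaust_3)
  then show ?thesis
    by (intro C1_cong[OF C1_mult[OF x y]]) (fastforce simp: chi_def chi'_def)+
qed

lemma C1_chi': "C1 X (chi' R i) (chi'' R i)"
proof -
  note x = C1_compose_x[OF cutoff_deriv[of R] cutoff_continuous(2)]
    and y = C1_compose_y[OF cutoff_deriv[of R] cutoff_continuous(2)]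
    and x' = C1_compose_x[OF cutoff'_deriv[of R] cutoff_continuous(3)]
    and y' = C1_compose_y[OF cutoff'_deriv[of R] cutoff_continuous(3)]
  have j: "(j::3) = 1 \<or> j = 2 \<or> j = 3" for j by (rule exhaust_3)
  consider "i = 1" | "i = 2" | "i = 3" using exhaust_3 by blast
  then show ?thesis
  proof cases
    case 1
    with j show ?thesis
      by (intro C1_cong[OF C1_mult[OF x' y]]) (fastforce simp: chi'_def chi''_def)+
  next
    case 2
    show ?thesis
    proof (rule C1_cong[OF C1_mult[OF x y']], goal_cases)
      case (2 k p)
      with \<open>i = 2\<close> show ?case using j[of k] by (auto simp: chi''_def)
    qed (simp add: chi'_def 2)
  next
    case 3
    show ?thesis by (rule C1_cong[OF C1_const[of X 0]]) (simp_all add: 3 chi'_def chi''_def)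
  qed
qed

lemma chi_eta: "chi R p = (eta R p)\<^sup>2"
  by (simp add: chi_def eta_def cutoff_def power_mult_distrib flip: power_mult)

lemma cutoff_bounds:
  assumes "R \<ge> 1" "\<bar>t\<bar> \<le> R"
  defines "q \<equiv> 1 - t\<^sup>2 / R\<^sup>2"
  shows "0 \<le> q" "q \<le> 1" "\<bar>cutoff R t\<bar> \<le> q\<^sup>2" "\<bar>cutoff' R t\<bar> \<le> 8 / R * q\<^sup>2" "\<bar>cutoff'' R t\<bar> \<le> 56 / R * q\<^sup>2"
proof -
  have t: "t\<^sup>2 \<le> R\<^sup>2" using assms(2) by (metis abs_le_square_iff abs_of_nonneg abs_ge_zero order_trans)
  show q: "0 \<le> q" "q \<le> 1" using t assms(1) by (auto simp: q_def field_simps)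
  have pow: "q ^ 3 \<le> q\<^sup>2" "q ^ 4 \<le> q\<^sup>2" using q by (auto intro: power_decreasing)
  show "\<bar>cutoff R t\<bar> \<le> q\<^sup>2" using pow q by (simp add: cutoff_def flip: q_def)
  have "\<bar>cutoff' R t\<bar> = 8 * (\<bar>t\<bar> / R) / R * q ^ 3"
    unfolding cutoff'_def q_def[symmetric] using assms(1) q by (simp add: abs_mult power2_eq_square)
  also have "\<dots> \<le> 8 * 1 / R * q\<^sup>2"
    using assms pow q by (intro mult_mono divide_right_mono) (auto simp: field_simps)
  finally show "\<bar>cutoff' R t\<bar> \<le> 8 / R * q\<^sup>2" by simp
  have R: "1 / R\<^sup>2 \<le> 1 / R" using assms(1) by (simp add: field_simps power2_eq_square)
  have "\<bar>cutoff'' R t\<bar> \<le> 8 / R\<^sup>2 * q ^ 3 + 48 * (t\<^sup>2 / R\<^sup>2) / R\<^sup>2 * q\<^sup>2"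
    using q unfolding cutoff''_def q_def[symmetric]
    by (intro order_trans[OF abs_triangle_ineq]) (simp add: abs_mult power4_eq_xxxx power2_eq_square)
  also have "\<dots> \<le> 8 / R\<^sup>2 * q\<^sup>2 + 48 * 1 / R\<^sup>2 * q\<^sup>2"
    using assms(1) pow q t by (intro add_mono mult_mono divide_right_mono) (auto simp: field_simps)
  also have "\<dots> = 56 * (1 / R\<^sup>2) * q\<^sup>2" by simp
  also have "\<dots> \<le> 56 * (1 / R) * q\<^sup>2" using R assms(1) by (intro mult_mono) auto
  finally show "\<bar>cutoff'' R t\<bar> \<le> 56 / R * q\<^sup>2" by simp
qed

abbreviation Q :: "real \<Rightarrow> pt set" where "Q R \<equiv> brick (-R) R (-R) R"

lemma eta_bounds:
  assumes R: "R \<ge> 1" and p: "p \<in> Q R"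
  shows "0 \<le> eta R p" "eta R p \<le> 1" "\<bar>chi' R j p\<bar> \<le> 8 / R * eta R p" "\<bar>chi'' R i j p\<bar> \<le> 64 / R * eta R p"
proof -
  obtain x y z where xyz: "p = (x,y,z)" by (cases p) auto
  have "\<bar>x\<bar> \<le> R" "\<bar>y\<bar> \<le> R" using p by (auto simp: xyz brick_eq)
  note bx = cutoff_bounds[OF R this(1)] and by' = cutoff_bounds[OF R this(2)]
  define a b where "a = (1 - x\<^sup>2 / R\<^sup>2)\<^sup>2" and "b = (1 - y\<^sup>2 / R\<^sup>2)\<^sup>2"
  have ab: "0 \<le> a" "a \<le> 1" "0 \<le> b" "b \<le> 1"
    using bx by' by (auto simp: a_def b_def power_le_one)
  have eta: "eta R p = a * b" by (simp add: eta_def xyz a_def b_def)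
  show "0 \<le> eta R p" "eta R p \<le> 1" using ab by (auto simp: eta mult_le_one)
  have m: "\<bar>u * v\<bar> \<le> (c / R) * eta R p" if "\<bar>u\<bar> \<le> k / R * a" "\<bar>v\<bar> \<le> l * b" "k * l \<le> c" "0 \<le> k" "0 \<le> l" for u v k l c
  proof -
    have "\<bar>u * v\<bar> \<le> (k / R * a) * (l * b)"
      unfolding abs_mult using that R ab by (intro mult_mono) auto
    also have "\<dots> = (k * l) / R * (a * b)" by simp
    also have "\<dots> \<le> (c / R) * (a * b)" using that R ab by (intro mult_right_mono divide_right_mono) auto
    finally show ?thesis by (simp add: eta)
  qed
  have m': "\<bar>u * v\<bar> \<le> (c / R) * eta R p" if "\<bar>u\<bar> \<le> a" "\<bar>v\<bar> \<le> c / R * b" "0 \<le> c" for u v c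
  proof -
    have "\<bar>u * v\<bar> \<le> a * (c / R * b)"
      unfolding abs_mult using that R ab by (intro mult_mono) auto
    then show ?thesis by (simp add: eta mult_ac)
  qed
  note bx = bx[folded a_def] and by' = by'[folded b_def]
  show c1: "\<bar>chi' R j p\<bar> \<le> 8 / R * eta R p"
    using m[OF bx(4), of _ 1 8] m'[OF bx(3) by'(4)] by' R \<open>0 \<le> eta R p\<close> by (auto simp: chi'_def xyz)
  have "8 / R * b \<le> 8 * b" using R ab by (intro mult_right_mono) (auto simp: field_simps)
  then have "\<bar>cutoff' R y\<bar> \<le> 8 * b" using by'(4) by linarith
  note mm = m[OF bx(4) this, of 64]
  have le: "56 / R * eta R p \<le> 64 / R * eta R p"
    using R \<open>0 \<le> eta R p\<close> by (intro mult_right_mono divide_right_mono) auto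
  show "\<bar>chi'' R i j p\<bar> \<le> 64 / R * eta R p"
    using m[OF bx(5), of "cutoff R y" 1 56] m'[OF bx(3) by'(5)] mm by' R \<open>0 \<le> eta R p\<close> le
    by (simp add: chi''_def xyz)
qed

lemma hor_zero [simp]: "hor 0 = 0"
  by (simp add: hor_def zero_prod_def)

text \<open>The two cross terms of the divergence cancel because \<open>w\<close> is the curl of \<open>A\<close> and second derivatives of the
  cutoff are symmetric.  On the walls the field vanishes since both \<open>w\<close> and \<open>A\<close> do.\<close>

lemma test_field_curl:
  assumes R: "R > 0" and w: "\<And>i. C1 layer (w i) (w' i)" and A: "has_potential w A A'"
    and div: "\<And>p. p \<in> layer \<Longrightarrow> (\<Sum>i\<in>UNIV. w' i i p) = 0"
    and bd: "\<And>i x y. w i (x,y,0) = 0" "\<And>i x y. w i (x,y,1) = 0"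
  shows "test_field (-R) R (-R) R (curl_test (chi R) (chi' R) w A)
     (\<lambda>i j p. chi R p * w' i j p + cut_err (chi' R) (chi'' R) w A A' i j p)"
  unfolding test_field_def
proof (intro conjI allI impI ballI)
  have C: "C1 layer (A i) (A' i)" for i using A by (simp add: has_potential_def)
  show "C1 (Q R) (curl_test (chi R) (chi' R) w A i) (\<lambda>j p. chi R p * w' i j p + cut_err (chi' R) (chi'' R) w A A' i j p)" for i
    by (intro C1_curl_test C1_chi C1_chi' C1_subset[OF w brick_sub_layer] C1_subset[OF C brick_sub_layer])
  show "curl_test (chi R) (chi' R) w A i (x,y,z) = 0"
    if "x = - R \<or> x = R \<or> y = - R \<or> y = R \<or> z = 0 \<or> z = 1" for i x y z
    using that bd A R unfolding curl_test_def has_potential_def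
    by (elim disjE) (auto simp: chi_def chi'_def cutoff_def cutoff'_def)
  fix p assume "p \<in> Q R"
  then have p: "p \<in> layer" by (rule brick_layer)
  have "w 1 p = A' 3 2 p - A' 2 3 p" "w 2 p = A' 1 3 p - A' 3 1 p"
    using A p by (auto simp: has_potential_def)
  moreover have "chi R p * w' 1 1 p + chi R p * w' 2 2 p + chi R p * w' 3 3 p = 0"
    using div[OF p] by (simp add: sum_3 flip: distrib_left)
  ultimately show "(\<Sum>i\<in>UNIV. chi R p * w' i i p + cut_err (chi' R) (chi'' R) w A A' i i p) = 0"
    by (simp add: sum_3 cut_err_def chi'_def chi''_def) (simp add: algebra_simps)
qed (use R in auto)

lemma cut_err_bound:
  assumes R: "R \<ge> 1" and p: "p \<in> Q R"
    and k: "\<And>i. \<bar>w i p\<bar> \<le> k" "\<And>i. \<bar>A i p\<bar> \<le> k" "\<And>i j. \<bar>A' i j p\<bar> \<le> k"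
  shows "\<bar>cut_err (chi' R) (chi'' R) w A A' i j p\<bar> \<le> 200 / R * eta R p * k"
proof -
  let ?e = "1 / R * eta R p * k"
  have k0: "0 \<le> k" using k(1)[of 1] by linarith
  have m1: "\<bar>chi' R a p * v\<bar> \<le> 8 * ?e" if "\<bar>v\<bar> \<le> k" for a v
    using mult_mono[OF eta_bounds(3)[OF R p, of a] that] eta_bounds(1)[OF R p] R k0
    by (simp add: abs_mult)
  have m2: "\<bar>chi'' R a b p * v\<bar> \<le> 64 * ?e" if "\<bar>v\<bar> \<le> k" for a b v
    using mult_mono[OF eta_bounds(4)[OF R p, of a b] that] eta_bounds(1)[OF R p] R k0
    by (simp add: abs_mult)
  have e0: "0 \<le> ?e" using eta_bounds(1)[OF R p] R k0 by simp
  \<comment> \<open>The largest case has \<open>8 + 2 * 64 + 2 * 8\<close> in place of \<open>200\<close>.\<close>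
  have "\<bar>cut_err (chi' R) (chi'' R) w A A' i j p\<bar> \<le> 200 * ?e"
    using m1[OF k(1)[of i], of j] m2[OF k(2)[of 3], of 2 j] m1[OF k(3)[of 3 j], of 2]
      m2[OF k(2)[of 3], of 1 j] m1[OF k(3)[of 3 j], of 1] m2[OF k(2)[of 2], of 1 j] m1[OF k(3)[of 2 j], of 1]
      m2[OF k(2)[of 1], of 2 j] m1[OF k(3)[of 1 j], of 2] e0
    unfolding cut_err_def abs_le_iff
    by (cases "i = 1"; cases "i = 2"; simp only: if_True if_False simp_thms; linarith)
  then show ?thesis by simp
qed

lemma energy_identity:
  assumes R: "R > 0" and w: "\<And>i. C1 layer (w i) (w' i)" and A: "has_potential w A A'"
    and div: "\<And>p. p \<in> layer \<Longrightarrow> (\<Sum>i\<in>UNIV. w' i i p) = 0"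
    and bd: "\<And>i x y. w i (x,y,0) = 0" "\<And>i x y. w i (x,y,1) = 0"
    and W: "weak_balance (\<lambda>i j p. w' i j p - N i j p)"
  shows "integral (Q R) (\<lambda>p. \<Sum>i\<in>UNIV. \<Sum>j\<in>UNIV. (w' i j p - N i j p) *
     (chi R p * w' i j p + cut_err (chi' R) (chi'' R) w A A' i j p)) = 0"
  using weak_balanceD[OF W test_field_curl[OF R w A div bd], of 0]
  by (simp only: hor_zero add_0_right)

section \<open>Wirtinger inequality and growth lemmas\<close>

text \<open>The optimal constant is \<open>\<pi>\<close>, but any smaller \<open>\<kappa>\<close> is enough here and keeps the proof free of singular
  functions: \<open>T(x) = \<kappa> tan(\<kappa>(x - 1/2))\<close> is smooth on the closed interval and solves \<open>T' = \<kappa>\<^sup>2 + T\<^sup>2\<close>, so that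
  \<open>f'\<^sup>2 - \<kappa>\<^sup>2 f\<^sup>2 + (T f\<^sup>2)' = (f' + T f)\<^sup>2\<close>, and the boundary values of \<open>T f\<^sup>2\<close> are zero.\<close>

lemma wirtinger:
  fixes f f' :: "real \<Rightarrow> real"
  assumes f: "\<And>x. x \<in> {0..1} \<Longrightarrow> (f has_real_derivative f' x) (at x within {0..1})"
    and f': "continuous_on {0..1} f'" and bd: "f 0 = 0" "f 1 = 0" and \<kappa>: "0 < \<kappa>" "\<kappa> < pi"
  shows "\<kappa>\<^sup>2 * integral {0..1} (\<lambda>x. (f x)\<^sup>2) \<le> integral {0..1} (\<lambda>x. (f' x)\<^sup>2)"
proof -
  define T where "T x = \<kappa> * tan (\<kappa> * (x - 1/2))" for x
  have cont: "continuous_on {0..1} f" by (rule DERIV_continuous_on[OF f])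
  have cos: "cos (\<kappa> * (x - 1/2)) \<noteq> 0" if "x \<in> {0..1}" for x
  proof -
    have "\<bar>\<kappa> * (x - 1/2)\<bar> \<le> \<kappa> * (1/2)"
    proof -
      have "\<bar>x - 1/2\<bar> \<le> 1/2" using that unfolding abs_le_iff by auto
      then show ?thesis using \<kappa> unfolding abs_mult by (intro mult_mono) auto
    qed
    also have "\<dots> < pi / 2" using \<kappa> by simp
    finally have "cos (\<kappa> * (x - 1/2)) > 0" by (intro cos_gt_zero_pi) auto
    then show ?thesis by simp
  qed
  have dT: "(T has_real_derivative \<kappa>\<^sup>2 + (T x)\<^sup>2) (at x within {0..1})" if "x \<in> {0..1}" for x
  proof -
    have "((\<lambda>x. \<kappa> * tan (\<kappa> * (x - 1/2))) has_real_derivative \<kappa> * (inverse ((cos (\<kappa> * (x - 1/2)))\<^sup>2) * \<kappa>)) (at x within {0..1})"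
      using cos[OF that] by (auto intro!: derivative_eq_intros)
    moreover have "inverse ((cos y)\<^sup>2) = 1 + (tan y)\<^sup>2" if "cos y \<noteq> 0" for y :: real
      using tan_sec[OF that] by (simp add: power_inverse)
    ultimately show ?thesis
      using cos[OF that] by (simp add: T_def[abs_def] power2_eq_square algebra_simps)
  qed
  have Tc: "continuous_on {0..1} T" by (rule DERIV_continuous_on[OF dT])
  have "((\<lambda>x. T x * (f x)\<^sup>2) has_real_derivative (\<kappa>\<^sup>2 + (T x)\<^sup>2) * (f x)\<^sup>2 + T x * (2 * f x * f' x)) (at x within {0..1})"
    if "x \<in> {0..1}" for x
    by (auto intro!: derivative_eq_intros dT f that)
  then have "((\<lambda>x. (\<kappa>\<^sup>2 + (T x)\<^sup>2) * (f x)\<^sup>2 + T x * (2 * f x * f' x)) has_integral T 1 * (f 1)\<^sup>2 - T 0 * (f 0)\<^sup>2) {0..1}"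
    by (intro fundamental_theorem_of_calculus) (auto simp: has_real_derivative_iff_has_vector_derivative)
  then have I0: "((\<lambda>x. (\<kappa>\<^sup>2 + (T x)\<^sup>2) * (f x)\<^sup>2 + T x * (2 * f x * f' x)) has_integral 0) {0..1}"
    by (simp add: bd)
  have I1: "((\<lambda>x. (f' x)\<^sup>2) has_integral integral {0..1} (\<lambda>x. (f' x)\<^sup>2)) {0..1}"
    and I2: "((\<lambda>x. (f x)\<^sup>2) has_integral integral {0..1} (\<lambda>x. (f x)\<^sup>2)) {0..1}"
    by (intro integrable_integral integrable_continuous_interval continuous_intros cont f')+
  have "((\<lambda>x. (f' x)\<^sup>2 - \<kappa>\<^sup>2 * (f x)\<^sup>2 + ((\<kappa>\<^sup>2 + (T x)\<^sup>2) * (f x)\<^sup>2 + T x * (2 * f x * f' x))) has_integral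
      integral {0..1} (\<lambda>x. (f' x)\<^sup>2) - \<kappa>\<^sup>2 * integral {0..1} (\<lambda>x. (f x)\<^sup>2) + 0) {0..1}"
    by (intro has_integral_add has_integral_diff has_integral_mult_right I0 I1 I2)
  moreover have "(f' x)\<^sup>2 - \<kappa>\<^sup>2 * (f x)\<^sup>2 + ((\<kappa>\<^sup>2 + (T x)\<^sup>2) * (f x)\<^sup>2 + T x * (2 * f x * f' x)) = (f' x + T x * f x)\<^sup>2" for x
    by (simp add: power2_eq_square algebra_simps)
  ultimately have "((\<lambda>x. (f' x + T x * f x)\<^sup>2) has_integral
      integral {0..1} (\<lambda>x. (f' x)\<^sup>2) - \<kappa>\<^sup>2 * integral {0..1} (\<lambda>x. (f x)\<^sup>2)) {0..1}" by simp
  from has_integral_nonneg[OF this] show ?thesis by simp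
qed

text \<open>Iterating the first hypothesis \<open>n\<close> times leaves \<open>J(2\<^sup>n R) / 8\<^sup>n\<close>, which the second one bounds by
  \<open>K R\<^sup>2 / 2\<^sup>n\<close>; so \<open>K\<close> drops out of the conclusion.  The terms with \<open>B\<close> form a
  geometric series of ratio \<open>2\<^sup>q/8 \<le> 1/2\<close>.\<close>

lemma doubling_growth:
  fixes J :: "real \<Rightarrow> real"
  assumes step: "\<And>R. R \<ge> R0 \<Longrightarrow> J R \<le> J (2 * R) / 8 + B * R ^ q"
    and growth: "\<And>R. R \<ge> R0 \<Longrightarrow> J R \<le> K * R\<^sup>2"
    and "q \<le> 2" "0 < R0" "0 \<le> B" "R \<ge> R0"
  shows "J R \<le> 2 * B * R ^ q"
proof -
  have q: "(2::real) ^ q \<le> 4" using power_increasing[OF \<open>q \<le> 2\<close>, of "2::real"] by simp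
  have *: "J R \<le> 2 * B * R ^ q + (1/2) ^ n * (K * R\<^sup>2)" if "R \<ge> R0" for n R
    using that
  proof (induction n arbitrary: R)
    case 0
    then show ?case using growth[of R] assms by (simp add: add_increasing)
  next
    case (Suc n)
    have "J R \<le> J (2 * R) / 8 + B * R ^ q" by (rule step[OF Suc.prems])
    moreover have "J (2 * R) \<le> 2 * B * (2 * R) ^ q + (1/2) ^ n * (K * (2 * R)\<^sup>2)"
      using Suc.prems assms by (intro Suc.IH) auto
    moreover have "2 * B * (2 * R) ^ q = (B * R ^ q) * (2 * 2 ^ q)" by (simp add: power_mult_distrib)
    moreover have "(B * R ^ q) * (2 * 2 ^ q) \<le> (B * R ^ q) * 8" using q Suc.prems assms by (intro mult_left_mono) auto
    moreover have "(1/2) ^ n * (K * (2 * R)\<^sup>2) = 8 * ((1/2) ^ Suc n * (K * R\<^sup>2))" by (simp add: power_mult_distrib)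
    ultimately show ?case by linarith
  qed
  have "(\<lambda>n. 2 * B * R ^ q + (1/2) ^ n * (K * R\<^sup>2)) \<longlonglongrightarrow> 2 * B * R ^ q + 0 * (K * R\<^sup>2)"
    by (intro tendsto_intros LIMSEQ_realpow_zero) auto
  then have "(\<lambda>n. 2 * B * R ^ q + (1/2) ^ n * (K * R\<^sup>2)) \<longlonglongrightarrow> 2 * B * R ^ q" by simp
  then show ?thesis
    by (rule tendsto_lowerbound) (use * \<open>R \<ge> R0\<close> in auto)
qed

lemma Q_mono: "r \<le> R \<Longrightarrow> Q r \<subseteq> Q R"
  by (auto simp: brick_eq)

lemma Q_integrable: "continuous_on layer (f :: pt \<Rightarrow> real) \<Longrightarrow> f integrable_on Q R"
  by (rule brick_integrable[OF continuous_on_subset[OF _ brick_sub_layer]])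

lemma Q_has_integral: "continuous_on layer f \<Longrightarrow> (f has_integral integral (Q R) f) (Q R)" for f :: "pt \<Rightarrow> real"
  by (rule integrable_integral[OF Q_integrable])

lemma integral_Q_const: "R \<ge> 0 \<Longrightarrow> integral (Q R) (\<lambda>p. c) = c * (4 * R\<^sup>2)"
  by (simp add: brick_def content_Pair power2_eq_square)

text \<open>The Cauchy-Schwarz inequality on the square of area \<open>4R\<^sup>2\<close> only gives a bound by a multiple of \<open>R\<close>.  The
  constant can be made small since outside a large fixed square the integral of \<open>f\<close> is small.\<close>

lemma sqrt_mean_sublinear:
  assumes f: "continuous_on layer f" and nn: "\<And>p. p \<in> layer \<Longrightarrow> 0 \<le> f p"
    and K: "\<And>R. R \<ge> 1 \<Longrightarrow> integral (Q R) f \<le> K" and \<tau>: "0 < \<tau>"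
  shows "\<exists>R1\<ge>1. \<forall>R\<ge>R1. integral (Q R) (\<lambda>p. sqrt (f p)) \<le> \<tau> * R"
proof -
  define I where "I R = integral (Q R) f" for R
  have bdd: "bdd_above (I ` {1..})" using K by (intro bdd_aboveI2[of _ _ K]) (auto simp: I_def)
  have "\<exists>r\<in>{1..}. Sup (I ` {1..}) - \<tau>\<^sup>2 / 16 < I r"
    using less_cSup_iff[OF _ bdd, of "Sup (I ` {1..}) - \<tau>\<^sup>2 / 16"] \<tau> by auto
  then obtain r where r: "r \<ge> 1" "Sup (I ` {1..}) - \<tau>\<^sup>2 / 16 < I r" by auto
  have Ir: "I R \<le> I r + \<tau>\<^sup>2 / 16" if "R \<ge> 1" for R
  proof -
    have "I R \<le> Sup (I ` {1..})" using that by (intro cSup_upper bdd) auto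
    then show ?thesis using r by linarith
  qed
  have sc: "continuous_on layer (\<lambda>p. sqrt (f p))" by (intro continuous_intros f)
  have "integral (Q R) (\<lambda>p. sqrt (f p)) \<le> \<tau> * R" if R: "R \<ge> max r (2 * (4 * r\<^sup>2 + K) / \<tau>)" for R
  proof -
    have R1: "R \<ge> 1" "r \<le> R" using R r by auto
    \<comment> \<open>Comparing the integrals of this nonnegative function over the two squares is Young's inequality
    on their difference set.\<close>
    let ?k = "\<lambda>p. (4 * R / \<tau> * f p + \<tau> / (16 * R)) - sqrt (f p)"
    have kc: "continuous_on layer ?k" by (intro continuous_intros f sc)
    have kn: "0 \<le> ?k p" if "p \<in> layer" for p
    proof -
      define s where "s = sqrt (f p)"
      define a where "a = R / \<tau>"
      have a: "a > 0" "\<tau> / (16 * R) = 1 / (16 * a)" "4 * R / \<tau> = 4 * a" using R1 \<tau> by (simp_all add: a_def)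
      have "?k p = 4 * a * s\<^sup>2 + 1 / (16 * a) - s"
        using nn[OF that] unfolding a(2,3) by (simp add: s_def)
      also have "\<dots> = 4 * a * (s - 1 / (8 * a))\<^sup>2"
        using a(1) unfolding power2_eq_square by (simp add: divide_simps) (simp add: algebra_simps)
      finally show ?thesis using a(1) by simp
    qed
    have int: "integral (Q \<rho>) ?k = 4 * R / \<tau> * I \<rho> + \<tau> / (16 * R) * (4 * \<rho>\<^sup>2) - integral (Q \<rho>) (\<lambda>p. sqrt (f p))"
      if "\<rho> \<ge> 0" for \<rho>
    proof (rule integral_unique)
      have c: "((\<lambda>p. \<tau> / (16 * R)) has_integral \<tau> / (16 * R) * (4 * \<rho>\<^sup>2)) (Q \<rho>)"
        using integrable_integral[OF Q_integrable[OF continuous_on_const]] integral_Q_const[OF that] by metis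
      show "(?k has_integral 4 * R / \<tau> * I \<rho> + \<tau> / (16 * R) * (4 * \<rho>\<^sup>2) - integral (Q \<rho>) (\<lambda>p. sqrt (f p))) (Q \<rho>)"
        unfolding I_def
        by (intro has_integral_add has_integral_diff has_integral_mult_right c
            integrable_integral[OF Q_integrable] f sc)
    qed
    have "integral (Q r) ?k \<le> integral (Q R) ?k"
      by (rule integral_subset_le[OF Q_mono[OF R1(2)] Q_integrable[OF kc] Q_integrable[OF kc]])
        (intro ballI kn, erule brick_layer)
    then have "integral (Q R) (\<lambda>p. sqrt (f p)) \<le> integral (Q r) (\<lambda>p. sqrt (f p)) + 4 * R / \<tau> * (I R - I r)
        + \<tau> / (16 * R) * (4 * R\<^sup>2) - \<tau> / (16 * R) * (4 * r\<^sup>2)"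
      using int[of r] int[of R] R1 r(1) unfolding right_diff_distrib by linarith
    moreover have "4 * R / \<tau> * (I R - I r) \<le> 4 * R / \<tau> * (\<tau>\<^sup>2 / 16)"
      using Ir[OF R1(1)] R1 \<tau> by (intro mult_left_mono) auto
    moreover have "4 * R / \<tau> * (\<tau>\<^sup>2 / 16) = \<tau> * R / 4" using \<tau> by (simp add: power2_eq_square)
    moreover have "0 \<le> \<tau> / (16 * R) * (4 * r\<^sup>2)" using R1 \<tau> by simp
    moreover have "\<tau> / (16 * R) * (4 * R\<^sup>2) = \<tau> * R / 4" using R1 by (simp add: power2_eq_square)
    moreover have "integral (Q r) (\<lambda>p. sqrt (f p)) \<le> integral (Q r) (\<lambda>p. 1 + f p)"
    proof (rule integral_le[OF Q_integrable[OF sc] Q_integrable])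
      fix p assume "p \<in> Q r"
      then have "0 \<le> f p" using nn brick_layer by blast
      moreover have "f p \<le> (1 + f p)\<^sup>2" using \<open>0 \<le> f p\<close> by (simp add: power2_eq_square algebra_simps)
      ultimately show "sqrt (f p) \<le> 1 + f p" by (intro real_le_lsqrt) auto
    qed (intro continuous_intros f)
    moreover have "integral (Q r) (\<lambda>p. 1 + f p) = 4 * r\<^sup>2 + I r"
      using integral_add[OF Q_integrable[OF continuous_on_const[of _ 1]] Q_integrable[OF f], of r]
        r(1) integral_Q_const[of r 1]
      by (simp add: I_def)
    moreover have "4 * r\<^sup>2 + I r \<le> \<tau> * R / 2"
    proof -
      have "I r \<le> K" using K[OF r(1)] by (simp add: I_def)
      moreover have "2 * (4 * r\<^sup>2 + K) / \<tau> \<le> R" using R by simp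
      then have "2 * (4 * r\<^sup>2 + K) \<le> R * \<tau>" using \<tau> by (simp only: pos_divide_le_eq)
      ultimately show ?thesis by (simp add: mult.commute)
    qed
    ultimately show ?thesis by linarith
  qed
  then show ?thesis using r(1) by (intro exI[of _ "max r (2 * (4 * r\<^sup>2 + K) / \<tau>)"]) auto
qed

section \<open>The difference of a flow and its translate, and its vector potential\<close>

lemma column_cont:
  assumes "continuous_on layer f"
  shows "continuous_on layer (column f)"
proof -
  have "continuous_on (layer \<times> cbox 0 1) (\<lambda>(p,s). f (fst p, fst (snd p), s))"
    unfolding case_prod_unfold
    by (rule continuous_on_compose2[OF assms]) (auto intro!: continuous_intros simp: layer_def box_real)
  from integral_continuous_on_param[OF this] show ?thesis
    by (simp add: column_def[abs_def] box_real)
qed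

lemma column_const_z: "column f (x,y,z) = column f (x,y,z')"
  by (simp add: column_def)

lemma integral_brick_column:
  assumes "continuous_on layer f"
  shows "integral (brick a b c d) (column f) = integral (brick a b c d) f"
proof -
  have "continuous_on (brick a b c d) (column f)" "continuous_on (brick a b c d) f"
    using column_cont[OF assms] assms brick_sub_layer continuous_on_subset by blast+
  then show ?thesis by (simp add: integral_brick column_def)
qed

lemma square_integral_le:
  fixes f :: "real \<Rightarrow> real"
  assumes "continuous_on {0..1} f"
  shows "(integral {0..1} f)\<^sup>2 \<le> integral {0..1} (\<lambda>s. (f s)\<^sup>2)"
proof -
  define m where "m = integral {0..1} f"
  have i: "(\<lambda>s. (f s)\<^sup>2) integrable_on {0..1}" "f integrable_on {0..1}"
    by (intro integrable_continuous_interval continuous_intros assms)+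
  have "0 \<le> integral {0..1} (\<lambda>s. (f s - m)\<^sup>2)"
    by (intro integral_nonneg integrable_continuous_interval continuous_intros assms) auto
  also have "(\<lambda>s. (f s - m)\<^sup>2) = (\<lambda>s. ((f s)\<^sup>2 - 2 * m * f s) + m\<^sup>2)"
    by (auto simp: power2_eq_square algebra_simps)
  also have "integral {0..1} \<dots> = integral {0..1} (\<lambda>s. (f s)\<^sup>2) - 2 * m * m + m\<^sup>2"
  proof (rule integral_unique)
    have "((\<lambda>s. m\<^sup>2) has_integral m\<^sup>2) {0..1::real}" using has_integral_const_real[of "m\<^sup>2" 0 1] by simp
    then show "((\<lambda>s. (f s)\<^sup>2 - 2 * m * f s + m\<^sup>2) has_integral
        integral {0..1} (\<lambda>s. (f s)\<^sup>2) - 2 * m * m + m\<^sup>2) {0..1}"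
      by (intro has_integral_add has_integral_diff has_integral_mult_right i[THEN integrable_integral]
          i(2)[THEN integrable_integral, folded m_def])
  qed
  finally show ?thesis by (simp add: m_def power2_eq_square)
qed

lemma prim_column_le:
  assumes f: "continuous_on layer f" and g: "continuous_on layer g"
    and le: "\<And>p. p \<in> layer \<Longrightarrow> (f p)\<^sup>2 \<le> g p" and p: "p \<in> layer"
  shows "\<bar>prim f p\<bar> \<le> sqrt (column g p)" "\<bar>column f p\<bar> \<le> sqrt (column g p)"
proof -
  obtain x y z where xyz: "p = (x,y,z)" by (cases p) auto
  have z: "0 \<le> z" "z \<le> 1" using p by (auto simp: xyz layer_def)
  note fc = continuous_segment[OF f, of x y] and gc = continuous_segment[OF g, of x y]
  have ab: "continuous_on {0..1} (\<lambda>s. \<bar>f (x,y,s)\<bar>)" by (intro continuous_intros fc)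
  have "(integral {0..1} (\<lambda>s. \<bar>f (x,y,s)\<bar>))\<^sup>2 \<le> integral {0..1} (\<lambda>s. (f (x,y,s))\<^sup>2)"
    using square_integral_le[OF ab] by simp
  also have "\<dots> \<le> integral {0..1} (\<lambda>s. g (x,y,s))"
    by (intro integral_le integrable_continuous_interval continuous_intros fc gc le) (auto simp: layer_def)
  finally have *: "integral {0..1} (\<lambda>s. \<bar>f (x,y,s)\<bar>) \<le> sqrt (column g p)"
    by (simp add: column_def xyz real_le_rsqrt)
  have "\<bar>integral {0..w} (\<lambda>s. f (x,y,s))\<bar> \<le> integral {0..1} (\<lambda>s. \<bar>f (x,y,s)\<bar>)" if "0 \<le> w" "w \<le> 1" for w
  proof -
    have "\<bar>integral {0..w} (\<lambda>s. f (x,y,s))\<bar> \<le> integral {0..w} (\<lambda>s. \<bar>f (x,y,s)\<bar>)"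
      by (rule integral_norm_bound_integral[of "\<lambda>s. f (x,y,s)" "{0..w}" "\<lambda>s. \<bar>f (x,y,s)\<bar>", unfolded real_norm_def])
        (use that in \<open>auto intro!: integrable_continuous_interval continuous_on_subset[OF fc] continuous_on_subset[OF ab]\<close>)
    also have "\<dots> \<le> integral {0..1} (\<lambda>s. \<bar>f (x,y,s)\<bar>)"
      by (rule integral_subset_le)
        (use that in \<open>auto intro!: integrable_continuous_interval continuous_on_subset[OF ab]\<close>)
    finally show ?thesis .
  qed
  from this[of z] this[of 1] z *
  show "\<bar>prim f p\<bar> \<le> sqrt (column g p)" "\<bar>column f p\<bar> \<le> sqrt (column g p)"
    by (simp_all add: prim_def column_def xyz)
qed

lemma prim_column_bound:
  assumes f: "continuous_on layer f" and le: "\<And>p. p \<in> layer \<Longrightarrow> \<bar>f p\<bar> \<le> c" and p: "p \<in> layer"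
  shows "\<bar>prim f p\<bar> \<le> c" "\<bar>column f p\<bar> \<le> c"
proof -
  have c: "0 \<le> c" using le[OF p] by linarith
  have "(f p)\<^sup>2 \<le> c\<^sup>2" if "p \<in> layer" for p using le[OF that] c by (simp add: abs_le_square_iff[symmetric])
  from prim_column_le[OF f continuous_on_const this p]
  show "\<bar>prim f p\<bar> \<le> c" "\<bar>column f p\<bar> \<le> c"
    using c by (simp_all add: column_def)
qed

lemma avg_bound:
  assumes f: "continuous_on layer f" and le: "\<And>p. p \<in> layer \<Longrightarrow> \<bar>f p\<bar> \<le> c" and p: "p \<in> layer"
  shows "\<bar>avg h f p\<bar> \<le> c"
proof -
  have i: "(\<lambda>s. f (p + s *\<^sub>R hor h)) integrable_on {0..1}"
    by (intro integrable_continuous_interval continuous_on_compose2[OF f] continuous_intros) (use p in auto)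
  have "norm (integral {0..1} (\<lambda>s. f (p + s *\<^sub>R hor h))) \<le> integral {0..1} (\<lambda>s::real. c)"
    by (rule integral_norm_bound_integral[OF i]) (use le p in auto)
  then show ?thesis by (simp add: avg_def)
qed

lemma prim_fundamental:
  assumes f: "C1 layer f f'" and z: "\<And>x y. f (x,y,0) = 0" and p: "p \<in> layer"
  shows "prim (f' 3) p = f p"
proof -
  obtain x y z where xyz: "p = (x,y,z)" by (cases p) auto
  have zz: "0 \<le> z" "z \<le> 1" using p by (auto simp: xyz layer_def)
  have "((\<lambda>s. f' 3 (x,y,s)) has_integral f (x,y,z) - f (x,y,0)) {0..z}"
  proof (rule fundamental_theorem_of_calculus)
    fix s :: real assume s: "s \<in> {0..z}"
    then have "((\<lambda>t. f (x,y,t)) has_real_derivative f' 3 (x,y,s)) (at s within {t. (x,y,t) \<in> layer})"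
      using zz by (intro C1_slice(3)[OF f]) (auto simp: layer_def)
    then show "((\<lambda>t. f (x,y,t)) has_vector_derivative f' 3 (x,y,s)) (at s within {0..z})"
      unfolding has_real_derivative_iff_has_vector_derivative
      by (rule has_vector_derivative_within_subset) (use zz in \<open>auto simp: layer_def\<close>)
  qed (rule zz)
  then show ?thesis using assms by (simp add: prim_def xyz integral_unique)
qed

text \<open>The stress \<open>N\<close> is \<open>v\<otimes>v\<close> for a solution of the Navier-Stokes system and an average of \<open>u\<otimes>u\<close> for the mollified
  velocity.  For the growth of the energy only a bound on \<open>N\<close> matters.\<close>

locale slab_flow =
  fixes v :: "3 \<Rightarrow> pt \<Rightarrow> real" and v' N :: "3 \<Rightarrow> 3 \<Rightarrow> pt \<Rightarrow> real" and M :: real and h :: "real \<times> real"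
  assumes C1v: "\<And>i. C1 layer (v i) (v' i)"
    and div_free: "\<And>p. p \<in> layer \<Longrightarrow> (\<Sum>i\<in>UNIV. v' i i p) = 0"
    and no_slip: "\<And>i x y. v i (x,y,0) = 0" "\<And>i x y. v i (x,y,1) = 0"
    and bounded: "\<And>i p. p \<in> layer \<Longrightarrow> \<bar>v i p\<bar> \<le> M"
    and N_cont: "\<And>i j. continuous_on layer (N i j)"
    and weak: "weak_balance (\<lambda>i j p. v' i j p - N i j p)"
    and axis: "fst h = 0 \<or> snd h = 0"
begin

definition w :: "3 \<Rightarrow> pt \<Rightarrow> real" where "w i p = v i (p + hor h) - v i p"
definition w' :: "3 \<Rightarrow> 3 \<Rightarrow> pt \<Rightarrow> real" where "w' i j p = v' i j (p + hor h) - v' i j p"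
definition N\<^sub>h :: "3 \<Rightarrow> 3 \<Rightarrow> pt \<Rightarrow> real" where "N\<^sub>h i j p = N i j (p + hor h) - N i j p"

text \<open>A stream function of the vertically integrated flux of \<open>w\<close>.  As a mean over the segment from \<open>p\<close> to \<open>p + h\<close> it
  is bounded by \<open>|h| M\<close>.\<close>

definition \<psi> :: "pt \<Rightarrow> real" where
  "\<psi> p = snd h * avg h (column (v 1)) p - fst h * avg h (column (v 2)) p"

text \<open>A parabolic profile with unit integral that vanishes on the walls, and its primitive.  The flux of \<open>w\<close>
  through a vertical segment is split off with this profile, so that the primitive of the rest
  vanishes on the upper wall too.\<close>

definition g :: "pt \<Rightarrow> real" where "g p = 6 * snd (snd p) - 6 * (snd (snd p))\<^sup>2"
definition G :: "pt \<Rightarrow> real" where "G p = 3 * (snd (snd p))\<^sup>2 - 2 * (snd (snd p)) ^ 3"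

definition Z :: "3 \<Rightarrow> pt \<Rightarrow> real" where "Z k p = prim (w k) p - G p * column (w k) p"
definition Z' :: "3 \<Rightarrow> 3 \<Rightarrow> pt \<Rightarrow> real" where
  "Z' k j p = (if j = 3 then w k p - g p * column (w k) p
     else prim (w' k j) p - G p * column (w' k j) p)"

definition A :: "3 \<Rightarrow> pt \<Rightarrow> real" where
  "A i p = (if i = 1 then Z 2 p else if i = 2 then - Z 1 p else g p * \<psi> p)"
definition A' :: "3 \<Rightarrow> 3 \<Rightarrow> pt \<Rightarrow> real" where
  "A' i j p = (if i = 1 then Z' 2 j p else if i = 2 then - Z' 1 j p
     else if j = 1 then - g p * column (w 2) p
     else if j = 2 then g p * column (w 1) p
     else (6 - 12 * snd (snd p)) * \<psi> p)"

lemma C1w: "C1 layer (w i) (w' i)"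
  unfolding w_def[abs_def] w'_def[abs_def] by (intro C1_diff C1_shift C1v)

lemma w_div: "p \<in> layer \<Longrightarrow> (\<Sum>i\<in>UNIV. w' i i p) = 0"
  by (simp add: w'_def sum_subtractf div_free)

lemma w_boundary: "w i (x,y,0) = 0" "w i (x,y,1) = 0"
  by (simp_all add: w_def no_slip hor_def)

lemma Nh_cont: "continuous_on layer (N\<^sub>h i j)"
  unfolding N\<^sub>h_def[abs_def] by (intro continuous_intros continuous_shift N_cont)

lemma column_diff:
  assumes "continuous_on layer f" "continuous_on layer k"
  shows "column (\<lambda>p. f p - k p) p = column f p - column k p"
  unfolding column_def
  by (intro integral_diff integrable_continuous_interval continuous_segment assms)

lemma w_weak: "weak_balance (\<lambda>i j p. w' i j p - N\<^sub>h i j p)"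
  unfolding weak_balance_def
proof (intro allI impI)
  fix k a b c d \<Psi> \<Psi>' assume t: "test_field a b c d \<Psi> \<Psi>'"
  have C: "continuous_on (brick a b c d) (\<Psi>' i j)" for i j
    using t by (auto simp: test_field_def intro: C1_cont')
  let ?f = "\<lambda>k p. \<Sum>i\<in>UNIV. \<Sum>j\<in>UNIV. (v' i j (p + hor k) - N i j (p + hor k)) * \<Psi>' i j p"
  have i: "?f k integrable_on brick a b c d" for k
    by (intro brick_integrable continuous_intros C continuous_on_subset[OF continuous_shift brick_sub_layer]
        N_cont C1_cont'[OF C1v])
  have s: "p + hor k + hor h = p + hor (h + k)" for p by (cases p) (simp add: hor_def)
  have eq: "(\<Sum>i\<in>UNIV. \<Sum>j\<in>UNIV. (w' i j (p + hor k) - N\<^sub>h i j (p + hor k)) * \<Psi>' i j p) = ?f (h + k) p - ?f k p" for p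
    unfolding sum_subtractf[symmetric] w'_def N\<^sub>h_def s by (intro sum.cong refl) (simp only: algebra_simps)
  have "integral (brick a b c d) (\<lambda>p. \<Sum>i\<in>UNIV. \<Sum>j\<in>UNIV. (w' i j (p + hor k) - N\<^sub>h i j (p + hor k)) * \<Psi>' i j p) =
    integral (brick a b c d) (\<lambda>p. ?f (h + k) p - ?f k p)"
    by (simp only: eq)
  also have "\<dots> = 0"
    using i by (simp add: integral_diff weak_balanceD[OF weak t])
  finally show "integral (brick a b c d) (\<lambda>p. \<Sum>i\<in>UNIV. \<Sum>j\<in>UNIV. (w' i j (p + hor k) - N\<^sub>h i j (p + hor k)) * \<Psi>' i j p) = 0" .
qed

lemma column_w: "p \<in> layer \<Longrightarrow> column (w k) p = column (v k) (p + hor h) - column (v k) p"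
proof -
  have "column (w k) p = column (\<lambda>p. v k (p + hor h)) p - column (v k) p"
    unfolding w_def[abs_def] by (rule column_diff) (intro continuous_shift C1_cont[OF C1v])+
  then show ?thesis by (simp add: column_def hor_def)
qed

text \<open>The vertically integrated flux is a solenoidal field in the plane, because no fluid crosses the walls.\<close>

lemma column_div:
  assumes "p \<in> layer" shows "column (v' 1 1) p + column (v' 2 2) p = 0"
proof -
  obtain x y z where p: "p = (x,y,z)" by (cases p) auto
  have i: "(\<lambda>s. v' i j (x,y,s)) integrable_on {0..1}" for i j
    by (intro integrable_continuous_interval continuous_segment C1_cont'[OF C1v])
  have "column (v' 3 3) p = prim (v' 3 3) (x,y,1)"
    by (simp add: p prim_def column_def)
  also have "\<dots> = 0"
    using prim_fundamental[OF C1v no_slip(1), of "(x,y,1)" 3] by (simp add: layer_def no_slip)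
  finally have "column (v' 1 1) p + column (v' 2 2) p = column (v' 1 1) p + column (v' 2 2) p + column (v' 3 3) p"
    by simp
  also have "\<dots> = integral {0..1} (\<lambda>s. v' 1 1 (x,y,s) + v' 2 2 (x,y,s) + v' 3 3 (x,y,s))"
    using i by (simp add: column_def p integral_add integrable_add)
  also have "\<dots> = integral {0..1} (\<lambda>s::real. 0::real)"
    by (rule integral_cong) (use div_free in \<open>auto simp: sum_3 layer_def\<close>)
  finally show ?thesis by simp
qed

text \<open>The flux \<open>F\<close> of \<open>v\<close> is solenoidal, so the rotated gradient of the mean of \<open>h\<^sub>2F\<^sub>1 - h\<^sub>1F\<^sub>2\<close> is the mean of the
  derivative of \<open>F\<close> in the direction \<open>h\<close>, which is the flux of the difference \<open>w\<close>.\<close>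

lemma C1_psi: "C1 layer \<psi> (\<lambda>j p. if j = 1 then - column (w 2) p else if j = 2 then column (w 1) p else 0)"
proof -
  note C = C1_column[OF C1v]
  have eq: "avg h (column (v' 2 2)) p = - avg h (column (v' 1 1)) p" if "p \<in> layer" for p
  proof -
    have "column (v' 2 2) (p + s *\<^sub>R hor h) = - column (v' 1 1) (p + s *\<^sub>R hor h)" for s
      using column_div[of "p + s *\<^sub>R hor h"] that by simp
    then show ?thesis by (simp add: avg_def)
  qed
  have f: "fst h * avg h (column (v' k 1)) p + snd h * avg h (column (v' k 2)) p = column (w k) p"
    if "p \<in> layer" for k p
    using avg_fundamental[OF C[of k] that axis] that by (simp add: column_w)
  have avg0: "avg h (\<lambda>p. 0) p = 0" for p by (simp add: avg_def)
  show ?thesis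
  proof (rule C1_cong[OF C1_diff[OF C1_cmult[OF C1_avg[OF C[of 1], of h], of "snd h"] C1_cmult[OF C1_avg[OF C[of 2], of h], of "fst h"]]], goal_cases)
    case (2 j p)
    then show ?case using f[of p 1] f[of p 2] eq[of p] exhaust_3[of j]
      by (auto simp: avg0 algebra_simps)
  qed (simp add: \<psi>_def)
qed

lemma C1_g: "C1 X g (\<lambda>j p. if j = 3 then 6 - 12 * snd (snd p) else 0)"
  by (rule C1_cong[OF C1_compose_z[of "\<lambda>t. 6 * t - 6 * t\<^sup>2" "\<lambda>t. 6 - 12 * t"]])
    (use exhaust_3 in \<open>auto intro!: derivative_eq_intros continuous_intros simp: g_def snd_snd_dir\<close>)

lemma C1_G: "C1 X G (\<lambda>j p. if j = 3 then g p else 0)"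
  by (rule C1_cong[OF C1_compose_z[of "\<lambda>t. 3 * t\<^sup>2 - 2 * t ^ 3" "\<lambda>t. 6 * t - 6 * t\<^sup>2"]])
    (use exhaust_3 in \<open>auto intro!: derivative_eq_intros continuous_intros simp: g_def G_def snd_snd_dir\<close>)

lemma C1_Z: "C1 layer (Z k) (Z' k)"
  by (rule C1_cong[OF C1_diff[OF C1_prim[OF C1w[of k]] C1_mult[OF C1_G C1_column[OF C1w[of k]]]]])
    (auto simp: Z_def Z'_def)

lemma potential: "has_potential w A A'"
  unfolding has_potential_def
proof (intro conjI allI ballI)
  fix i :: 3
  consider (x) "i = 1" | (y) "i = 2" | (z) "i = 3" using exhaust_3 by blast
  then show "C1 layer (A i) (A' i)"
  proof cases
    case x
    show ?thesis by (rule C1_cong[OF C1_Z[of 2]]) (simp_all add: x A_def A'_def)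
  next
    case y
    show ?thesis by (rule C1_cong[OF C1_cmult[OF C1_Z[of 1], of "-1"]]) (simp_all add: y A_def A'_def)
  next
    case z
    have "(j::3) = 1 \<or> j = 2 \<or> j = 3" for j by (rule exhaust_3)
    then show ?thesis
      by (intro C1_cong[OF C1_mult[OF C1_g C1_psi]]) (fastforce simp: z A_def A'_def)+
  qed
next
  fix p assume p: "p \<in> layer"
  obtain x y z where xyz: "p = (x,y,z)" by (cases p) auto
  show "w 1 p = A' 3 2 p - A' 2 3 p" "w 2 p = A' 1 3 p - A' 3 1 p"
    by (simp_all add: A'_def Z'_def)
  have dv: "w' 1 1 (x,y,s) + w' 2 2 (x,y,s) = - w' 3 3 (x,y,s)" if "s \<in> {0..1}" for s
    using w_div[of "(x,y,s)"] that by (simp add: sum_3 layer_def)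
  have i: "(\<lambda>s. w' i j (x,y,s)) integrable_on {0..t}" if "t \<le> 1" for i j t
    by (intro integrable_continuous_interval continuous_on_subset[OF continuous_segment[OF C1_cont'[OF C1w]]])
      (use that in auto)
  have P: "integral {0..t} (\<lambda>s. w' 1 1 (x,y,s)) + integral {0..t} (\<lambda>s. w' 2 2 (x,y,s)) = - w 3 (x,y,t)"
    if t: "0 \<le> t" "t \<le> 1" for t
  proof -
    have "integral {0..t} (\<lambda>s. w' 1 1 (x,y,s)) + integral {0..t} (\<lambda>s. w' 2 2 (x,y,s)) =
        integral {0..t} (\<lambda>s. w' 1 1 (x,y,s) + w' 2 2 (x,y,s))"
      using i[OF t(2)] by (simp add: integral_add)
    also have "\<dots> = integral {0..t} (\<lambda>s. - w' 3 3 (x,y,s))"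
      by (rule integral_cong) (use t in \<open>auto intro!: dv\<close>)
    also have "\<dots> = - prim (w' 3 3) (x,y,t)" by (simp add: prim_def)
    also have "\<dots> = - w 3 (x,y,t)"
      using prim_fundamental[OF C1w w_boundary(1), of "(x,y,t)" 3] t by (simp add: layer_def)
    finally show ?thesis .
  qed
  have "0 \<le> z" "z \<le> 1" using p by (auto simp: xyz layer_def)
  have "A' 2 1 p - A' 1 2 p = - (prim (w' 1 1) p + prim (w' 2 2) p) + G p * (column (w' 1 1) p + column (w' 2 2) p)"
    by (simp add: A'_def Z'_def algebra_simps)
  also have "prim (w' 1 1) p + prim (w' 2 2) p = - w 3 p"
    using P[of z] p by (simp add: prim_def xyz layer_def)
  also have "column (w' 1 1) p + column (w' 2 2) p = 0"
    using P[of 1] by (simp add: column_def xyz w_boundary)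
  finally show "w 3 p = A' 2 1 p - A' 1 2 p" by simp
next
  fix i :: 3 and x y
  show "A i (x,y,0) = 0" "A i (x,y,1) = 0"
    by (auto simp: A_def Z_def G_def g_def prim_def column_def)
qed

definition H :: real where "H = \<bar>fst h\<bar> + \<bar>snd h\<bar>"

definition DW :: "pt \<Rightarrow> real" where "DW p = (\<Sum>i\<in>UNIV. \<Sum>j\<in>UNIV. (w' i j p)\<^sup>2)"

lemma M_nonneg: "0 \<le> M"
  using bounded[of 0 1] by (simp add: layer_def zero_prod_def)

lemma gG_bounds:
  assumes "p \<in> layer"
  shows "0 \<le> g p" "g p \<le> 2" "0 \<le> G p" "G p \<le> 1" "\<bar>6 - 12 * snd (snd p)\<bar> \<le> 6"
proof -
  define z where "z = snd (snd p)"
  have z: "0 \<le> z" "z \<le> 1" using assms by (auto simp: layer_def z_def)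
  have "g p = 6 * (z * (1 - z))" "g p = 3/2 - 6 * (z - 1/2)\<^sup>2"
    by (simp_all add: g_def z_def power2_eq_square algebra_simps)
  moreover have "0 \<le> z * (1 - z)" "0 \<le> (z - 1/2)\<^sup>2" using z by simp_all
  ultimately show "0 \<le> g p" "g p \<le> 2" by linarith+
  have "G p = z\<^sup>2 * (3 - 2 * z)" "1 - G p = (1 - z)\<^sup>2 * (1 + 2 * z)"
    by (simp_all add: G_def z_def power2_eq_square power3_eq_cube algebra_simps)
  moreover have "0 \<le> z\<^sup>2 * (3 - 2 * z)" "0 \<le> (1 - z)\<^sup>2 * (1 + 2 * z)" using z by simp_all
  ultimately show "0 \<le> G p" "G p \<le> 1" by linarith+
  show "\<bar>6 - 12 * snd (snd p)\<bar> \<le> 6" using z by (simp add: z_def abs_le_iff)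
qed

lemma psi_bound: "p \<in> layer \<Longrightarrow> \<bar>\<psi> p\<bar> \<le> H * M"
proof -
  assume p: "p \<in> layer"
  have "\<bar>avg h (column (v k)) p\<bar> \<le> M" for k
    by (intro avg_bound column_cont C1_cont[OF C1v] prim_column_bound(2) bounded p)
  then have "\<bar>snd h * avg h (column (v 1)) p\<bar> \<le> \<bar>snd h\<bar> * M" "\<bar>fst h * avg h (column (v 2)) p\<bar> \<le> \<bar>fst h\<bar> * M"
    unfolding abs_mult by (intro mult_left_mono; simp)+
  then show ?thesis unfolding \<psi>_def H_def by (simp add: algebra_simps)
qed

lemma DW_cont: "continuous_on layer DW"
  unfolding DW_def[abs_def] by (intro continuous_intros C1_cont'[OF C1w])

lemma w'_DW: "(w' i j p)\<^sup>2 \<le> DW p"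
proof -
  have "(w' i j p)\<^sup>2 \<le> (\<Sum>j\<in>UNIV. (w' i j p)\<^sup>2)" by (rule member_le_sum) auto
  also have "\<dots> \<le> DW p" unfolding DW_def by (rule member_le_sum[of i UNIV "\<lambda>i. \<Sum>j\<in>UNIV. (w' i j p)\<^sup>2"]) (auto intro: sum_nonneg)
  finally show ?thesis .
qed

definition \<theta> :: "pt \<Rightarrow> real" where "\<theta> p = sqrt (column DW p)"

lemma w_theta: "p \<in> layer \<Longrightarrow> \<bar>w i p\<bar> \<le> \<theta> p"
  using prim_column_le(1)[OF C1_cont'[OF C1w] DW_cont w'_DW, of p i 3] prim_fundamental[OF C1w w_boundary(1)]
  by (simp add: \<theta>_def)

lemma column_nonneg: "continuous_on layer f \<Longrightarrow> (\<And>p. 0 \<le> f p) \<Longrightarrow> 0 \<le> column f p"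
  unfolding column_def
  by (intro integral_nonneg integrable_continuous_interval continuous_segment)

lemma DW_nonneg: "0 \<le> DW p" by (simp add: DW_def sum_nonneg)

lemma theta_sq: "(\<theta> p)\<^sup>2 = column DW p"
  unfolding \<theta>_def using column_nonneg[OF DW_cont DW_nonneg] by simp

lemma theta_nonneg: "0 \<le> \<theta> p" unfolding \<theta>_def using column_nonneg[OF DW_cont DW_nonneg] by simp

text \<open>Every entry of the potential is built from vertical means and primitives of the difference
  and of its horizontal derivatives, except for the stream function, which is only bounded.\<close>

lemma potential_bounds:
  assumes p: "p \<in> layer" and nn: "0 \<le> t" "0 \<le> b"
    and w: "\<And>k. \<bar>w k p\<bar> \<le> t" "\<And>k. \<bar>prim (w k) p\<bar> \<le> t" "\<And>k. \<bar>column (w k) p\<bar> \<le> t"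
    and w': "\<And>k j. j \<noteq> 3 \<Longrightarrow> \<bar>prim (w' k j) p\<bar> \<le> t" "\<And>k j. j \<noteq> 3 \<Longrightarrow> \<bar>column (w' k j) p\<bar> \<le> t"
    and \<psi>: "\<bar>\<psi> p\<bar> \<le> b"
  shows "\<bar>w i p\<bar> \<le> 3 * t + 6 * b" "\<bar>A i p\<bar> \<le> 3 * t + 6 * b" "\<bar>A' i j p\<bar> \<le> 3 * t + 6 * b"
proof -
  note gG = gG_bounds[OF p]
  have g: "\<bar>g p * x\<bar> \<le> 2 * c" if "\<bar>x\<bar> \<le> c" for x c
    unfolding abs_mult using gG that by (intro mult_mono) auto
  have G: "\<bar>G p * x\<bar> \<le> c" if "\<bar>x\<bar> \<le> c" for x c
    using mult_mono[of "\<bar>G p\<bar>" 1 "\<bar>x\<bar>" c] gG that by (simp add: abs_mult)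
  have g': "\<bar>(6 - 12 * snd (snd p)) * \<psi> p\<bar> \<le> 6 * b"
    unfolding abs_mult using gG \<psi> by (intro mult_mono) auto
  have Z: "\<bar>Z k p\<bar> \<le> 2 * t" for k
    unfolding Z_def using abs_triangle_ineq4[of "prim (w k) p" "G p * column (w k) p"] w(2)[of k] G[OF w(3)[of k]] by linarith
  have Z': "\<bar>Z' k j p\<bar> \<le> 3 * t" for k j
    using abs_triangle_ineq4[of "w k p" "g p * column (w k) p"] w(1)[of k] g[OF w(3)[of k]]
      abs_triangle_ineq4[of "prim (w' k j) p" "G p * column (w' k j) p"] w'(1)[of j k] G[OF w'(2)[of j k]] nn
    unfolding Z'_def by (cases "j = 3") auto
  show "\<bar>w i p\<bar> \<le> 3 * t + 6 * b" using w(1)[of i] nn by linarith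
  show "\<bar>A i p\<bar> \<le> 3 * t + 6 * b"
    using Z[of 1] Z[of 2] g[OF \<psi>] nn unfolding A_def by auto
  show "\<bar>A' i j p\<bar> \<le> 3 * t + 6 * b"
    using Z'[of 1 j] Z'[of 2 j] g[OF w(3)[of 1]] g[OF w(3)[of 2]] g' nn unfolding A'_def by auto
qed

lemma theta_bounds:
  assumes p: "p \<in> layer"
  shows "\<bar>w i p\<bar> \<le> 3 * \<theta> p + 6 * (H * M)" "\<bar>A i p\<bar> \<le> 3 * \<theta> p + 6 * (H * M)"
    "\<bar>A' i j p\<bar> \<le> 3 * \<theta> p + 6 * (H * M)"
proof goal_cases
  obtain x y z where xyz: "p = (x,y,z)" by (cases p) auto
  have t: "\<theta> (x,y,s) = \<theta> p" for s
    using column_const_z[of DW x y s z] by (simp add: \<theta>_def xyz)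
  have "(w k q)\<^sup>2 \<le> column DW q" if "q \<in> layer" for k q
    using w_theta[OF that, of k] theta_sq[of q] theta_nonneg[of q] by (metis power2_abs power_mono abs_ge_zero)
  from prim_column_le[OF C1_cont[OF C1w] column_cont[OF DW_cont] this p]
  have w: "\<bar>prim (w k) p\<bar> \<le> \<theta> p" "\<bar>column (w k) p\<bar> \<le> \<theta> p" for k
    by (simp_all add: \<theta>_def column_def)
  have w': "\<bar>prim (w' k j) p\<bar> \<le> \<theta> p" "\<bar>column (w' k j) p\<bar> \<le> \<theta> p" for k j
    using prim_column_le[OF C1_cont'[OF C1w] DW_cont w'_DW p, of k j] by (simp_all add: \<theta>_def)
  have HM: "0 \<le> H * M" using M_nonneg by (simp add: H_def)
  note B = potential_bounds[OF p theta_nonneg HM w_theta[OF p] w w' psi_bound[OF p]]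
  case 1 show ?case by (rule B)
  case 2 show ?case by (rule B)
  case 3 show ?case by (rule B)
qed

lemma sup_bounds:
  assumes p: "p \<in> layer" and D: "\<And>i j p. p \<in> layer \<Longrightarrow> j \<noteq> 3 \<Longrightarrow> \<bar>v' i j p\<bar> \<le> D"
  shows "\<bar>w i p\<bar> \<le> 3 * (2 * M + 2 * D) + 6 * (H * M)" "\<bar>A i p\<bar> \<le> 3 * (2 * M + 2 * D) + 6 * (H * M)"
    "\<bar>A' i j p\<bar> \<le> 3 * (2 * M + 2 * D) + 6 * (H * M)"
proof goal_cases
  have D0: "0 \<le> D" using D[OF p, of 1 1] by simp
  have w: "\<bar>w k q\<bar> \<le> 2 * M + 2 * D" if "q \<in> layer" for k q
    using bounded[OF that, of k] bounded[of "q + hor h" k] that D0 unfolding w_def by simp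
  have w': "\<bar>w' k j q\<bar> \<le> 2 * M + 2 * D" if "q \<in> layer" "j \<noteq> 3" for k j q
    using D[OF that, of k] D[of "q + hor h" j k] that M_nonneg unfolding w'_def by simp
  have nn: "0 \<le> 2 * M + 2 * D" "0 \<le> H * M" using D0 M_nonneg by (auto simp: H_def)
  note B = potential_bounds[OF p nn w[OF p] prim_column_bound[OF C1_cont[OF C1w] w p]
      prim_column_bound[OF C1_cont'[OF C1w] w' p] psi_bound[OF p]]
  case 1 show ?case by (rule B; assumption)
  case 2 show ?case by (rule B; assumption)
  case 3 show ?case by (rule B; assumption)
qed

end

section \<open>Quadratic growth of the energy\<close>

lemma chi_lower:
  assumes R: "0 < R" and p: "p \<in> Q (R/2)"
  shows "1 \<le> 10 * chi R p"
proof -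
  obtain x y z where xyz: "p = (x,y,z)" by (cases p) auto
  have c: "(3/4) ^ 4 \<le> cutoff R t" if "\<bar>t\<bar> \<le> R / 2" for t
  proof -
    have "t\<^sup>2 \<le> (R/2)\<^sup>2" using that by (metis abs_le_square_iff abs_of_nonneg abs_ge_zero order_trans)
    then have "3/4 \<le> 1 - t\<^sup>2 / R\<^sup>2" using R by (simp add: field_simps power2_eq_square)
    then show ?thesis unfolding cutoff_def by (rule power_mono) simp
  qed
  have "\<bar>x\<bar> \<le> R / 2" "\<bar>y\<bar> \<le> R / 2" using p by (auto simp: xyz brick_eq)
  then have "(3/4) ^ 4 * (3/4) ^ 4 \<le> chi R p"
    unfolding chi_def xyz fst_conv snd_conv by (intro mult_mono c order_trans[OF _ c]) auto
  \<comment> \<open>\<open>(3/4)\<^sup>8\<close> exceeds \<open>1/10\<close>.\<close>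
  then show ?thesis by (simp add: power_def)
qed

lemma chi_bounds: "R \<ge> 1 \<Longrightarrow> p \<in> Q R \<Longrightarrow> 0 \<le> chi R p \<and> chi R p \<le> eta R p \<and> chi R p \<le> 1"
  using eta_bounds(1,2)[of R p] unfolding chi_eta power2_eq_square
  by (auto intro: mult_left_le mult_le_one)

lemma chi_cont: "continuous_on X (chi R)" and chi'_cont: "continuous_on X (chi' R j)"
  by (rule C1_cont[OF C1_chi] C1_cont'[OF C1_chi])+

context slab_flow
begin

definition J :: "real \<Rightarrow> real" where "J R = integral (Q R) DW"

abbreviation E :: "real \<Rightarrow> 3 \<Rightarrow> 3 \<Rightarrow> pt \<Rightarrow> real" where
  "E R \<equiv> cut_err (chi' R) (chi'' R) w A A'"

abbreviation balance :: "real \<Rightarrow> pt \<Rightarrow> real" where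
  "balance R p \<equiv> \<Sum>i\<in>UNIV. \<Sum>j\<in>UNIV. (w' i j p - N\<^sub>h i j p) * (chi R p * w' i j p + E R i j p)"

lemma A_cont: "continuous_on layer (A i)" "continuous_on layer (A' i j)"
  using potential unfolding has_potential_def by (auto intro: C1_cont C1_cont')

lemma E_cont: "continuous_on layer (E R i j)"
proof -
  have c2: "continuous_on X (chi'' R i j)" for X i j by (rule C1_cont'[OF C1_chi'])
  show ?thesis
    unfolding cut_err_def[abs_def]
    by (cases "i = 1"; cases "i = 2"; simp; intro continuous_intros chi'_cont c2 A_cont C1_cont[OF C1w])
qed

lemma energy: "R > 0 \<Longrightarrow> integral (Q R) (balance R) = 0"
  by (rule energy_identity[OF _ C1w potential w_div w_boundary w_weak])

lemma energy_cont: "continuous_on layer (balance R)"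
  by (intro continuous_intros C1_cont'[OF C1w] Nh_cont chi_cont E_cont)

lemma balance_le:
  assumes "(f has_integral I) (Q R)" "R > 0" "\<And>p. p \<in> Q R \<Longrightarrow> f p \<le> balance R p"
  shows "I \<le> 0"
  using has_integral_le[OF assms(1) Q_has_integral[OF energy_cont] assms(3)] energy[OF assms(2)] by simp

lemma Q_const_has_integral: "R \<ge> 0 \<Longrightarrow> ((\<lambda>p. c) has_integral c * (4 * R\<^sup>2)) (Q R)" for c :: real
  using Q_has_integral[OF continuous_on_const, of c R] by (simp only: integral_Q_const)

lemma theta_cont: "continuous_on layer \<theta>"
  unfolding \<theta>_def[abs_def] by (intro continuous_intros column_cont DW_cont)

lemma chiDW_cont: "continuous_on layer (\<lambda>p. chi R p * DW p)"
  by (intro continuous_intros chi_cont DW_cont)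

lemma J_nonneg: "0 \<le> J R"
  unfolding J_def by (intro integral_nonneg Q_integrable DW_cont DW_nonneg)

lemma J_mono: "r \<le> R \<Longrightarrow> J r \<le> J R"
  unfolding J_def by (intro integral_subset_le Q_mono Q_integrable DW_cont ballI DW_nonneg)

lemma integral_theta_sq: "integral (Q R) (\<lambda>p. (\<theta> p)\<^sup>2) = J R"
  unfolding theta_sq J_def by (rule integral_brick_column[OF DW_cont])

lemma theta_sq_has_integral: "((\<lambda>p. (\<theta> p)\<^sup>2) has_integral J R) (Q R)"
  using Q_has_integral[of "\<lambda>p. (\<theta> p)\<^sup>2" R] by (simp add: integral_theta_sq continuous_intros theta_cont)

lemma J_half:
  assumes "R \<ge> 1" shows "J (R / 2) \<le> 10 * integral (Q R) (\<lambda>p. chi R p * DW p)"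
proof -
  have "J (R / 2) \<le> integral (Q (R / 2)) (\<lambda>p. 10 * (chi R p * DW p))"
    unfolding J_def
  proof (intro integral_le Q_integrable DW_cont continuous_intros chi_cont)
    fix p assume "p \<in> Q (R / 2)"
    from chi_lower[OF _ this] have "1 * DW p \<le> 10 * chi R p * DW p"
      using assms by (intro mult_right_mono DW_nonneg) auto
    then show "DW p \<le> 10 * (chi R p * DW p)" by simp
  qed
  also have "\<dots> \<le> integral (Q R) (\<lambda>p. 10 * (chi R p * DW p))"
    by (intro integral_subset_le Q_mono Q_integrable continuous_intros chi_cont DW_cont ballI)
      (use assms chi_bounds DW_nonneg in auto)
  finally show ?thesis by simp
qed

lemma sum9: "(\<Sum>i\<in>(UNIV::3 set). \<Sum>j\<in>(UNIV::3 set). c) = 9 * (c::real)"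
  by simp

lemma DW_chi_sum: "(\<Sum>i\<in>UNIV. \<Sum>j\<in>UNIV. c * (w' i j p)\<^sup>2) = c * DW p"
  by (simp add: DW_def sum_distrib_left)

text \<open>If the horizontal derivatives of \<open>v\<close> are bounded, then so are \<open>w\<close>, \<open>A\<close> and \<open>DA\<close>: vertical derivatives of the
  potential are again built from \<open>w\<close> and \<open>\<psi>\<close>.  Only \<open>\<eta>|Dw|\<close> is uncontrolled in the energy identity,
  and it is absorbed by \<open>\<eta>\<^sup>2|Dw|\<^sup>2\<close>.\<close>

lemma crude_bound:
  assumes n: "\<And>i j p. p \<in> layer \<Longrightarrow> \<bar>N\<^sub>h i j p\<bar> \<le> n"
    and D: "\<And>i j p. p \<in> layer \<Longrightarrow> j \<noteq> 3 \<Longrightarrow> \<bar>v' i j p\<bar> \<le> D"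
  shows "\<exists>K. \<forall>R\<ge>1. J R \<le> K * R\<^sup>2"
proof -
  define k where "k = 3 * (2 * M + 2 * D) + 6 * (H * M)"
  have z: "(0::pt) \<in> layer" by (simp add: layer_def zero_prod_def)
  have n0: "0 \<le> n" using n[OF z, of 1 1] by simp
  have k0: "0 \<le> k" using sup_bounds(1)[OF z D, of 1] by (simp add: k_def)
  define s where "s = n + 200 * k"
  have "J R \<le> 5760 * s\<^sup>2 * R\<^sup>2" if R: "R \<ge> 1" for R
  proof -
    define r where "r = 2 * R"
    have r: "r \<ge> 1" using R by (simp add: r_def)
    have pw: "(\<Sum>i\<in>UNIV. \<Sum>j\<in>UNIV. (1/2 * chi r p) * (w' i j p)\<^sup>2 - 2 * s\<^sup>2) \<le>
       balance r p"
      if p: "p \<in> Q r" for p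
    proof (intro sum_mono, goal_cases)
      case (1 i j)
      note pl = brick_layer[OF p]
      define a N0 x c where "a = w' i j p" and "N0 = N\<^sub>h i j p" and "x = E r i j p" and "c = eta r p"
      have c: "0 \<le> c" "c \<le> 1" using eta_bounds[OF r p] by (auto simp: c_def)
      have "\<bar>x\<bar> \<le> 200 / r * c * k"
        unfolding x_def c_def k_def
        by (rule cut_err_bound[OF r p]) (rule sup_bounds[OF pl D]; assumption)+
      also have "\<dots> \<le> 200 * c * k"
        using r c k0 by (intro mult_right_mono) (auto simp: field_simps)
      finally have x: "\<bar>x\<bar> \<le> 200 * c * k" .
      have N0: "\<bar>N0\<bar> \<le> n" unfolding N0_def by (rule n[OF pl])
      have "\<bar>N0 * (c\<^sup>2 * a)\<bar> \<le> n * (c * \<bar>a\<bar>)"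
        unfolding abs_mult using N0 c by (intro mult_mono) (auto simp: power2_eq_square mult_left_le_one_le)
      moreover have "\<bar>a * x\<bar> \<le> \<bar>a\<bar> * (200 * c * k)" unfolding abs_mult by (intro mult_left_mono x) auto
      moreover have "\<bar>N0 * x\<bar> \<le> n * (200 * k)"
      proof -
        have "200 * c * k \<le> 200 * k" using c k0 by (simp add: mult_left_le_one_le)
        then have "\<bar>x\<bar> \<le> 200 * k" using x by linarith
        then show ?thesis unfolding abs_mult using N0 n0 by (intro mult_mono) auto
      qed
      moreover have "s * (c * \<bar>a\<bar>) \<le> 1/2 * (c\<^sup>2 * a\<^sup>2) + s\<^sup>2 / 2"
        using zero_le_power2[of "c * \<bar>a\<bar> - s"] by (simp add: power2_eq_square algebra_simps)
      moreover have "n * (200 * k) \<le> s\<^sup>2"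
        using n0 k0 unfolding s_def power2_eq_square by (simp add: algebra_simps)
      moreover have "(a - N0) * (c\<^sup>2 * a + x) = c\<^sup>2 * a\<^sup>2 - N0 * (c\<^sup>2 * a) + a * x - N0 * x"
        by (simp add: power2_eq_square algebra_simps)
      moreover have "s * (c * \<bar>a\<bar>) = n * (c * \<bar>a\<bar>) + \<bar>a\<bar> * (200 * c * k)"
        by (simp add: s_def algebra_simps)
      ultimately have "1/2 * c\<^sup>2 * a\<^sup>2 - 2 * s\<^sup>2 \<le> (a - N0) * (c\<^sup>2 * a + x)"
        using zero_le_power2[of s] by linarith
      then show ?case
        by (simp only: chi_eta a_def N0_def x_def c_def)
    qed
    have "1/2 * integral (Q r) (\<lambda>p. chi r p * DW p) - 18 * s\<^sup>2 * (4 * r\<^sup>2) \<le> 0"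
    proof (rule balance_le)
      show "((\<lambda>p. 1/2 * (chi r p * DW p) - 18 * s\<^sup>2) has_integral
          1/2 * integral (Q r) (\<lambda>p. chi r p * DW p) - 18 * s\<^sup>2 * (4 * r\<^sup>2)) (Q r)"
        by (rule has_integral_diff[OF has_integral_mult_right[OF Q_has_integral[OF chiDW_cont]] Q_const_has_integral])
          (use r in simp)
      show "1/2 * (chi r p * DW p) - 18 * s\<^sup>2 \<le> balance r p" if "p \<in> Q r" for p
        using pw[OF that] by (simp only: sum_subtractf DW_chi_sum sum9)
    qed (use r in simp)
    moreover have "J R \<le> 10 * integral (Q r) (\<lambda>p. chi r p * DW p)"
      using J_half[OF r] by (simp add: r_def)
    moreover have "s\<^sup>2 * r\<^sup>2 = 4 * (s\<^sup>2 * R\<^sup>2)" by (simp add: r_def power2_eq_square)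
    ultimately show ?thesis by simp
  qed
  then show ?thesis by blast
qed

text \<open>The point of this bound is that it does not depend on \<open>D\<close>.  Now \<open>DA\<close> is estimated by \<open>\<theta>\<close>, so the energy over
  the doubled square reappears on the right, but with the factor
  \<open>164000/R\<close>, which is at most \<open>1/8\<close> from the stated radius on.\<close>

lemma quadratic_growth:
  assumes n: "\<And>i j p. p \<in> layer \<Longrightarrow> \<bar>N\<^sub>h i j p\<bar> \<le> n"
    and D: "\<And>i j p. p \<in> layer \<Longrightarrow> j \<noteq> 3 \<Longrightarrow> \<bar>v' i j p\<bar> \<le> D"
    and R: "R \<ge> 1312000"
  shows "J R \<le> 2 * (300000 * (n\<^sup>2 + (6 * (H * M))\<^sup>2)) * R\<^sup>2"
proof -
  define b where "b = 6 * (H * M)"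
  have z: "(0::pt) \<in> layer" by (simp add: layer_def zero_prod_def)
  have n0: "0 \<le> n" using n[OF z, of 1 1] by simp
  have b0: "0 \<le> b" using M_nonneg by (simp add: b_def H_def)
  obtain K where K: "\<And>R. R \<ge> 1 \<Longrightarrow> J R \<le> K * R\<^sup>2"
    using crude_bound[OF n D] by blast
  have step: "J R \<le> J (2 * R) / 8 + (300000 * (n\<^sup>2 + b\<^sup>2)) * R\<^sup>2" if R: "R \<ge> 1312000" for R
  proof -
    \<comment> \<open>The radius in the energy identity is doubled: the cutoff is bounded below on the square of half its size.\<close>
    define r where "r = 2 * R"
    have r: "r \<ge> 1" using R by (simp add: r_def)
    have pw: "(\<Sum>i\<in>UNIV. \<Sum>j\<in>UNIV. (1/2 * chi r p) * (w' i j p)\<^sup>2 - n\<^sup>2 / 2 -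
         200 / r * (w' i j p)\<^sup>2 - 200 / r * (n\<^sup>2 + b\<^sup>2 + 9 * (\<theta> p)\<^sup>2)) \<le>
       balance r p"
      if p: "p \<in> Q r" for p
    proof (intro sum_mono, goal_cases)
      case (1 i j)
      note pl = brick_layer[OF p]
      define a N0 x c t where "a = w' i j p" and "N0 = N\<^sub>h i j p" and "x = E r i j p" and "c = eta r p" and "t = \<theta> p"
      have c: "0 \<le> c" "c \<le> 1" using eta_bounds[OF r p] by (auto simp: c_def)
      have t: "0 \<le> t" by (simp add: t_def theta_nonneg)
      have "\<bar>x\<bar> \<le> 200 / r * c * (3 * t + b)"
        unfolding x_def c_def b_def t_def
        by (rule cut_err_bound[OF r p]) (rule theta_bounds[OF pl])+
      also have "\<dots> \<le> 200 / r * 1 * (3 * t + b)"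
        using r c t b0 by (intro mult_right_mono mult_left_mono) auto
      finally have x: "\<bar>x\<bar> \<le> 200 / r * (3 * t + b)" by simp
      have N0: "\<bar>N0\<bar> \<le> n" unfolding N0_def by (rule n[OF pl])
      have "\<bar>N0 * (c\<^sup>2 * a)\<bar> \<le> n * (c * \<bar>a\<bar>)"
        unfolding abs_mult using N0 c by (intro mult_mono) (auto simp: power2_eq_square mult_left_le_one_le)
      moreover have "n * (c * \<bar>a\<bar>) \<le> 1/2 * (c\<^sup>2 * a\<^sup>2) + n\<^sup>2 / 2"
        using zero_le_power2[of "c * \<bar>a\<bar> - n"] by (simp add: power2_eq_square algebra_simps)
      moreover have "\<bar>(a - N0) * x\<bar> \<le> 200 / r * (a\<^sup>2 + n\<^sup>2 + b\<^sup>2 + 9 * t\<^sup>2)"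
      proof -
        have "\<bar>(a - N0) * x\<bar> \<le> (\<bar>a\<bar> + n) * (200 / r * (3 * t + b))"
          unfolding abs_mult using x N0 n0 by (intro mult_mono) auto
        also have "\<dots> = 200 / r * ((\<bar>a\<bar> + n) * (3 * t + b))" by simp
        also have "(\<bar>a\<bar> + n) * (3 * t + b) \<le> a\<^sup>2 + n\<^sup>2 + b\<^sup>2 + 9 * t\<^sup>2"
          using zero_le_power2[of "(\<bar>a\<bar> + n) - (3 * t + b)"] zero_le_power2[of "\<bar>a\<bar> - n"] zero_le_power2[of "3 * t - b"]
          by (simp add: power2_eq_square algebra_simps)
        finally show ?thesis using r by (simp add: mult_left_mono divide_right_mono)
      qed
      moreover have "(a - N0) * (c\<^sup>2 * a + x) = c\<^sup>2 * a\<^sup>2 - N0 * (c\<^sup>2 * a) + (a - N0) * x"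
        by (simp add: power2_eq_square algebra_simps)
      moreover have "200 / r * (a\<^sup>2 + n\<^sup>2 + b\<^sup>2 + 9 * t\<^sup>2) = 200 / r * a\<^sup>2 + 200 / r * (n\<^sup>2 + b\<^sup>2 + 9 * t\<^sup>2)"
        by (simp add: algebra_simps)
      ultimately have "1/2 * c\<^sup>2 * a\<^sup>2 - n\<^sup>2 / 2 - 200 / r * a\<^sup>2 - 200 / r * (n\<^sup>2 + b\<^sup>2 + 9 * t\<^sup>2) \<le> (a - N0) * (c\<^sup>2 * a + x)"
        by linarith
      then show ?case
        by (simp only: chi_eta a_def N0_def x_def c_def t_def)
    qed
    define c1 where "c1 = 9 * (n\<^sup>2 / 2) + 9 * (200 / r * (n\<^sup>2 + b\<^sup>2))"
    let ?f = "\<lambda>p. 1/2 * (chi r p * DW p) - 200 / r * DW p - 16200 / r * (\<theta> p)\<^sup>2 - c1"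
    have le0: "1/2 * integral (Q r) (\<lambda>p. chi r p * DW p) - 200 / r * J r - 16200 / r * J r - c1 * (4 * r\<^sup>2) \<le> 0"
    proof (rule balance_le)
      show "(?f has_integral 1/2 * integral (Q r) (\<lambda>p. chi r p * DW p) - 200 / r * J r - 16200 / r * J r - c1 * (4 * r\<^sup>2)) (Q r)"
        by (rule has_integral_diff[OF has_integral_diff[OF has_integral_diff[OF
              has_integral_mult_right[OF Q_has_integral[OF chiDW_cont]]
              has_integral_mult_right[OF Q_has_integral[OF DW_cont, folded J_def]]]
              has_integral_mult_right[OF theta_sq_has_integral]] Q_const_has_integral]) (use r in simp)
      fix p assume "p \<in> Q r"
      have eq: "?f p = 1/2 * chi r p * DW p - 9 * (n\<^sup>2 / 2) - 200 / r * DW p - 9 * (200 / r * (n\<^sup>2 + b\<^sup>2 + 9 * (\<theta> p)\<^sup>2))"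
        by (simp add: c1_def ring_distribs add_divide_distrib)
      from pw[OF \<open>p \<in> Q r\<close>] show "?f p \<le> balance r p"
        by (simp only: eq sum_subtractf DW_chi_sum sum9)
    qed (use r in simp)
    define X q where "X = integral (Q r) (\<lambda>p. chi r p * DW p)" and "q = J r / r"
    have q: "200 / r * J r = 200 * q" "16200 / r * J r = 16200 * q" "16400 / r * J r = 16400 * q"
      by (simp_all add: q_def)
    have "J R \<le> 10 * X"
      using J_half[OF r] by (simp add: r_def X_def)
    also have "10 * X \<le> 20 * (16400 / r * J r + c1 * (4 * r\<^sup>2))"
    proof -
      define y where "y = c1 * (4 * r\<^sup>2)"
      have "1 / 2 * X - 200 * q - 16200 * q - y \<le> 0"
        using le0[folded X_def] unfolding q y_def .
      then have "10 * X \<le> 20 * (16400 * q + y)" by simp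
      then show ?thesis unfolding q y_def .
    qed
    also have "16400 / r * J r \<le> 1 / 160 * J r"
      using R J_nonneg[of r] by (intro mult_right_mono) (auto simp: r_def field_simps)
    also have "c1 * (4 * r\<^sup>2) \<le> (15000 * (n\<^sup>2 + b\<^sup>2)) * R\<^sup>2"
    proof -
      have "200 / r * (n\<^sup>2 + b\<^sup>2) \<le> 100 * (n\<^sup>2 + b\<^sup>2)"
        using R by (intro mult_right_mono) (auto simp: r_def field_simps)
      then have "c1 \<le> 9 * (n\<^sup>2 / 2) + 9 * (100 * (n\<^sup>2 + b\<^sup>2))"
        unfolding c1_def by (intro add_left_mono mult_left_mono) auto
      also have "\<dots> \<le> 15000 / 16 * (n\<^sup>2 + b\<^sup>2)" by simp
      finally have "c1 * (4 * r\<^sup>2) \<le> 15000 / 16 * (n\<^sup>2 + b\<^sup>2) * (4 * r\<^sup>2)" by (rule mult_right_mono) simp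
      also have "\<dots> = (15000 * (n\<^sup>2 + b\<^sup>2)) * R\<^sup>2" by (simp add: r_def power_mult_distrib)
      finally show ?thesis .
    qed
    finally show ?thesis unfolding r_def by (simp add: ring_distribs)
  qed
  show ?thesis
    using doubling_growth[of 1312000 J "300000 * (n\<^sup>2 + b\<^sup>2)" 2 K R] step K R by (simp add: b_def)
qed

end

section \<open>Vanishing of the energy for Navier-Stokes flows below the critical speed\<close>

text \<open>The number \<open>\<kappa>\<close> takes the place of \<open>\<pi>\<close> in Wirtinger's inequality.\<close>

locale navier_stokes_flow = slab_flow +
  fixes m \<kappa> :: real
  assumes N_eq: "\<And>i j p. N i j p = v i p * v j p"
    and speed: "\<And>p. p \<in> layer \<Longrightarrow> (\<Sum>i\<in>UNIV. (v i p)\<^sup>2) \<le> m\<^sup>2"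
    and m\<kappa>: "0 < m" "m < \<kappa>" "\<kappa> < pi"
begin

definition W2 :: "pt \<Rightarrow> real" where "W2 p = (\<Sum>i\<in>UNIV. (w i p)\<^sup>2)"

lemma Nh_eq: "N\<^sub>h i j p = v j (p + hor h) * w i p + w j p * v i p"
  by (simp add: N\<^sub>h_def N_eq w_def algebra_simps)

lemma W2_cont: "continuous_on layer W2"
  unfolding W2_def[abs_def] by (intro continuous_intros C1_cont[OF C1w])

lemma vh_cont: "continuous_on layer (\<lambda>p. v j (p + hor h))"
  by (intro continuous_shift C1_cont[OF C1v])

text \<open>Transport by the solenoidal field \<open>v(\<cdot> + h)\<close> preserves \<open>|w|\<^sup>2 / 2\<close>, so only the derivative of the cutoff
  contributes.\<close>

lemma transport_bound:
  assumes R: "R \<ge> 1"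
  shows "integral (Q R) (\<lambda>p. chi R p * (\<Sum>i\<in>UNIV. \<Sum>j\<in>UNIV. v j (p + hor h) * w i p * w' i j p)) \<le> 36 * M / R * J R"
proof -
  define V where "V j p = v j (p + hor h)" for j p
  define V' where "V' i j p = v' i j (p + hor h)" for i j p
  define S where "S p = 1/2 * (w 1 p * w 1 p + w 2 p * w 2 p + w 3 p * w 3 p)" for p
  define S' where "S' j p = 1/2 * (w' 1 j p * w 1 p + w 1 p * w' 1 j p + (w' 2 j p * w 2 p + w 2 p * w' 2 j p)
     + (w' 3 j p * w 3 p + w 3 p * w' 3 j p))" for j p
  have CS: "C1 layer S S'"
    unfolding S_def[abs_def] S'_def[abs_def]
    by (intro C1_cmult C1_add C1_mult C1w)
  have CV: "C1 layer (V j) (V' j)" for j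
    unfolding V_def[abs_def] V'_def[abs_def] by (intro C1_shift C1v)
  have C: "C1 layer (\<lambda>p. chi R p * (V j p * S p)) (\<lambda>k p. chi' R k p * (V j p * S p) + chi R p * (V' j k p * S p + V j p * S' k p))" for j
    by (intro C1_mult C1_chi CV CS)
  have z: "integral (Q R) (\<lambda>p. chi' R j p * (V j p * S p) + chi R p * (V' j j p * S p + V j p * S' j p)) = 0" for j
    by (rule integral_deriv_zero[OF C1_subset[OF C brick_sub_layer]])
      (use R in \<open>auto simp: S_def w_boundary chi_def cutoff_def\<close>)
  have cont: "continuous_on layer (\<lambda>p. chi' R j p * (V j p * S p) + chi R p * (V' j j p * S p + V j p * S' j p))" for j
    by (rule C1_cont'[OF C])
  let ?Z = "\<lambda>j p. chi' R j p * (V j p * S p) + chi R p * (V' j j p * S p + V j p * S' j p)"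
  let ?T = "\<lambda>p. chi R p * (\<Sum>i\<in>UNIV. \<Sum>j\<in>UNIV. v j (p + hor h) * w i p * w' i j p)"
  have "integral (Q R) ?T = integral (Q R) (\<lambda>p. ?T p - (\<Sum>j\<in>UNIV. ?Z j p))"
  proof -
    have "continuous_on layer ?T" by (intro continuous_intros chi_cont vh_cont C1_cont[OF C1w] C1_cont'[OF C1w])
    moreover have "integral (Q R) (\<lambda>p. \<Sum>j\<in>UNIV. ?Z j p) = 0"
      by (subst integral_sum) (auto simp: z intro!: Q_integrable cont)
    moreover have "continuous_on layer (\<lambda>p. \<Sum>j\<in>UNIV. ?Z j p)"
      by (intro continuous_on_sum cont)
    ultimately show ?thesis by (simp add: integral_diff Q_integrable)
  qed
  also have "\<dots> \<le> integral (Q R) (\<lambda>p. 36 * M / R * (\<theta> p)\<^sup>2)"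
  proof (intro integral_le Q_integrable)
    fix p assume p: "p \<in> Q R"
    note pl = brick_layer[OF p]
    have "(\<Sum>j\<in>UNIV. V' j j p) = 0" using div_free[of "p + hor h"] pl by (simp add: V'_def)
    then have d: "V' 1 1 p = - V' 2 2 p - V' 3 3 p" by (simp add: sum_3)
    have "?T p - (\<Sum>j\<in>UNIV. ?Z j p)
       = - (\<Sum>j\<in>UNIV. chi' R j p * (V j p * S p))"
    proof -
      have S': "S' j p = (\<Sum>i\<in>UNIV. w i p * w' i j p)" for j
        by (simp add: S'_def sum_3 algebra_simps)
      show ?thesis by (simp add: sum_3 S' d flip: V_def) (simp add: algebra_simps)
    qed
    also have "\<dots> \<le> \<bar>chi' R 1 p * (V 1 p * S p)\<bar> + \<bar>chi' R 2 p * (V 2 p * S p)\<bar> + \<bar>chi' R 3 p * (V 3 p * S p)\<bar>"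
      by (simp add: sum_3)
    also have "\<dots> \<le> 3 * (8 / R * (M * (3/2 * (\<theta> p)\<^sup>2)))"
    proof -
      define y where "y = 8 / R * (M * (3/2 * (\<theta> p)\<^sup>2))"
      have wt: "w i p * w i p \<le> (\<theta> p)\<^sup>2" for i
        using w_theta[OF pl, of i] theta_nonneg[of p] by (metis abs_le_square_iff abs_of_nonneg power2_eq_square)
      have S: "\<bar>S p\<bar> \<le> 3/2 * (\<theta> p)\<^sup>2" using wt[of 1] wt[of 2] wt[of 3] unfolding S_def by simp
      have VM: "\<bar>V j p\<bar> \<le> M" for j unfolding V_def using bounded[of "p + hor h" j] pl by simp
      have "\<bar>chi' R j p\<bar> \<le> 8 / R" for j
      proof -
        have "8 / R * eta R p \<le> 8 / R * 1" using eta_bounds(2)[OF R p] R by (intro mult_left_mono) auto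
        then show ?thesis using eta_bounds(3)[OF R p, of j] by simp
      qed
      then have "\<bar>chi' R j p * (V j p * S p)\<bar> \<le> y" for j
        unfolding abs_mult y_def using VM S M_nonneg R by (intro mult_mono) auto
      from this[of 1] this[of 2] this[of 3] show ?thesis unfolding y_def[symmetric] by linarith
    qed
    also have "\<dots> = 36 * M / R * (\<theta> p)\<^sup>2" by simp
    finally show "?T p - (\<Sum>j\<in>UNIV. ?Z j p) \<le> 36 * M / R * (\<theta> p)\<^sup>2" .
  qed (intro continuous_intros cont theta_cont chi_cont vh_cont C1_cont[OF C1w] C1_cont'[OF C1w])+
  also have "\<dots> = 36 * M / R * J R" by (simp add: integral_theta_sq)
  finally show ?thesis .
qed

text \<open>The cutoff is constant on vertical segments, so Wirtinger's inequality may be used there with the weight.\<close>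

lemma poincare:
  assumes R: "R \<ge> 1"
  shows "\<kappa>\<^sup>2 * integral (Q R) (\<lambda>p. chi R p * W2 p) \<le> integral (Q R) (\<lambda>p. chi R p * DW p)"
proof -
  have sub: "continuous_on (Q R) f" if "continuous_on layer f" for f :: "pt \<Rightarrow> real"
    using that continuous_on_subset[OF _ brick_sub_layer] by blast
  have "integral (Q R) (\<lambda>p. \<kappa>\<^sup>2 * (chi R p * W2 p)) \<le> integral (Q R) (\<lambda>p. chi R p * DW p)"
  proof (rule integral_brick_mono_columns)
    fix x y assume xy: "x \<in> {- R..R}" "y \<in> {- R..R}"
    define c where "c = chi R (x,y,0)"
    have c0: "0 \<le> c" using chi_bounds[OF R, of "(x,y,0)"] xy by (simp add: brick_eq c_def)
    have c: "chi R (x,y,z) = c" for z by (simp add: chi_def c_def)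
    have seg: "(\<lambda>z. f (x,y,z)) integrable_on {0..1}" if "continuous_on layer f" for f :: "pt \<Rightarrow> real"
      by (intro integrable_continuous_interval continuous_segment that)
    have one: "\<kappa>\<^sup>2 * integral {0..1} (\<lambda>z. (w i (x,y,z))\<^sup>2) \<le> integral {0..1} (\<lambda>z. (w' i 3 (x,y,z))\<^sup>2)" for i
    proof (rule wirtinger)
      show "((\<lambda>z. w i (x,y,z)) has_real_derivative w' i 3 (x,y,z)) (at z within {0..1})" if "z \<in> {0..1}" for z
      proof -
        have eq: "{t. (x,y,t) \<in> layer} = {0..1}" by (auto simp: layer_def)
        have "(x,y,z) \<in> layer" using that by (auto simp: layer_def)
        from C1_slice(3)[OF C1w[of i] this] show ?thesis unfolding eq .
      qed
      show "continuous_on {0..1} (\<lambda>z. w' i 3 (x,y,z))" by (intro continuous_segment C1_cont'[OF C1w])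
    qed (use m\<kappa> in \<open>auto simp: w_boundary\<close>)
    have "\<kappa>\<^sup>2 * integral {0..1} (\<lambda>z. W2 (x,y,z)) = (\<Sum>i\<in>UNIV. \<kappa>\<^sup>2 * integral {0..1} (\<lambda>z. (w i (x,y,z))\<^sup>2))"
      unfolding W2_def
      by (subst integral_sum) (auto simp: sum_distrib_left intro!: seg continuous_intros C1_cont[OF C1w])
    also have "\<dots> \<le> (\<Sum>i\<in>UNIV. integral {0..1} (\<lambda>z. (w' i 3 (x,y,z))\<^sup>2))" by (intro sum_mono one)
    also have "\<dots> = integral {0..1} (\<lambda>z. \<Sum>i\<in>UNIV. (w' i 3 (x,y,z))\<^sup>2)"
      by (rule integral_sum[symmetric]) (auto intro!: seg continuous_intros C1_cont'[OF C1w])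
    also have "\<dots> \<le> integral {0..1} (\<lambda>z. DW (x,y,z))"
    proof (intro integral_le seg DW_cont)
      show "(\<Sum>i\<in>UNIV. (w' i 3 (x,y,z))\<^sup>2) \<le> DW (x,y,z)" for z
        unfolding DW_def by (intro sum_mono member_le_sum) auto
    qed (intro continuous_intros C1_cont'[OF C1w])
    finally have "c * (\<kappa>\<^sup>2 * integral {0..1} (\<lambda>z. W2 (x,y,z))) \<le> c * integral {0..1} (\<lambda>z. DW (x,y,z))"
      by (intro mult_left_mono c0)
    then show "integral {0..1} (\<lambda>z. \<kappa>\<^sup>2 * (chi R (x,y,z) * W2 (x,y,z))) \<le> integral {0..1} (\<lambda>z. chi R (x,y,z) * DW (x,y,z))"
      by (simp add: c mult_ac)
  qed (intro sub continuous_intros chi_cont W2_cont DW_cont)+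
  then show ?thesis by simp
qed

text \<open>Young's inequality with weights \<open>\<kappa>\<close> and \<open>1/\<kappa>\<close>; after Wirtinger's inequality both terms become
  \<open>m / (2\<kappa>)\<close> times the energy, which leaves the factor \<open>1 - m/\<kappa> > 0\<close>.\<close>

lemma convection_pointwise:
  assumes p: "p \<in> layer"
  shows "(\<Sum>i\<in>UNIV. \<Sum>j\<in>UNIV. w j p * v i p * w' i j p) \<le> m * \<kappa> / 2 * W2 p + m / (2 * \<kappa>) * DW p"
proof -
  have "w j p * v i p * w' i j p \<le> \<kappa> / (2 * m) * ((w j p)\<^sup>2 * (v i p)\<^sup>2) + m / (2 * \<kappa>) * (w' i j p)\<^sup>2" for i j
  proof -
    define s where "s = w j p * v i p"
    define a where "a = \<kappa> / m"
    have a: "a > 0" using m\<kappa> by (simp add: a_def)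
    have "0 \<le> (a * s - w' i j p)\<^sup>2 / (2 * a)" using a by simp
    also have "\<dots> = a / 2 * s\<^sup>2 + 1 / (2 * a) * (w' i j p)\<^sup>2 - s * w' i j p"
      using a by (simp add: power2_eq_square divide_simps) (simp add: algebra_simps)
    finally have "s * w' i j p \<le> a / 2 * s\<^sup>2 + 1 / (2 * a) * (w' i j p)\<^sup>2" by simp
    moreover have "a / 2 = \<kappa> / (2 * m)" "1 / (2 * a) = m / (2 * \<kappa>)" by (simp_all add: a_def)
    ultimately show ?thesis by (simp add: s_def power_mult_distrib)
  qed
  then have "(\<Sum>i\<in>UNIV. \<Sum>j\<in>UNIV. w j p * v i p * w' i j p) \<le>
     (\<Sum>i\<in>UNIV. \<Sum>j\<in>UNIV. \<kappa> / (2 * m) * ((w j p)\<^sup>2 * (v i p)\<^sup>2) + m / (2 * \<kappa>) * (w' i j p)\<^sup>2)"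
    by (intro sum_mono)
  also have "\<dots> = \<kappa> / (2 * m) * (W2 p * (\<Sum>i\<in>UNIV. (v i p)\<^sup>2)) + m / (2 * \<kappa>) * DW p"
    by (simp add: sum.distrib W2_def DW_def sum_distrib_left sum_distrib_right)

  also have "\<dots> \<le> \<kappa> / (2 * m) * (W2 p * m\<^sup>2) + m / (2 * \<kappa>) * DW p"
    using speed[OF p] m\<kappa> by (intro add_right_mono mult_left_mono) (auto simp: W2_def sum_nonneg)
  also have "\<kappa> / (2 * m) * (W2 p * m\<^sup>2) = m * \<kappa> / 2 * W2 p" using m\<kappa> by (simp add: power2_eq_square)
  finally show ?thesis .
qed

definition C\<^sub>0 :: real where
  "C\<^sub>0 = 36 * M + 200 * (1 + 9 * (4 * M\<^sup>2 + 5) + 9 * (6 * (H * M)) + 18 * (6 * (H * M)) * M)"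

lemma C0_nonneg: "0 \<le> C\<^sub>0"
  using M_nonneg by (simp add: C\<^sub>0_def H_def)

definition L :: "pt \<Rightarrow> real" where "L p = sqrt (DW p) + \<theta> p"

lemma L_cont: "continuous_on layer L"
  unfolding L_def[abs_def] by (intro continuous_intros DW_cont theta_cont)

text \<open>Every term here carries a derivative of the cutoff and hence the factor \<open>1/R\<close>.  The part \<open>L\<close> of first order
  comes from the stream function, which is bounded but not small.\<close>

lemma remainder_pointwise:
  assumes R: "R \<ge> 1" and p: "p \<in> Q R"
  shows "- (\<Sum>i\<in>UNIV. \<Sum>j\<in>UNIV. (w' i j p - N\<^sub>h i j p) * E R i j p) \<le>
     (C\<^sub>0 - 36 * M) / R * (DW p + (\<theta> p)\<^sup>2 + L p)"
proof -
  define b t where "b = 6 * (H * M)" and "t = \<theta> p"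
  note pl = brick_layer[OF p]
  have b0: "0 \<le> b" using M_nonneg by (simp add: b_def H_def)
  have t: "0 \<le> t" by (simp add: t_def theta_nonneg)
  have one: "- ((w' i j p - N\<^sub>h i j p) * E R i j p) \<le> 200 / R * ((w' i j p)\<^sup>2 + (4 * M\<^sup>2 + 5) * t\<^sup>2 + b * (sqrt (DW p) + 2 * M * t))" for i j
  proof -
    define a N0 x where "a = w' i j p" and "N0 = N\<^sub>h i j p" and "x = E R i j p"
    have "\<bar>x\<bar> \<le> 200 / R * eta R p * (3 * t + b)"
      unfolding x_def b_def t_def by (rule cut_err_bound[OF R p]) (rule theta_bounds[OF pl])+
    also have "\<dots> \<le> 200 / R * 1 * (3 * t + b)"
      using R eta_bounds[OF R p] t b0 by (intro mult_right_mono mult_left_mono) auto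
    finally have x: "\<bar>x\<bar> \<le> 200 / R * (3 * t + b)" by simp
    have "\<bar>v j (p + hor h) * w i p\<bar> \<le> M * t" "\<bar>w j p * v i p\<bar> \<le> t * M"
      unfolding abs_mult t_def using bounded[OF pl] bounded[of "p + hor h"] pl w_theta[OF pl] M_nonneg theta_nonneg[of p]
      by (intro mult_mono; simp)+
    then have N0: "\<bar>N0\<bar> \<le> 2 * M * t"
      unfolding N0_def Nh_eq
      using abs_triangle_ineq[of "v j (p + hor h) * w i p" "w j p * v i p"] by (simp add: mult.commute[of t])
    have a: "\<bar>a\<bar> \<le> sqrt (DW p)" unfolding a_def using w'_DW[of i j p] by (simp add: real_le_rsqrt)
    have "- ((a - N0) * x) \<le> \<bar>a - N0\<bar> * \<bar>x\<bar>" unfolding abs_mult[symmetric] by simp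
    also have "\<dots> \<le> (\<bar>a\<bar> + 2 * M * t) * (200 / R * (3 * t + b))"
      using x N0 M_nonneg t by (intro mult_mono) auto
    also have "\<dots> = 200 / R * ((\<bar>a\<bar> + 2 * M * t) * (3 * t + b))" by simp
    also have "\<dots> \<le> 200 / R * (a\<^sup>2 + (4 * M\<^sup>2 + 5) * t\<^sup>2 + b * (sqrt (DW p) + 2 * M * t))"
    proof (intro mult_left_mono)
      have "(\<bar>a\<bar> + 2 * M * t) * (3 * t) \<le> a\<^sup>2 + (4 * M\<^sup>2 + 5) * t\<^sup>2"
      proof -
        define y where "y = \<bar>a\<bar> + 2 * M * t"
        have "y * (3 * t) \<le> 1/2 * y\<^sup>2 + 9/2 * t\<^sup>2"
          using zero_le_power2[of "y - 3 * t"] by (simp add: power2_eq_square algebra_simps)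
        moreover have "y\<^sup>2 \<le> 2 * a\<^sup>2 + 8 * (M\<^sup>2 * t\<^sup>2)"
          using zero_le_power2[of "\<bar>a\<bar> - 2 * M * t"] unfolding y_def by (simp add: power2_eq_square algebra_simps)
        moreover have "(4 * M\<^sup>2 + 5) * t\<^sup>2 = 4 * (M\<^sup>2 * t\<^sup>2) + 5 * t\<^sup>2" by (simp add: algebra_simps)
        ultimately show ?thesis unfolding y_def[symmetric] using zero_le_power2[of t] by linarith
      qed
      moreover have "(\<bar>a\<bar> + 2 * M * t) * b \<le> (sqrt (DW p) + 2 * M * t) * b"
        using a b0 by (intro mult_right_mono) auto
      ultimately show "(\<bar>a\<bar> + 2 * M * t) * (3 * t + b) \<le> a\<^sup>2 + (4 * M\<^sup>2 + 5) * t\<^sup>2 + b * (sqrt (DW p) + 2 * M * t)"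
        by (simp add: algebra_simps)
    qed (use R in auto)
    finally show ?thesis by (simp only: a_def N0_def x_def)
  qed
  have "- (\<Sum>i\<in>UNIV. \<Sum>j\<in>UNIV. (w' i j p - N\<^sub>h i j p) * E R i j p) =
     (\<Sum>i\<in>UNIV. \<Sum>j\<in>UNIV. - ((w' i j p - N\<^sub>h i j p) * E R i j p))"
    by (simp only: sum_negf)
  also have "\<dots> \<le> (\<Sum>i\<in>UNIV. \<Sum>j\<in>UNIV. 200 / R * ((w' i j p)\<^sup>2 + (4 * M\<^sup>2 + 5) * t\<^sup>2 + b * (sqrt (DW p) + 2 * M * t)))"
    by (intro sum_mono one)
  also have "\<dots> = 200 / R * (DW p + 9 * ((4 * M\<^sup>2 + 5) * t\<^sup>2) + 9 * (b * (sqrt (DW p) + 2 * M * t)))"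
  proof -
    have "(\<Sum>i\<in>UNIV. \<Sum>j\<in>UNIV. (w' i j p)\<^sup>2 + c + d) = DW p + 9 * c + 9 * d" for c d
      by (simp add: sum.distrib DW_def)
    then show ?thesis by (simp only: sum_distrib_left[symmetric])
  qed
  also have "\<dots> \<le> 200 / R * ((1 + 9 * (4 * M\<^sup>2 + 5) + 9 * b + 18 * b * M) * (DW p + t\<^sup>2 + L p))"
  proof (intro mult_left_mono)
    define s where "s = sqrt (DW p)"
    define X where "X = DW p + t\<^sup>2 + (s + t)"
    have s: "0 \<le> s" "0 \<le> DW p" using DW_nonneg by (auto simp: s_def)
    have X: "DW p \<le> X" "t\<^sup>2 \<le> X" "s \<le> X" "t \<le> X" using s t by (auto simp: X_def add_increasing2)
    have "9 * ((4 * M\<^sup>2 + 5) * t\<^sup>2) \<le> 9 * ((4 * M\<^sup>2 + 5) * X)" "9 * b * s \<le> 9 * b * X" "18 * b * M * t \<le> 18 * b * M * X"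
      using X b0 M_nonneg by (auto intro!: mult_left_mono)
    then have "DW p + 9 * ((4 * M\<^sup>2 + 5) * t\<^sup>2) + 9 * (b * (s + 2 * M * t)) \<le> X + 9 * ((4 * M\<^sup>2 + 5) * X) + 9 * b * X + 18 * b * M * X"
      using X(1) by (simp add: ring_distribs)
    also have "\<dots> = (1 + 9 * (4 * M\<^sup>2 + 5) + 9 * b + 18 * b * M) * X" by (simp add: ring_distribs)
    finally show "DW p + 9 * ((4 * M\<^sup>2 + 5) * t\<^sup>2) + 9 * (b * (sqrt (DW p) + 2 * M * t)) \<le>
       (1 + 9 * (4 * M\<^sup>2 + 5) + 9 * b + 18 * b * M) * (DW p + t\<^sup>2 + L p)"
      by (simp only: s_def X_def L_def t_def)
  qed (use R in auto)
  also have "\<dots> = (C\<^sub>0 - 36 * M) / R * (DW p + (\<theta> p)\<^sup>2 + L p)"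
    by (simp add: C\<^sub>0_def t_def b_def)
  finally show ?thesis .
qed

text \<open>The critical estimate: all terms without the factor \<open>1/R\<close> have been absorbed because \<open>m < \<kappa>\<close>.\<close>

lemma decay_estimate:
  assumes R: "R \<ge> 1"
  shows "(1 - m / \<kappa>) * J (R / 2) \<le> 10 * (2 * C\<^sub>0 / R * (J R + integral (Q R) L))"
proof -
  define X where "X = integral (Q R) (\<lambda>p. chi R p * DW p)"
  define Y where "Y = integral (Q R) (\<lambda>p. chi R p * W2 p)"
  let ?I = "\<lambda>p. balance R p"
  let ?T = "\<lambda>p. chi R p * (\<Sum>i\<in>UNIV. \<Sum>j\<in>UNIV. v j (p + hor h) * w i p * w' i j p)"
  let ?D = "\<lambda>p. DW p + (\<theta> p)\<^sup>2 + L p"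
  let ?F = "\<lambda>p. ?I p + ?T p + (m * \<kappa> / 2 * (chi R p * W2 p) + m / (2 * \<kappa>) * (chi R p * DW p)) + (C\<^sub>0 - 36 * M) / R * ?D p"
  have pw: "chi R p * DW p \<le> ?F p" if p: "p \<in> Q R" for p
  proof -
    note pl = brick_layer[OF p]
    have term_eq: "(w' i j p - N\<^sub>h i j p) * (chi R p * w' i j p + E R i j p) =
       chi R p * (w' i j p)\<^sup>2 - chi R p * (v j (p + hor h) * w i p * w' i j p) - chi R p * (w j p * v i p * w' i j p)
       + (w' i j p - N\<^sub>h i j p) * E R i j p" for i j
      by (simp add: Nh_eq power2_eq_square algebra_simps)
    have "?I p = chi R p * DW p - ?T p - chi R p * (\<Sum>i\<in>UNIV. \<Sum>j\<in>UNIV. w j p * v i p * w' i j p)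
       + (\<Sum>i\<in>UNIV. \<Sum>j\<in>UNIV. (w' i j p - N\<^sub>h i j p) * E R i j p)"
      by (simp only: term_eq sum.distrib sum_subtractf sum_distrib_left[symmetric] DW_def)
    moreover have "chi R p * (\<Sum>i\<in>UNIV. \<Sum>j\<in>UNIV. w j p * v i p * w' i j p) \<le> chi R p * (m * \<kappa> / 2 * W2 p + m / (2 * \<kappa>) * DW p)"
      by (intro mult_left_mono convection_pointwise pl) (use chi_bounds[OF R p] in auto)
    moreover have "chi R p * (m * \<kappa> / 2 * W2 p + m / (2 * \<kappa>) * DW p) =
        m * \<kappa> / 2 * (chi R p * W2 p) + m / (2 * \<kappa>) * (chi R p * DW p)" by (simp add: algebra_simps)
    moreover note remainder_pointwise[OF R p]
    ultimately show ?thesis by linarith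
  qed
  note i = Q_has_integral[of _ R]
  have Tc: "continuous_on layer ?T" by (intro continuous_intros chi_cont vh_cont C1_cont[OF C1w] C1_cont'[OF C1w])
  note it = theta_sq_has_integral[of R]
  have iI: "(?I has_integral 0) (Q R)" using i[OF energy_cont[of R]] energy[of R] R by simp
  have "(?F has_integral 0 + integral (Q R) ?T + (m * \<kappa> / 2 * Y + m / (2 * \<kappa>) * X) + (C\<^sub>0 - 36 * M) / R * (J R + J R + integral (Q R) L)) (Q R)"
    unfolding X_def Y_def
    by (intro has_integral_add has_integral_mult_right iI i[OF Tc] it i[OF DW_cont, folded J_def] i[OF L_cont] i
        continuous_intros chi_cont W2_cont DW_cont)
  then have "X \<le> 0 + integral (Q R) ?T + (m * \<kappa> / 2 * Y + m / (2 * \<kappa>) * X) + (C\<^sub>0 - 36 * M) / R * (J R + J R + integral (Q R) L)"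
    unfolding X_def by (rule has_integral_le[OF i[OF chiDW_cont]]) (rule pw)
  moreover have "m * \<kappa> / 2 * Y \<le> m / (2 * \<kappa>) * X"
  proof -
    have "m / (2 * \<kappa>) * (\<kappa>\<^sup>2 * Y) \<le> m / (2 * \<kappa>) * X"
      unfolding X_def Y_def using m\<kappa> by (intro mult_left_mono poincare R) auto
    then show ?thesis using m\<kappa> by (simp add: power2_eq_square)
  qed
  moreover define q l where "q = J R / R" and "l = integral (Q R) L / R"
  have L0: "0 \<le> L p" for p using theta_nonneg DW_nonneg by (simp add: L_def)
  have ql: "0 \<le> q" "0 \<le> l"
    unfolding q_def l_def using J_nonneg R L0
    by (auto intro!: divide_nonneg_nonneg integral_nonneg Q_integrable L_cont)
  have "36 * M / R * J R = 36 * M * q" "(C\<^sub>0 - 36 * M) / R * (J R + J R + integral (Q R) L) = (C\<^sub>0 - 36 * M) * (2 * q + l)"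
    "2 * C\<^sub>0 / R * (J R + integral (Q R) L) = 2 * C\<^sub>0 * (q + l)"
    by (simp_all add: q_def l_def add_divide_distrib diff_divide_distrib ring_distribs)
  moreover have "m / \<kappa> * X = 2 * (m / (2 * \<kappa>) * X)" by simp
  moreover have "0 \<le> 36 * M * q + (C\<^sub>0 + 36 * M) * l"
    using ql M_nonneg C0_nonneg by simp
  moreover have "36 * M * q + (C\<^sub>0 - 36 * M) * (2 * q + l) + (36 * M * q + (C\<^sub>0 + 36 * M) * l) = 2 * C\<^sub>0 * (q + l)"
    by (simp add: algebra_simps)
  ultimately have "X - m / \<kappa> * X \<le> 2 * C\<^sub>0 / R * (J R + integral (Q R) L)"
    using transport_bound[OF R] by linarith
  then have X: "10 * (X - m / \<kappa> * X) \<le> 10 * (2 * C\<^sub>0 / R * (J R + integral (Q R) L))"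
    by (rule mult_left_mono) simp
  have "(1 - m / \<kappa>) * J (R / 2) \<le> (1 - m / \<kappa>) * (10 * X)"
    unfolding X_def using m\<kappa> by (intro mult_left_mono J_half R) (auto simp: field_simps)
  also have "(1 - m / \<kappa>) * (10 * X) = 10 * (X - m / \<kappa> * X)" by (simp add: algebra_simps)
  also note X
  finally show ?thesis .
qed

lemma J_vanishes:
  assumes growth: "\<And>R. R \<ge> R0 \<Longrightarrow> J R \<le> K * R\<^sup>2"
  shows "J R = 0"
proof -
  define C where "C = 20 * C\<^sub>0 / (1 - m / \<kappa>)"
  have a: "0 < 1 - m / \<kappa>" using m\<kappa> by simp
  have C0: "0 \<le> C" using C0_nonneg a by (simp add: C_def)
  have decay: "J R \<le> C / (2 * R) * (J (2 * R) + integral (Q (2 * R)) L)" if "R \<ge> 1" for R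
  proof -
    have "J R * (1 - m / \<kappa>) \<le> 10 * (2 * C\<^sub>0 / (2 * R) * (J (2 * R) + integral (Q (2 * R)) L))"
      using decay_estimate[of "2 * R"] that by (simp add: mult.commute)
    then have "J R \<le> 10 * (2 * C\<^sub>0 / (2 * R) * (J (2 * R) + integral (Q (2 * R)) L)) / (1 - m / \<kappa>)"
      by (simp only: pos_le_divide_eq[OF a])
    also have "\<dots> = C / (2 * R) * (J (2 * R) + integral (Q (2 * R)) L)"
    proof -
      have "10 * (2 * c / (2 * R) * S) / b = 20 * c / b / (2 * R) * S" for b c S
        by simp
      then show ?thesis unfolding C_def .
    qed
    finally show ?thesis .
  qed
  note i = Q_has_integral
  note it = theta_sq_has_integral
  define R1 where "R1 = Max {1, R0, 8 * C}"
  have R1: "R1 \<ge> 1" "R1 \<ge> R0" "R1 \<ge> 8 * C" by (simp_all add: R1_def)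
  \<comment> \<open>Young's inequality turns the linear term into a small multiple of the energy and a constant.\<close>
  have step: "J R \<le> J (2 * R) / 8 + 64 * C\<^sup>2 * R ^ 0" if R: "R \<ge> R1" for R
  proof -
    have R': "R \<ge> 1" using R R1 by simp
    define y where "y = C / (2 * R)"
    have y16: "0 \<le> y" "y \<le> 1/16" using R R1 R' C0 by (auto simp: y_def field_simps)
    have "y * L p \<le> 1/32 * DW p + 1/32 * (\<theta> p)\<^sup>2 + 16 * y\<^sup>2" for p
    proof -
      define s t where "s = sqrt (DW p)" and "t = \<theta> p"
      have "DW p = s\<^sup>2" using DW_nonneg by (simp add: s_def)
      moreover have "y * (s + t) \<le> 1/32 * s\<^sup>2 + 1/32 * t\<^sup>2 + 16 * y\<^sup>2"
      proof -
        have "y * (s + t) \<le> 1/64 * (s + t)\<^sup>2 + 16 * y\<^sup>2"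
          using zero_le_power2[of "(s + t) - 32 * y"] by (simp add: power2_eq_square algebra_simps)
        moreover have "(s + t)\<^sup>2 \<le> 2 * s\<^sup>2 + 2 * t\<^sup>2"
          using zero_le_power2[of "s - t"] by (simp add: power2_eq_square algebra_simps)
        ultimately show ?thesis by linarith
      qed
      ultimately show ?thesis by (simp add: L_def s_def t_def)
    qed
    moreover have "((\<lambda>p. 16 * y\<^sup>2) has_integral 16 * y\<^sup>2 * (4 * (2 * R)\<^sup>2)) (Q (2 * R))"
      by (rule Q_const_has_integral) (use R' in simp)
    then have "((\<lambda>p. 1/32 * DW p + 1/32 * (\<theta> p)\<^sup>2 + 16 * y\<^sup>2) has_integral
        1/32 * J (2 * R) + 1/32 * J (2 * R) + 16 * y\<^sup>2 * (4 * (2 * R)\<^sup>2)) (Q (2 * R))"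
      by (intro has_integral_add has_integral_mult_right it i[OF DW_cont, folded J_def])
    ultimately have "y * integral (Q (2 * R)) L \<le> 1/32 * J (2 * R) + 1/32 * J (2 * R) + 16 * y\<^sup>2 * (4 * (2 * R)\<^sup>2)"
      by (intro has_integral_le[OF has_integral_mult_right[OF i[OF L_cont]]])
    moreover have "16 * y\<^sup>2 * (4 * (2 * R)\<^sup>2) = 64 * C\<^sup>2"
      using R' by (simp add: y_def power2_eq_square)
    moreover have "y * J (2 * R) \<le> 1/16 * J (2 * R)" using y16 J_nonneg by (intro mult_right_mono)
    moreover have "J R \<le> y * J (2 * R) + y * integral (Q (2 * R)) L"
      using decay[OF R'] unfolding y_def by (simp only: distrib_left)
    ultimately have "J R \<le> J (2 * R) / 8 + 64 * C\<^sup>2" by linarith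
    then show ?thesis by simp
  qed
  have bounded: "J R \<le> 128 * C\<^sup>2" for R
  proof -
    have "J R \<le> J (max R R1)" by (rule J_mono) simp
    also have "\<dots> \<le> 2 * (64 * C\<^sup>2) * (max R R1) ^ 0"
      by (rule doubling_growth[of R1 J "64 * C\<^sup>2" 0 K]) (use step growth R1 in auto)
    finally show ?thesis by simp
  qed
  \<comment> \<open>With bounded energy, the linear term of the decay estimate is of lower order.\<close>
  have "J R \<le> 0"
  proof (rule field_le_epsilon)
    fix \<epsilon> :: real assume \<epsilon>: "0 < \<epsilon>"
    let ?f = "\<lambda>p. DW p + (\<theta> p)\<^sup>2"
    have fc: "continuous_on layer ?f" by (intro continuous_intros DW_cont theta_cont)
    have fi: "(?f has_integral J R + J R) (Q R)" for R
      by (intro has_integral_add it i[OF DW_cont, folded J_def])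
    define \<tau> where "\<tau> = \<epsilon> / (4 * (C + 1))"
    have \<tau>: "0 < \<tau>" using \<epsilon> C0 by (simp add: \<tau>_def)
    obtain R2 where R2: "R2 \<ge> 1" "\<And>R. R \<ge> R2 \<Longrightarrow> integral (Q R) (\<lambda>p. sqrt (?f p)) \<le> \<tau> * R"
    proof -
      have "\<exists>R1\<ge>1. \<forall>R\<ge>R1. integral (Q R) (\<lambda>p. sqrt (?f p)) \<le> \<tau> * R"
      proof (rule sqrt_mean_sublinear[OF fc _ _ \<tau>])
        show "integral (Q R) ?f \<le> 256 * C\<^sup>2" for R
          using integral_unique[OF fi[of R]] bounded[of R] by simp
      qed (simp add: DW_nonneg)
      then show ?thesis using that by blast
    qed
    define r where "r = Max {R, R2, 128 * C ^ 3 / \<epsilon>}"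
    have r: "r \<ge> R" "r \<ge> R2" "r \<ge> 128 * C ^ 3 / \<epsilon>" by (simp_all add: r_def)
    have r1: "r \<ge> 1" using r R2 by simp
    have "L p \<le> 2 * sqrt (?f p)" for p
    proof -
      have "sqrt (DW p) \<le> sqrt (?f p)" by simp
      moreover have "\<theta> p \<le> sqrt (?f p)" using DW_nonneg by (intro real_le_rsqrt) simp
      ultimately show ?thesis unfolding L_def by linarith
    qed
    then have "integral (Q (2 * r)) L \<le> integral (Q (2 * r)) (\<lambda>p. 2 * sqrt (?f p))"
      by (intro integral_le Q_integrable L_cont continuous_intros DW_cont theta_cont)
    also have "\<dots> \<le> 2 * (\<tau> * (2 * r))"
      using R2(2)[of "2 * r"] r r1 by simp
    finally have Li: "integral (Q (2 * r)) L \<le> 2 * (\<tau> * (2 * r))" .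
    have "J R \<le> J r" by (rule J_mono[OF r(1)])
    also have "J r \<le> C / (2 * r) * (J (2 * r) + integral (Q (2 * r)) L)" by (rule decay[OF r1])
    also have "\<dots> \<le> C / (2 * r) * (128 * C\<^sup>2 + 2 * (\<tau> * (2 * r)))"
      using Li bounded C0 r1 by (intro mult_left_mono add_mono) auto
    also have "\<dots> = 64 * C ^ 3 / r + 2 * (C * \<tau>)"
      using r1 by (simp add: field_simps power2_eq_square power3_eq_cube)
    also have "64 * C ^ 3 / r \<le> \<epsilon> / 2"
      using r(3) r1 \<epsilon> by (simp add: field_simps)
    also have "2 * (C * \<tau>) \<le> \<epsilon> / 2"
      using C0 \<epsilon> by (simp add: \<tau>_def field_simps)
    finally show "J R \<le> 0 + \<epsilon>" by simp
  qed
  with J_nonneg[of R] show ?thesis by simp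
qed

lemma translation_invariant:
  assumes growth: "\<And>R. R \<ge> R0 \<Longrightarrow> J R \<le> K * R\<^sup>2" and p: "p \<in> layer"
  shows "v i (p + hor h) = v i p"
proof -
  have DW: "DW q = 0" if q: "q \<in> layer" for q
  proof -
    obtain x y z where xyz: "q = (x,y,z)" by (cases q) auto
    define R where "R = \<bar>x\<bar> + \<bar>y\<bar> + 1"
    have qR: "q \<in> Q R" using q by (auto simp: xyz R_def brick_eq layer_def)
    have "(DW has_integral 0) (Q R)"
      using integrable_integral[OF Q_integrable[OF DW_cont], of R] J_vanishes[OF growth] by (simp add: J_def)
    moreover have "box (-R,-R,0) (R,R,1::real) \<noteq> {}"
      by (auto simp: box_ne_empty Basis_prod_def R_def)
    moreover have "continuous_on (Q R) DW" by (rule continuous_on_subset[OF DW_cont brick_sub_layer])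
    ultimately show ?thesis
      using has_integral_0_cbox_imp_0[of "(-R,-R,0)" "(R,R,1)" DW q] qR DW_nonneg unfolding brick_def by blast
  qed
  have "\<theta> p = 0"
  proof -
    obtain x y z where xyz: "p = (x,y,z)" by (cases p) auto
    have "column DW p = integral {0..1} (\<lambda>s::real. 0::real)"
      unfolding column_def by (rule integral_cong) (auto simp: xyz layer_def intro!: DW)
    then show ?thesis by (simp add: \<theta>_def)
  qed
  then show ?thesis using w_theta[OF p, of i] by (simp add: w_def)
qed

end

section \<open>Mollification in the horizontal directions\<close>

lemma continuous_avg: "continuous_on layer f \<Longrightarrow> continuous_on layer (avg h f)"
  using integral_continuous_on_param[of layer 0 1 "\<lambda>p s. f (p + s *\<^sub>R hor h)"] continuous_shift_param[of f h]
  by (simp add: avg_def[abs_def] box_real)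

lemma avg_integrable:
  fixes f :: "pt \<Rightarrow> real"
  assumes f: "continuous_on layer f" and p: "p \<in> layer"
  shows "(\<lambda>s. f (p + s *\<^sub>R hor h)) integrable_on {0..1}"
  by (intro integrable_continuous_interval continuous_on_compose2[OF f] continuous_intros) (use p in auto)

lemma avg_diff:
  assumes "continuous_on layer f" "continuous_on layer k" "p \<in> layer"
  shows "avg h (\<lambda>p. f p - k p) p = avg h f p - avg h k p"
  unfolding avg_def by (intro integral_diff avg_integrable assms)

lemma avg_sum:
  fixes f :: "3 \<Rightarrow> pt \<Rightarrow> real"
  assumes "\<And>i. continuous_on layer (f i)" "p \<in> layer"
  shows "(\<Sum>i\<in>UNIV. avg h (f i) p) = avg h (\<lambda>p. \<Sum>i\<in>UNIV. f i p) p"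
  unfolding avg_def by (intro integral_sum[symmetric] avg_integrable assms) simp

lemma avg_close:
  assumes f: "continuous_on layer f" and p: "p \<in> layer"
    and le: "\<And>s. s \<in> {0..1} \<Longrightarrow> \<bar>f (p + s *\<^sub>R hor h) - c\<bar> \<le> d"
  shows "\<bar>avg h f p - c\<bar> \<le> d"
proof -
  note i = avg_integrable[OF f p, of h]
  have ic: "(\<lambda>s. c) integrable_on {0..1::real}" by (rule integrable_const_ivl)
  have "avg h f p - c = integral {0..1} (\<lambda>s. f (p + s *\<^sub>R hor h) - c)"
    unfolding avg_def by (simp add: integral_diff[OF i ic])
  moreover have "norm (integral {0..1} (\<lambda>s. f (p + s *\<^sub>R hor h) - c)) \<le> integral {0..1} (\<lambda>s::real. d)"
    by (rule integral_norm_bound_integral[OF integrable_diff[OF i ic]]) (use le in auto)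
  ultimately show ?thesis by simp
qed

lemma weak_cong:
  assumes W: "weak_balance T" and eq: "\<And>i j p. p \<in> layer \<Longrightarrow> T i j p = T' i j p"
  shows "weak_balance T'"
  unfolding weak_balance_def
proof (intro allI impI)
  fix h a b c d \<Psi> \<Psi>' assume t: "test_field a b c d \<Psi> \<Psi>'"
  have "integral (brick a b c d) (\<lambda>p. \<Sum>i\<in>UNIV. \<Sum>j\<in>UNIV. T' i j (p + hor h) * \<Psi>' i j p) =
    integral (brick a b c d) (\<lambda>p. \<Sum>i\<in>UNIV. \<Sum>j\<in>UNIV. T i j (p + hor h) * \<Psi>' i j p)"
    by (rule integral_cong) (simp add: eq[symmetric] brick_layer)
  also have "\<dots> = 0" by (rule weak_balanceD[OF W t])
  finally show "integral (brick a b c d) (\<lambda>p. \<Sum>i\<in>UNIV. \<Sum>j\<in>UNIV. T' i j (p + hor h) * \<Psi>' i j p) = 0" .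
qed

context slab_flow
begin

text \<open>Averages of flows are flows: averaging commutes with derivatives, and the weak balance holds for every
  translate.  The average of \<open>v\<otimes>v\<close> is not the square of an average, hence the separate stress.\<close>

lemma averaged_flow:
  "slab_flow (\<lambda>i. avg d (v i)) (\<lambda>i j. avg d (v' i j)) (\<lambda>i j. avg d (N i j)) M h"
proof
  have vc: "continuous_on layer (v i)" "continuous_on layer (v' i j)" for i j
    by (rule C1_cont[OF C1v] C1_cont'[OF C1v])+
  show "C1 layer (avg d (v i)) (\<lambda>j. avg d (v' i j))" for i by (rule C1_avg[OF C1v])
  show "(\<Sum>i\<in>UNIV. avg d (v' i i) p) = 0" if "p \<in> layer" for p
  proof -
    have "(\<Sum>i\<in>UNIV. avg d (v' i i) p) = avg d (\<lambda>p. \<Sum>i\<in>UNIV. v' i i p) p"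
      by (rule avg_sum[OF vc(2) that])
    also have "\<dots> = integral {0..1} (\<lambda>s::real. 0::real)"
      unfolding avg_def by (rule integral_cong) (use that in \<open>auto intro!: div_free\<close>)
    finally show ?thesis by simp
  qed
  show "avg d (v i) (x,y,0) = 0" "avg d (v i) (x,y,1) = 0" for i x y
    by (simp_all add: avg_def hor_def no_slip)
  show "\<bar>avg d (v i) p\<bar> \<le> M" if "p \<in> layer" for i p
    by (rule avg_bound[OF vc(1) bounded that])
  show "continuous_on layer (avg d (N i j))" for i j by (rule continuous_avg[OF N_cont])
  show "weak_balance (\<lambda>i j p. avg d (v' i j) p - avg d (N i j) p)"
    by (rule weak_cong[OF weak_avg[OF _ weak, of d]])
      (auto intro!: continuous_intros vc N_cont avg_diff)
  show "fst h = 0 \<or> snd h = 0" by (rule axis)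
qed

text \<open>Averaging in both horizontal directions makes both horizontal derivatives bounded, by a constant that
  depends on \<open>\<epsilon>\<close>; the resulting growth bound does not.\<close>

lemma mollified_growth:
  assumes B: "\<And>i j p. p \<in> layer \<Longrightarrow> \<bar>N i j p\<bar> \<le> B" and \<epsilon>: "0 < \<epsilon>" and R: "R \<ge> 1312000"
  shows "slab_flow.J (\<lambda>i j. avg (0,\<epsilon>) (avg (\<epsilon>,0) (v' i j))) h R
     \<le> 2 * (300000 * ((2 * B)\<^sup>2 + (6 * (H * M))\<^sup>2)) * R\<^sup>2"
proof -
  interpret a: slab_flow "\<lambda>i. avg (\<epsilon>,0) (v i)" "\<lambda>i j. avg (\<epsilon>,0) (v' i j)" "\<lambda>i j. avg (\<epsilon>,0) (N i j)" M h
    by (rule averaged_flow)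
  interpret b: slab_flow "\<lambda>i. avg (0,\<epsilon>) (avg (\<epsilon>,0) (v i))" "\<lambda>i j. avg (0,\<epsilon>) (avg (\<epsilon>,0) (v' i j))"
    "\<lambda>i j. avg (0,\<epsilon>) (avg (\<epsilon>,0) (N i j))" M h
    by (rule a.averaged_flow)
  have D: "\<bar>avg (0,\<epsilon>) (avg (\<epsilon>,0) (v' i j)) p\<bar> \<le> 2 * M / \<epsilon>" if p: "p \<in> layer" and j: "j \<noteq> 3" for i j p
  proof -
    consider "j = 1" | "j = 2" using j exhaust_3[of j] by blast
    then show ?thesis
    proof cases
      case 1
      have "\<bar>avg (\<epsilon>,0) (v' i 1) q\<bar> \<le> 2 * M / \<epsilon>" if q: "q \<in> layer" for q
      proof -
        have "\<epsilon> * avg (\<epsilon>,0) (v' i 1) q = v i (q + hor (\<epsilon>,0)) - v i q"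
          using avg_fundamental[OF C1v[of i] q, of "(\<epsilon>,0)"] by simp
        then have "\<bar>\<epsilon> * avg (\<epsilon>,0) (v' i 1) q\<bar> \<le> 2 * M"
          using bounded[OF q, of i] bounded[of "q + hor (\<epsilon>,0)" i] q by simp
        then show ?thesis using \<epsilon> by (simp add: abs_mult field_simps)
      qed
      then show ?thesis unfolding 1
        by (rule avg_bound[OF continuous_avg[OF C1_cont'[OF C1v]] _ p])
    next
      case 2
      have "\<epsilon> * avg (0,\<epsilon>) (avg (\<epsilon>,0) (v' i 2)) p = avg (\<epsilon>,0) (v i) (p + hor (0,\<epsilon>)) - avg (\<epsilon>,0) (v i) p"
        using avg_fundamental[OF a.C1v[of i] p, of "(0,\<epsilon>)"] by simp
      then have "\<bar>\<epsilon> * avg (0,\<epsilon>) (avg (\<epsilon>,0) (v' i 2)) p\<bar> \<le> 2 * M"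
        using a.bounded[OF p, of i] a.bounded[of "p + hor (0,\<epsilon>)" i] p by simp
      then show ?thesis unfolding 2 using \<epsilon> by (simp add: abs_mult field_simps)
    qed
  qed
  have N: "\<bar>avg (0,\<epsilon>) (avg (\<epsilon>,0) (N i j)) p\<bar> \<le> B" if "p \<in> layer" for i j p
    by (intro avg_bound continuous_avg N_cont B that)
  have "\<bar>b.N\<^sub>h i j p\<bar> \<le> 2 * B" if "p \<in> layer" for i j p
    using N[OF that, of i j] N[of "p + hor h" i j] that unfolding b.N\<^sub>h_def by simp
  from b.quadratic_growth[OF this D R] show ?thesis .
qed

lemma mollification_close:
  assumes "R > 0"
  shows "\<exists>\<epsilon>>0. \<forall>p\<in>Q R. \<forall>i j. \<bar>avg (0,\<epsilon>) (avg (\<epsilon>,0) (v' i j)) p - v' i j p\<bar> \<le> 1/2"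
proof -
  define X where "X = Q (R + 1)"
  have "compact X" by (simp add: X_def brick_def)
  have "\<exists>\<delta>>0. \<forall>p\<in>X. \<forall>q\<in>X. dist q p < \<delta> \<longrightarrow> dist (v' i j q) (v' i j p) < 1/2" for i j
  proof -
    have "uniformly_continuous_on X (v' i j)"
      unfolding X_def
      by (intro compact_uniformly_continuous continuous_on_subset[OF C1_cont'[OF C1v] brick_sub_layer])
        (simp add: brick_def)
    then show ?thesis unfolding uniformly_continuous_on_def by (meson half_gt_zero zero_less_one)
  qed
  then obtain \<delta> where \<delta>: "\<And>i j. \<delta> i j > 0"
    "\<And>i j p q. p \<in> X \<Longrightarrow> q \<in> X \<Longrightarrow> dist q p < \<delta> i j \<Longrightarrow> dist (v' i j q) (v' i j p) < 1/2"
    by metis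
  define m where "m = Min (range (\<lambda>(i,j). \<delta> i j))"
  have m: "m > 0" unfolding m_def using \<delta>(1) by (subst Min_gr_iff) auto
  have m\<delta>: "m \<le> \<delta> i j" for i j
    unfolding m_def by (rule Min_le) (auto intro: rev_image_eqI[of "(i,j)"])
  define \<epsilon> where "\<epsilon> = min 1 (m / 4)"
  have \<epsilon>: "0 < \<epsilon>" "\<epsilon> \<le> 1" "\<epsilon> \<le> m / 4" using m by (auto simp: \<epsilon>_def)
  have \<epsilon>\<delta>: "2 * \<epsilon> < \<delta> i j" for i j
    using m\<delta>[of i j] \<epsilon>(3) m by linarith
  have "\<bar>avg (0,\<epsilon>) (avg (\<epsilon>,0) (v' i j)) p - v' i j p\<bar> \<le> 1/2" if p: "p \<in> Q R" for p i j
  proof (intro avg_close continuous_avg C1_cont'[OF C1v])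
    obtain x y z where xyz: "p = (x,y,z)" by (cases p) auto
    have pl: "p \<in> layer" by (rule brick_layer[OF p])
    then show "p \<in> layer" "\<And>s. p + s *\<^sub>R hor (0, \<epsilon>) \<in> layer" by auto
    fix s t :: real assume s: "s \<in> {0..1}" and t: "t \<in> {0..1}"
    let ?q = "p + s *\<^sub>R hor (0, \<epsilon>) + t *\<^sub>R hor (\<epsilon>, 0)"
    have b: "0 \<le> s * \<epsilon>" "s * \<epsilon> \<le> \<epsilon>" "0 \<le> t * \<epsilon>" "t * \<epsilon> \<le> \<epsilon>"
      using s t \<epsilon> by (auto simp: mult_left_le_one_le)
    have b1: "s * \<epsilon> \<le> 1" "t * \<epsilon> \<le> 1" using b \<epsilon> by linarith+
    have "?q \<in> X" "p \<in> X" using p b(1,3) b1 unfolding X_def xyz hor_def brick_eq by auto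
    moreover have "dist ?q p < \<delta> i j"
    proof -
      have "dist ?q p = norm (s *\<^sub>R hor (0, \<epsilon>) + t *\<^sub>R hor (\<epsilon>, 0))" by (simp add: dist_norm)
      also have "\<dots> \<le> norm (s *\<^sub>R hor (0, \<epsilon>)) + norm (t *\<^sub>R hor (\<epsilon>, 0))" by (rule norm_triangle_ineq)
      also have "\<dots> = s * \<epsilon> + t * \<epsilon>" using s t \<epsilon> by (simp add: hor_def norm_Pair)
      finally show ?thesis using b \<epsilon>\<delta>[of i j] by linarith
    qed
    ultimately have "dist (v' i j ?q) (v' i j p) < 1/2" using \<delta>(2) by blast
    then show "\<bar>v' i j ?q - v' i j p\<bar> \<le> 1/2" by (simp add: dist_real_def)
  qed
  with \<epsilon>(1) show ?thesis by blast
qed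

text \<open>For each fixed \<open>R\<close> the mollified gradient is uniformly close to the original one if \<open>\<epsilon>\<close> is small,
  so the bound for mollified flows carries over.\<close>

lemma energy_growth:
  assumes B: "\<And>i j p. p \<in> layer \<Longrightarrow> \<bar>N i j p\<bar> \<le> B"
  shows "\<exists>K. \<forall>R\<ge>1312000. J R \<le> K * R\<^sup>2"
proof -
  define K where "K = 2 * (300000 * ((2 * B)\<^sup>2 + (6 * (H * M))\<^sup>2))"
  have "J R \<le> (2 * K + 72) * R\<^sup>2" if R: "R \<ge> 1312000" for R
  proof -
    define R' where "R' = R + H"
    have H0: "0 \<le> H" by (simp add: H_def)
    obtain \<epsilon> where \<epsilon>: "0 < \<epsilon>"
      "\<And>p i j. p \<in> Q R' \<Longrightarrow> \<bar>avg (0,\<epsilon>) (avg (\<epsilon>,0) (v' i j)) p - v' i j p\<bar> \<le> 1/2"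
      using mollification_close[of R'] R H0 by (auto simp: R'_def)
    interpret a: slab_flow "\<lambda>i. avg (\<epsilon>,0) (v i)" "\<lambda>i j. avg (\<epsilon>,0) (v' i j)" "\<lambda>i j. avg (\<epsilon>,0) (N i j)" M h
      by (rule averaged_flow)
    interpret b: slab_flow "\<lambda>i. avg (0,\<epsilon>) (avg (\<epsilon>,0) (v i))" "\<lambda>i j. avg (0,\<epsilon>) (avg (\<epsilon>,0) (v' i j))"
      "\<lambda>i j. avg (0,\<epsilon>) (avg (\<epsilon>,0) (N i j))" M h
      by (rule a.averaged_flow)
    have "J R \<le> integral (Q R) (\<lambda>p. 2 * b.DW p + 18)"
      \<comment> \<open>Each of the nine entries is off by at most \<open>1\<close>, since \<open>w\<close> is a difference of two values.\<close>
      unfolding J_def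
    proof (intro integral_le Q_integrable DW_cont continuous_intros b.DW_cont)
      fix p assume p: "p \<in> Q R"
      have pR: "p \<in> Q R'" using Q_mono[of R R'] H0 p by (auto simp: R'_def)
      have pR': "p + hor h \<in> Q R'"
        using p unfolding R'_def H_def by (cases p) (auto simp: brick_eq hor_def)
      have "(w' i j p)\<^sup>2 \<le> 2 * (b.w' i j p)\<^sup>2 + 2" for i j
      proof -
        have "\<bar>b.w' i j p - w' i j p\<bar> \<le> 1"
          using \<epsilon>(2)[OF pR, of i j] \<epsilon>(2)[OF pR', of i j] unfolding b.w'_def w'_def by linarith
        then have "(b.w' i j p - w' i j p)\<^sup>2 \<le> 1" by (simp add: abs_square_le_1)
        moreover have "(w' i j p)\<^sup>2 \<le> 2 * (b.w' i j p)\<^sup>2 + 2 * (b.w' i j p - w' i j p)\<^sup>2"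
          using zero_le_power2[of "2 * b.w' i j p - w' i j p"] by (simp add: power2_eq_square algebra_simps)
        ultimately show ?thesis by linarith
      qed
      then have "DW p \<le> (\<Sum>i\<in>UNIV. \<Sum>j\<in>UNIV. 2 * (b.w' i j p)\<^sup>2 + 2)"
        unfolding DW_def by (intro sum_mono)
      also have "\<dots> = 2 * b.DW p + 18"
        by (simp add: b.DW_def sum.distrib sum_distrib_left)
      finally show "DW p \<le> 2 * b.DW p + 18" .
    qed
    also have "\<dots> = 2 * b.J R + 18 * (4 * R\<^sup>2)"
    proof (rule integral_unique)
      have "((\<lambda>p. 18) has_integral 18 * (4 * R\<^sup>2)) (Q R)"
        using integrable_integral[OF Q_integrable[OF continuous_on_const]] integral_Q_const[of R 18] R by (metis order_trans zero_le_numeral)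
      then show "((\<lambda>p. 2 * b.DW p + 18) has_integral 2 * b.J R + 18 * (4 * R\<^sup>2)) (Q R)"
        unfolding b.J_def
        by (intro has_integral_add has_integral_mult_right integrable_integral[OF Q_integrable[OF b.DW_cont]])
    qed
    also have "b.J R \<le> K * R\<^sup>2"
      using mollified_growth[OF B \<epsilon>(1) R] by (simp only: K_def)
    finally show ?thesis by (simp add: algebra_simps)
  qed
  then show ?thesis by blast
qed

end

lemma (in navier_stokes_flow) horizontally_invariant:
  assumes "p \<in> layer" shows "v i (p + hor h) = v i p"
proof -
  have "\<bar>N i j p\<bar> \<le> M * M" if "p \<in> layer" for i j p
    unfolding N_eq abs_mult using bounded[OF that] M_nonneg by (intro mult_mono) auto
  from energy_growth[OF this] obtain K where "\<And>R. R \<ge> 1312000 \<Longrightarrow> J R \<le> K * R\<^sup>2" by blast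
  from translation_invariant[OF this assms] show ?thesis .
qed

section \<open>Flows that depend on the height only\<close>

lemma C1_axis_const_deriv:
  assumes f: "C1 layer f f'" and p: "p \<in> layer" and j: "j \<noteq> 3" and c: "\<And>q. q \<in> layer \<Longrightarrow> f q = F (snd (snd q))"
  shows "f' j p = 0"
proof -
  have l: "p + s *\<^sub>R dir j \<in> layer" for s
    using p snd_snd_dir[OF j] by (cases p; cases "dir j") (auto simp: layer_def)
  then have "{s. p + s *\<^sub>R dir j \<in> layer} = UNIV" by auto
  with C1_deriv[OF f l[of 0]] have "((\<lambda>s. f (p + s *\<^sub>R dir j)) has_real_derivative f' j p) (at 0)" by simp
  moreover have "(\<lambda>s. f (p + s *\<^sub>R dir j)) = (\<lambda>s. f p)"
    using c[OF l] c[OF p] snd_snd_dir[OF j] by (auto simp: fun_eq_iff)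
  ultimately show ?thesis using DERIV_unique DERIV_const by metis
qed

lemma C1_vertical:
  assumes f: "C1 layer f f'" and z: "0 < z" "z < 1"
  shows "((\<lambda>t. f (x,y,t)) has_real_derivative f' 3 (x,y,z)) (at z)"
proof -
  have eq: "{t. (x,y,t) \<in> layer} = {0..1}" by (auto simp: layer_def)
  have "(x,y,z) \<in> layer" using z by (auto simp: layer_def)
  from C1_slice(3)[OF f this]
  have "((\<lambda>t. f (x,y,t)) has_real_derivative f' 3 (x,y,z)) (at z within {0..1})" unfolding eq .
  moreover have "at z within {0..1} = at z"
    by (rule at_within_interior) (use z in \<open>simp add: interior_atLeastAtMost_real\<close>)
  ultimately show ?thesis by (simp only:)
qed

lemma constant_second_derivative:
  fixes f f' :: "real \<Rightarrow> real"
  assumes c: "continuous_on {0..1} f" and bd: "f 0 = 0" "f 1 = 0"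
    and f: "\<And>z. 0 < z \<Longrightarrow> z < 1 \<Longrightarrow> (f has_real_derivative f' z) (at z)"
    and f': "\<And>z. 0 < z \<Longrightarrow> z < 1 \<Longrightarrow> (f' has_real_derivative c) (at z)"
    and z: "z \<in> {0..1}"
  shows "f z = - (c / 2) * z * (1 - z)"
proof -
  define k where "k = f' (1/2) - c * (1/2)"
  have k: "f' z = c * z + k" if "0 < z" "z < 1" for z
  proof -
    have "((\<lambda>z. f' z - c * z) has_real_derivative 0) (at t)" if "0 < t" "t < 1" for t
      using f'[OF that] by (auto intro!: derivative_eq_intros)
    then have d: "((\<lambda>z. f' z - c * z) has_real_derivative 0) (at t within {0<..<1})" if "t \<in> {0<..<1}" for t
      using that by (auto intro: has_field_derivative_at_within)
    obtain C where "\<And>t. t \<in> {0<..<1} \<Longrightarrow> f' t - c * t = C"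
      using has_field_derivative_zero_constant[of "{0<..<1}" "\<lambda>z. f' z - c * z", OF _ d] by auto
    from this[of z] this[of "1/2"] that show ?thesis by (simp add: k_def)
  qed
  define G where "G = (\<lambda>z. f z - c / 2 * z\<^sup>2 - k * z)"
  have Gc: "continuous_on {0..1} G" unfolding G_def by (intro continuous_intros c)
  have "(G has_real_derivative 0) (at t)" if "0 < t" "t < 1" for t
    unfolding G_def using f[OF that] k[OF that] by (auto intro!: derivative_eq_intros)
  then have G: "G t = G 0" if "t \<in> {0..1}" for t
    using DERIV_isconst2[of 0 1 G t] Gc that by auto
  have "G 0 = 0" by (simp add: G_def bd)
  moreover have "G 1 = - c / 2 - k" by (simp add: G_def bd)
  ultimately have "k = - c / 2" using G[of 1] by simp
  moreover have "f z = c / 2 * z\<^sup>2 + k * z" using G[OF z] \<open>G 0 = 0\<close> by (simp add: G_def)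
  moreover define a where "a = c / 2"
  then have "c = 2 * a" by simp
  ultimately have "f z = a * z\<^sup>2 - a * z" by simp
  then show ?thesis unfolding a_def[symmetric] by (simp add: power2_eq_square algebra_simps)
qed

text \<open>By invariance under translations along both axes, \<open>u\<close> depends on the height only.  The third component vanishes
  because its vertical derivative does.  The momentum equation then reads \<open>\<partial>\<^sub>kP = u\<^sub>k''\<close>, with \<open>\<partial>\<^sub>3P = 0\<close>.
  Hence \<open>u\<^sub>k''(z)\<close> is the increment of the pressure over a unit step in direction \<open>k\<close>, which is
  the same at all heights.\<close>

lemma liouville_coordinates:
  assumes u: "\<And>i. C1 layer (u i) (u' i)" and u': "\<And>i j. C1 layer (u' i j) (u'' i j)"
    and P: "C1 layer P P'"
    and ns: "\<And>i p. p \<in> layer \<Longrightarrow> - (\<Sum>j\<in>UNIV. u'' i j j p) + (\<Sum>j\<in>UNIV. u j p * u' i j p) + P' i p = 0"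
    and div: "\<And>p. p \<in> layer \<Longrightarrow> (\<Sum>i\<in>UNIV. u' i i p) = 0"
    and no_slip: "\<And>i x y. u i (x,y,0) = 0" "\<And>i x y. u i (x,y,1) = 0"
    and speed: "\<And>p. p \<in> layer \<Longrightarrow> (\<Sum>i\<in>UNIV. (u i p)\<^sup>2) \<le> m\<^sup>2" and m: "0 < m" "m < pi"
  shows "\<exists>c1 c2. \<forall>x y z. (x,y,z) \<in> layer \<longrightarrow>
     u 1 (x,y,z) = c1 * z * (1 - z) \<and> u 2 (x,y,z) = c2 * z * (1 - z) \<and> u 3 (x,y,z) = 0"
proof -
  have bdd: "\<bar>u i p\<bar> \<le> m" if "p \<in> layer" for i p
  proof -
    have "(u i p)\<^sup>2 \<le> (\<Sum>i\<in>UNIV. (u i p)\<^sup>2)" by (rule member_le_sum) auto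
    with speed[OF that] have "(u i p)\<^sup>2 \<le> m\<^sup>2" by linarith
    then show ?thesis using m by (simp add: abs_le_square_iff[symmetric])
  qed
  have inv: "u i (p + hor h) = u i p" if "fst h = 0 \<or> snd h = 0" "p \<in> layer" for i p h
  proof -
    interpret navier_stokes_flow u u' "\<lambda>i j p. u i p * u j p" m h m "(m + pi) / 2"
    proof
      show "weak_balance (\<lambda>i j p. u' i j p - u i p * u j p)"
        by (rule navier_stokes_weak[OF u u' P ns div])
      show "continuous_on layer (\<lambda>p. u i p * u j p)" for i j
        by (intro continuous_intros C1_cont[OF u])
    qed (use u div no_slip speed m bdd that in auto)
    show ?thesis by (rule horizontally_invariant[OF that(2)])
  qed
  have z: "u i q = u i (0, 0, snd (snd q))" if q: "q \<in> layer" for i q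
  proof -
    obtain x y z where xyz: "q = (x,y,z)" by (cases q) auto
    have l: "(0,0,z) \<in> layer" using q by (auto simp: xyz layer_def)
    have "u i ((0,0,z) + hor (x,0) + hor (0,y)) = u i (0,0,z)"
      using inv[of "(0,y)" "(0,0,z) + hor (x,0)" i] inv[of "(x,0)" "(0,0,z)" i] l by simp
    then show ?thesis by (simp add: xyz hor_def)
  qed
  have u'0: "u' i j p = 0" if "p \<in> layer" "j \<noteq> 3" for i j p
    by (rule C1_axis_const_deriv[OF u that z])
  have u''0: "u'' i j j p = 0" if "p \<in> layer" "j \<noteq> 3" for i j p
    by (rule C1_axis_const_deriv[OF u' that, of i j "\<lambda>z. 0"]) (rule u'0[OF _ that(2)])
  have u'33: "u' 3 3 p = 0" if "p \<in> layer" for p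
    using div[OF that] u'0[OF that, of 1 1] u'0[OF that, of 2 2] by (simp add: sum_3)
  have u3: "u 3 p = 0" if p: "p \<in> layer" for p
  proof -
    obtain x y z where xyz: "p = (x,y,z)" by (cases p) auto
    have zz: "z \<le> 1" using p by (auto simp: xyz layer_def)
    have "u 3 p = prim (u' 3 3) p" using prim_fundamental[OF u no_slip(1) p] by simp
    also have "\<dots> = integral {0..z} (\<lambda>s::real. 0::real)"
      unfolding prim_def xyz fst_conv snd_conv
      by (rule integral_cong) (use zz in \<open>auto intro!: u'33 simp: layer_def\<close>)
    finally show ?thesis by simp
  qed
  have conv: "(\<Sum>j\<in>UNIV. u j p * u' i j p) = 0" if "p \<in> layer" for i p
    using u'0[OF that] u3[OF that] by (simp add: sum_3)
  have ns': "P' i p = u'' i 3 3 p" if "p \<in> layer" for i p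
    using ns[OF that, of i] conv[OF that, of i] u''0[OF that] by (simp add: sum_3)
  have P3: "P' 3 (x,y,z) = 0" if zz: "0 < z" "z < 1" for x y z
  proof -
    have l: "(x,y,t) \<in> layer" if "0 < t" "t < 1" for t using that by (auto simp: layer_def)
    have "((\<lambda>t. u' 3 3 (x,y,t)) has_real_derivative u'' 3 3 3 (x,y,z)) (at z)"
      by (rule C1_vertical[OF u' zz])
    moreover have "((\<lambda>t. u' 3 3 (x,y,t)) has_real_derivative 0) (at z)"
      by (rule has_field_derivative_transform_within_open[where S = "{0<..<1}" and f = "\<lambda>t. 0"])
        (use zz u'33 l in auto)
    ultimately have "u'' 3 3 3 (x,y,z) = 0" by (rule DERIV_unique)
    then show ?thesis using ns'[of "(x,y,z)" 3] l[OF zz] by simp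
  qed
  have Pz: "P (x,y,z) = P (x,y,1/2)" if "0 < z" "z < 1" for x y z
  proof -
    have "\<exists>C. \<forall>t\<in>{0<..<1}. P (x,y,t) = C"
    proof (rule has_field_derivative_zero_constant)
      fix t :: real assume "t \<in> {0<..<1}"
      then show "((\<lambda>t. P (x,y,t)) has_real_derivative 0) (at t within {0<..<1})"
        using C1_vertical[OF P, of t x y] P3[of t x y] by (auto intro: has_field_derivative_at_within)
    qed auto
    then obtain C where "\<forall>t\<in>{0<..<1}. P (x,y,t) = C" by blast
    then show ?thesis using that by simp
  qed
  have u'z: "u' i 3 (x,y,z) = u' i 3 (0,0,z)" if "0 < z" "z < 1" for i x y z
  proof -
    have "((\<lambda>t. u i (0,0,t)) has_real_derivative u' i 3 (x,y,z)) (at z)"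
    proof (rule has_field_derivative_transform_within_open[OF C1_vertical[OF u that], where S = "{0<..<1}"])
      show "u i (x,y,t) = u i (0,0,t)" if "t \<in> {0<..<1}" for t
        using z[of "(x,y,t)" i] that by (simp add: layer_def)
    qed (use that in auto)
    then show ?thesis using C1_vertical[OF u that] by (rule DERIV_unique)
  qed
  have u''z: "u'' i 3 3 (x,y,z) = u'' i 3 3 (0,0,z)" if "0 < z" "z < 1" for i x y z
  proof -
    have "((\<lambda>t. u' i 3 (0,0,t)) has_real_derivative u'' i 3 3 (x,y,z)) (at z)"
    proof (rule has_field_derivative_transform_within_open[OF C1_vertical[OF u' that], where S = "{0<..<1}"])
      show "u' i 3 (x,y,t) = u' i 3 (0,0,t)" if "t \<in> {0<..<1}" for t
        using u'z[of t i x y] that by simp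
    qed (use that in auto)
    then show ?thesis using C1_vertical[OF u' that] by (rule DERIV_unique)
  qed
  have const: "u'' k 3 3 (0,0,z) = u'' k 3 3 (0,0,1/2)" if k: "k \<noteq> 3" and zz: "0 < z" "z < 1" for k z
  proof -
    have diff: "P ((0,0,z) + dir k) - P (0,0,z) = u'' k 3 3 (0,0,z)" if zz: "0 < z" "z < 1" for z
    proof -
      define G where "G = (\<lambda>s. P ((0,0,z) + s *\<^sub>R dir k) - u'' k 3 3 (0,0,z) * s)"
      obtain a b where ab: "dir k = (a,b,0)" using snd_snd_dir[OF k] by (cases "dir k") auto
      have l: "(0,0,z) + s *\<^sub>R dir k \<in> layer" for s using zz by (auto simp: ab layer_def)
      then have U: "{s. (0,0,z) + s *\<^sub>R dir k \<in> layer} = UNIV" by auto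
      have "((\<lambda>s. P ((0,0,z) + s *\<^sub>R dir k)) has_real_derivative u'' k 3 3 (0,0,z)) (at s)" for s
        using C1_deriv[OF P l[of s]] ns'[OF l[of s], of k] u''z[OF zz, of k "s * a" "s * b"]
        unfolding U by (simp add: ab)
      then have "(G has_real_derivative 0) (at s)" for s
        unfolding G_def by (auto intro!: derivative_eq_intros)
      then have "G 1 = G 0" using DERIV_isconst_all[of G] by blast
      then show ?thesis by (simp add: G_def)
    qed
    obtain a b where ab: "dir k = (a,b,0)" using snd_snd_dir[OF k] by (cases "dir k") auto
    show ?thesis
      using diff[OF zz] diff[of "1/2"] Pz[OF zz, of a b] Pz[OF zz, of 0 0] by (simp add: ab)
  qed
  have final: "u k (x,y,z) = - (u'' k 3 3 (0,0,1/2) / 2) * z * (1 - z)" if k: "k \<noteq> 3" and q: "(x,y,z) \<in> layer" for k x y z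
  proof -
    have "u k (0,0,z) = - (u'' k 3 3 (0,0,1/2) / 2) * z * (1 - z)"
    proof (rule constant_second_derivative[where f = "\<lambda>z. u k (0,0,z)" and f' = "\<lambda>z. u' k 3 (0,0,z)"])
      show "continuous_on {0..1} (\<lambda>z. u k (0,0,z))" by (rule continuous_segment[OF C1_cont[OF u]])
      show "((\<lambda>z. u k (0,0,z)) has_real_derivative u' k 3 (0,0,z)) (at z)" if "0 < z" "z < 1" for z
        by (rule C1_vertical[OF u that])
      show "((\<lambda>z. u' k 3 (0,0,z)) has_real_derivative u'' k 3 3 (0,0,1/2)) (at z)" if "0 < z" "z < 1" for z
        using C1_vertical[OF u' that, of k 3 0 0] const[OF k that] by simp
    qed (use q no_slip in \<open>auto simp: layer_def\<close>)
    with z[OF q, of k] show ?thesis by simp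
  qed
  show ?thesis
    by (rule exI[of _ "- (u'' 1 3 3 (0,0,1/2) / 2)"], rule exI[of _ "- (u'' 2 3 3 (0,0,1/2) / 2)"])
      (use final[of 1] final[of 2] u3 in auto)
qed

section \<open>From the slab in Euclidean space to coordinates\<close>

definition vec3 :: "pt \<Rightarrow> real^3" where
  "vec3 p = fst p *\<^sub>R axis 1 1 + fst (snd p) *\<^sub>R axis 2 1 + snd (snd p) *\<^sub>R axis 3 1"

lemma vec3_nth [simp]: "vec3 p $ 1 = fst p" "vec3 p $ 2 = fst (snd p)" "vec3 p $ 3 = snd (snd p)"
  by (simp_all add: vec3_def axis_def)

lemma vec3_of_nth: "vec3 (x $ 1, x $ 2, x $ 3) = x"
  by (simp add: vec_eq_iff forall_3)

lemma vec3_dir: "vec3 (p + t *\<^sub>R dir j) = vec3 p + t *\<^sub>R axis j 1"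
  using exhaust_3[of j] by (auto simp: vec3_def algebra_simps)

lemma vec3_closed_slab [simp]: "vec3 p \<in> closed_slab \<longleftrightarrow> p \<in> layer"
  by (cases p) (auto simp: closed_slab_def layer_def)

lemma continuous_vec3: "continuous_on X vec3"
  unfolding vec3_def by (intro continuous_intros)

lemma open_slab: "open slab"
  unfolding slab_def by (intro open_Collect_conj open_Collect_less continuous_intros)

lemma slab_at_within: "x \<in> slab \<Longrightarrow> at x within closed_slab = at x"
proof (rule at_within_open_subset)
  show "open slab" by (rule open_slab)
qed (auto simp: slab_def closed_slab_def)

lemma C1_of_Ck:
  fixes f :: "real^3 \<Rightarrow> 'b::real_normed_vector" and L :: "'b \<Rightarrow> real"
  assumes f: "Ck_on 1 closed_slab f" and L: "bounded_linear L"
  shows "C1 layer (\<lambda>p. L (f (vec3 p))) (\<lambda>j p. L (frechet_derivative f (at (vec3 p) within closed_slab) (axis j 1)))"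
proof (rule C1I)
  let ?D = "\<lambda>x. frechet_derivative f (at x within closed_slab)"
  have d: "f differentiable_on closed_slab" and c: "\<And>v. continuous_on closed_slab (\<lambda>x. ?D x v)"
    using f by simp_all
  have Lc: "continuous_on UNIV L" by (rule linear_continuous_on[OF L])
  have comp: "continuous_on layer (\<lambda>p. L (g (vec3 p)))" if "continuous_on closed_slab g" for g
    by (rule continuous_on_compose2[OF Lc continuous_on_compose2[OF that continuous_vec3]]) auto
  show "continuous_on layer (\<lambda>p. L (f (vec3 p)))" by (rule comp[OF differentiable_imp_continuous_on[OF d]])
  show "\<And>j. continuous_on layer (\<lambda>p. L (?D (vec3 p) (axis j 1)))" by (rule comp[OF c])
  fix j p t assume t: "p + t *\<^sub>R dir j \<in> layer"
  let ?U = "{s. p + s *\<^sub>R dir j \<in> layer}"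
  let ?g = "\<lambda>s. vec3 (p + s *\<^sub>R dir j)"
  have g: "(?g has_derivative (\<lambda>s. s *\<^sub>R axis j 1)) (at t within ?U)"
    unfolding vec3_dir by (auto intro!: derivative_eq_intros)
  have "(f has_derivative ?D (?g t)) (at (?g t) within closed_slab)"
    using d t by (simp add: differentiable_on_def frechet_derivative_works)
  then have fd: "(f has_derivative ?D (?g t)) (at (?g t) within ?g ` ?U)"
    by (rule has_derivative_subset) auto
  have "((\<lambda>s. L (f (?g s))) has_derivative (\<lambda>s. L (?D (?g t) (s *\<^sub>R axis j 1)))) (at t within ?U)"
    by (rule bounded_linear.has_derivative[OF L has_derivative_in_compose[OF g fd]])
  moreover have "L (?D (?g t) (s *\<^sub>R axis j 1)) = L (?D (?g t) (axis j 1)) * s" for s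
    using has_derivative_bounded_linear[OF fd] L
    by (simp add: linear_simps bounded_linear.linear linear_scale)
  ultimately show "((\<lambda>s. L (f (?g s))) has_real_derivative L (?D (?g t) (axis j 1))) (at t within ?U)"
    by (simp add: has_field_derivative_def)
qed

text \<open>The equations are given in the open slab only; their terms are continuous up to the walls.\<close>

lemma layer_extension:
  assumes f: "continuous_on layer f" and z: "\<And>x y z. 0 < z \<Longrightarrow> z < 1 \<Longrightarrow> f (x,y,z) = (0::real)" and p: "p \<in> layer"
  shows "f p = 0"
proof -
  obtain x y z where xyz: "p = (x,y,z)" by (cases p) auto
  have cl: "closure {0<..<1::real} = {0..1}" by simp
  have "continuous_on (closure {0<..<1}) (\<lambda>z. f (x,y,z))"
    unfolding cl by (rule continuous_segment[OF f])
  from continuous_constant_on_closure[OF this, of 0 z] show ?thesis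
    using z p unfolding cl by (auto simp: xyz layer_def)
qed

lemma partial_deriv_slab:
  "x \<in> slab \<Longrightarrow> partial_deriv j f x = frechet_derivative f (at x within closed_slab) (axis j 1)"
  by (simp add: partial_deriv_def slab_at_within)

lemma second_partial_deriv_slab:
  fixes f :: "real^3 \<Rightarrow> 'b::real_normed_vector"
  assumes x: "x \<in> slab" and d: "(\<lambda>x. frechet_derivative f (at x within closed_slab) (axis j 1)) differentiable_on closed_slab"
  shows "partial_deriv k (partial_deriv j f) x =
    frechet_derivative (\<lambda>x. frechet_derivative f (at x within closed_slab) (axis j 1)) (at x within closed_slab) (axis k 1)"
proof -
  let ?g = "\<lambda>x. frechet_derivative f (at x within closed_slab) (axis j 1)"
  have "x \<in> closed_slab" using x by (auto simp: slab_def closed_slab_def)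
  then have "(?g has_derivative frechet_derivative ?g (at x within closed_slab)) (at x)"
    using d slab_at_within[OF x] by (auto simp: differentiable_on_def frechet_derivative_works)
  then have "(partial_deriv j f has_derivative frechet_derivative ?g (at x within closed_slab)) (at x)"
    by (rule has_derivative_transform_within_open[OF _ open_slab x]) (simp add: partial_deriv_slab)
  from frechet_derivative_at[OF this] show ?thesis by (simp add: partial_deriv_def)
qed

theorem theorem1p3:
  fixes u :: "real^3 \<Rightarrow> real^3"
  assumes "smooth_slab_solution u"
    and "no_slip u"
    and "Linf_norm slab u < ereal pi"
  shows "poiseuille_flow u"
proof -
  obtain P where su: "smooth_on closed_slab u" and sP: "smooth_on closed_slab P"
    and ns: "steady_navier_stokes_on slab u P"
    using assms(1) by (auto simp: smooth_slab_solution_def)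
  define D where "D j x = frechet_derivative u (at x within closed_slab) (axis j 1)" for j x
  define U where "U i p = u (vec3 p) $ i" for i p
  define U' where "U' i j p = D j (vec3 p) $ i" for i j p
  define U'' where "U'' i j k p = frechet_derivative (D j) (at (vec3 p) within closed_slab) (axis k 1) $ i" for i j k p
  define p' where "p' j p = frechet_derivative P (at (vec3 p) within closed_slab) (axis j 1)" for j p
  have Ck: "Ck_on k closed_slab u" "Ck_on k closed_slab P" for k
    using su sP by (simp_all add: smooth_on_def)
  have D1: "Ck_on 1 closed_slab (D j)" for j
    using Ck(1)[of "Suc (Suc 0)"] by (simp add: D_def[abs_def])
  have CU: "C1 layer (U i) (U' i)" for i
    using C1_of_Ck[OF Ck(1) bounded_linear_vec_nth[of i]] by (simp add: U_def[abs_def] U'_def[abs_def] D_def)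
  have CU': "C1 layer (U' i j) (U'' i j)" for i j
    using C1_of_Ck[OF D1 bounded_linear_vec_nth[of i]] by (simp add: U'_def[abs_def] U''_def[abs_def])
  have CP: "C1 layer (\<lambda>p. P (vec3 p)) p'"
    using C1_of_Ck[OF Ck(2) bounded_linear_ident] by (simp add: p'_def[abs_def])
  have slab: "vec3 (x,y,z) \<in> slab" if "0 < z" "z < 1" for x y z
    using that by (simp add: slab_def)
  have Dd: "D j differentiable_on closed_slab" for j using D1[of j] by simp
  have pd: "partial_deriv j u x = D j x" if "x \<in> slab" for j x
    using partial_deriv_slab[OF that] by (simp add: D_def)
  have pd2: "partial_deriv k (partial_deriv j u) x = frechet_derivative (D j) (at x within closed_slab) (axis k 1)"
    if "x \<in> slab" for j k x
    using second_partial_deriv_slab[OF that, of u j k] Dd[of j] by (simp add: D_def[abs_def])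
  have momentum: "- (\<Sum>j\<in>UNIV. U'' i j j p) + (\<Sum>j\<in>UNIV. U j p * U' i j p) + p' i p = 0" if "p \<in> layer" for i p
  proof (rule layer_extension[OF _ _ that])
    show "continuous_on layer (\<lambda>p. - (\<Sum>j\<in>UNIV. U'' i j j p) + (\<Sum>j\<in>UNIV. U j p * U' i j p) + p' i p)"
      by (intro continuous_intros C1_cont[OF CU] C1_cont'[OF CU] C1_cont'[OF CU'] C1_cont'[OF CP])
    fix x y z :: real assume z: "0 < z" "z < 1"
    note s = slab[OF z, of x y]
    have "(- laplacian u (vec3 (x,y,z)) + advection u u (vec3 (x,y,z)) + gradient P (vec3 (x,y,z))) $ i = 0"
      using ns s by (simp add: steady_navier_stokes_on_def)
    then show "- (\<Sum>j\<in>UNIV. U'' i j j (x,y,z)) + (\<Sum>j\<in>UNIV. U j (x,y,z) * U' i j (x,y,z)) + p' i (x,y,z) = 0"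
      by (simp add: laplacian_def advection_def gradient_def pd[OF s] pd2[OF s] partial_deriv_slab[OF s, of _ P]
          U_def U'_def U''_def p'_def)
  qed
  have solenoidal: "(\<Sum>i\<in>UNIV. U' i i p) = 0" if "p \<in> layer" for p
  proof (rule layer_extension[OF _ _ that])
    show "continuous_on layer (\<lambda>p. \<Sum>i\<in>UNIV. U' i i p)" by (intro continuous_intros C1_cont'[OF CU])
    fix x y z :: real assume z: "0 < z" "z < 1"
    note s = slab[OF z, of x y]
    have "partial_deriv i (\<lambda>y. u y $ i) (vec3 (x,y,z)) = U' i i (x,y,z)" for i
    proof -
      have "vec3 (x,y,z) \<in> closed_slab" using s by (auto simp: slab_def closed_slab_def)
      then have "u differentiable (at (vec3 (x,y,z)))"
        using Ck(1)[of 1] slab_at_within[OF s] unfolding differentiable_on_def by (metis Ck_on.simps(2) One_nat_def differentiable_on_def)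
      then have "(u has_derivative frechet_derivative u (at (vec3 (x,y,z)))) (at (vec3 (x,y,z)))"
        by (simp only: frechet_derivative_works)
      from bounded_linear.has_derivative[OF bounded_linear_vec_nth[of i] this]
      have "frechet_derivative (\<lambda>y. u y $ i) (at (vec3 (x,y,z))) = (\<lambda>v. frechet_derivative u (at (vec3 (x,y,z))) v $ i)"
        by (rule frechet_derivative_at[symmetric])
      then show ?thesis by (simp add: partial_deriv_def U'_def D_def slab_at_within[OF s])
    qed
    moreover have "divergence u (vec3 (x,y,z)) = 0"
      using ns s by (simp add: steady_navier_stokes_on_def)
    ultimately show "(\<Sum>i\<in>UNIV. U' i i (x,y,z)) = 0"
      by (simp add: divergence_def)
  qed
  have noslip: "U i (x,y,0) = 0" "U i (x,y,1) = 0" for i x y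
    using assms(2) by (simp_all add: U_def no_slip_def)
  obtain r where r: "Linf_norm slab u < ereal r" "r < pi"
    using ereal_dense2[OF assms(3)] by auto
  define m where "m = max r 1"
  have m: "0 < m" "m < pi" using r pi_gt3 by (auto simp: m_def)
  have speed: "(\<Sum>i\<in>UNIV. (U i p)\<^sup>2) \<le> m\<^sup>2" if p: "p \<in> layer" for p
  proof -
    have "norm (u (vec3 p)) \<le> m"
    proof (cases "vec3 p \<in> slab")
      case True
      then have "ereal (norm (u (vec3 p))) \<le> Linf_norm slab u"
        unfolding Linf_norm_def by (rule SUP_upper)
      then have "ereal (norm (u (vec3 p))) < ereal r" using r(1) by (rule le_less_trans)
      then show ?thesis by (simp add: m_def)
    next
      case False
      then have "vec3 p $ 3 = 0 \<or> vec3 p $ 3 = 1" using p by (auto simp: slab_def layer_def)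
      then have "u (vec3 p) = 0" using assms(2) unfolding no_slip_def by blast
      then show ?thesis using m by simp
    qed
    then have "(norm (u (vec3 p)))\<^sup>2 \<le> m\<^sup>2" by (intro power_mono) auto
    then show ?thesis by (simp add: U_def norm_vec_def L2_set_def sum_nonneg)
  qed
  obtain c1 c2 where c: "\<And>x y z. (x,y,z) \<in> layer \<Longrightarrow>
     U 1 (x,y,z) = c1 * z * (1 - z) \<and> U 2 (x,y,z) = c2 * z * (1 - z) \<and> U 3 (x,y,z) = 0"
    using liouville_coordinates[OF CU CU' CP momentum solenoidal noslip speed m] by blast
  have "u x = vector [c1 * x $ 3 * (1 - x $ 3), c2 * x $ 3 * (1 - x $ 3), 0]" if "x \<in> closed_slab" for x
  proof -
    have "(x $ 1, x $ 2, x $ 3) \<in> layer" using that by (simp add: closed_slab_def layer_def)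
    from c[OF this] show ?thesis by (simp add: U_def vec3_of_nth vec_eq_iff forall_3)
  qed
  then show ?thesis unfolding poiseuille_flow_def by blast
qed

end
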